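(* Let $E$ be a separable Banach space, $\mathcal K\subset E$ a compact subset, $\boldsymbol{\mathcal K}=\mathcal K^{\mathbb Z_-}$, and let $\{Q(\boldsymbol\xi;\cdot),\boldsymbol\xi\in\boldsymbol{\mathcal K}\}\subset\mathcal P(E)$ be a transition probability from $\boldsymbol{\mathcal K}$ to $E$ such that $\operatorname{supp}Q(\boldsymbol\xi;\cdot)\subset\mathcal K$ for any $\boldsymbol\xi\in\boldsymbol{\mathcal K}$ and such that Hypotheses (SF) and (DLP$'$) stated in the context hold. Assume in addition the following property. (SR) For any integer $n\ge1$ and any $\delta>0$ there are a vector $\vec\xi_n=(\bar\xi_1,\dots,\bar\xi_n)\in E^n$ and an integer $s\ge0$ such that $\inf_{\boldsymbol\xi\in\boldsymbol{\mathcal K}}Q_s^n(\boldsymbol\xi;\mathcal O_\delta(\vec\xi_n))>0$. Then there is an $E$-valued stationary random process $\{\eta_k\}_{k\in\mathbb Z}$ such that the conditional measure of $\eta_1$ given the past $\{\eta_k,k\in\mathbb Z_-\}=\boldsymbol\xi$ is equal to $Q(\boldsymbol\xi;\cdot)$ for any $\boldsymbol\xi\in\mathcal E:=\operatorname{supp}\sigma$, where $\sigma=\mathcal D(\{\eta_k,k\in\mathbb Z_-\})$. Moreover, the law of the process $\{\eta_k\}$ is uniquely defined, and there are positive numbers $C$ and $\gamma$ such that, for any integers $m\ge1$ and $k\ge0$, $$\sup_{\boldsymbol\xi\in\boldsymbol{\mathcal K}}\|Q_k^m(\boldsymbol\xi;\cdot)-\boldsymbol\sigma_m\|_L^*\le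 Ce^{-\gamma k},$$ where $\boldsymbol\sigma_m\in\mathcal P(E^m)$ is the law of $(\eta_1,\dots,\eta_m)$.
   Context: Notation. $\mathcal P(Y)$: Borel probability measures on $Y$; $\mathcal D(\cdot)$: law; $\|\mu-\nu\|_{\mathrm{var}}=\sup_\Gamma|\mu(\Gamma)-\nu(\Gamma)|$; $\|\mu-\nu\|_L^*=\sup|\langle f,\mu\rangle-\langle f,\nu\rangle|$ over Lipschitz $f$ with $|f|\le1$, $\operatorname{Lip}(f)\le1$ ($E^m$ carries the sum of the norms of the components). $\mathbb Z_-=\{0,-1,-2,\dots\}$; $\boldsymbol{\mathcal K}$ carries the distance $\mathrm d(\boldsymbol\xi,\boldsymbol\xi')=\sum_{k\le0}\iota^k\|\xi_k-\xi'_k\|_E$ with a fixed $\iota>1$. For $k\ge1$, $\boldsymbol Q_k(\boldsymbol\xi;dy_1,\dots,dy_k)=Q(\boldsymbol\xi;dy_1)Q(\boldsymbol\xi_1;dy_2)\cdots Q(\boldsymbol\xi_{k-1};dy_k)$, where $\boldsymbol\xi_l=(\boldsymbol\xi,y_1,\dots,y_l)$ is the concatenation; for $k\ge0$, $m\ge1$, $Q_k^m(\boldsymbol\xi;\cdot)$ is the projection of $\boldsymbol Q_{k+m}(\boldsymbol\xi;\cdot)$ to the last $m$ components. $\mathcal O_\delta(\vec\xi_n)=B_E(\bar\xi_1,\delta)\times\cdots\times B_E(\bar\xi_n,\delta)$ (open balls). (SF) $\boldsymbol\xi\mapsto Q(\boldsymbol\xi;\cdot)$ is continuous from $\boldsymbol{\mathcal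 K}$ to $\mathcal P(\mathcal K)$ (weak topology), and there is $C>0$ with $\|Q(\boldsymbol\xi;\cdot)-Q(\boldsymbol\xi';\cdot)\|_{\mathrm{var}}\le C\,\mathrm d(\boldsymbol\xi,\boldsymbol\xi')$ for $\boldsymbol\xi,\boldsymbol\xi'\in\boldsymbol{\mathcal K}$. (DLP$'$) There is an increasing sequence of finite-dimensional subspaces $F_n\subset E$ with complementary subspaces $F_n^\dagger\subset E$ and projections $\mathsf P_n:E\to F_n$ (along $F_n^\dagger$) such that $\cup_nF_n$ is dense in $E$, the norms of $\mathsf P_n$ are bounded uniformly in $n$, and for each $n\ge1$ and $\boldsymbol\xi\in\boldsymbol{\mathcal K}$, $$Q(\boldsymbol\xi;dy)=Q_n^\dagger(\boldsymbol\xi;dy_n^\dagger)\,Q_n(\boldsymbol\xi,y_n^\dagger;dy_n),\qquad Q_n(\boldsymbol\xi,y_n^\dagger;dy_n)=\rho_n(\boldsymbol\xi,y_n^\dagger,y_n)\,\ell_n(dy_n),$$ where $y=(y_n,y_n^\dagger)$ corresponds to $E=F_n\dotplus F_n^\dagger$, $Q_n^\dagger(\boldsymbol\xi;\cdot)$ is the image of $Q(\boldsymbol\xi;\cdot)$ under $I-\mathsf P_n$, $\ell_n$ is Lebesgue measure on $F_n$, and $\rho_n:\boldsymbol{\mathcal K}\times E\to\mathbb R_+$ is Lipschitz continuous. Uniqueness of the law means: any two stationary $\mathcal K$-valued processes, each having conditional measure $Q(\boldsymbol\xi;\cdot)$ for $\boldsymbol\xi$ in the support of the law of its own past, have the same law.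 *)

theory Defs
  imports "HOL-Probability.Probability"
begin

section \<open>Pasts\<close>

text \<open>
  A one-sided past, indexed by the non-positive integers, is represented by
  \<open>\<xi> :: nat \<Rightarrow> 'a\<close>, where \<open>\<xi> j\<close> is the coordinate at time \<open>- j\<close>.
\<close>

definition past_space :: "'a set \<Rightarrow> (nat \<Rightarrow> 'a) set" where
  "past_space K = {\<xi>. \<forall>j. \<xi> j \<in> K}"

definition past_dist :: "real \<Rightarrow> (nat \<Rightarrow> 'a::real_normed_vector) \<Rightarrow> (nat \<Rightarrow> 'a) \<Rightarrow> real" where
  "past_dist \<iota> \<xi> \<xi>' = (\<Sum>\<^sub>\<infinity>j. \<iota> powi (- int j) * norm (\<xi> j - \<xi>' j))"

text \<open>
  The concatenation \<open>(\<xi>, y\<^sub>1, \<dots>, y\<^sub>l)\<close>: its coordinate at time \<open>- j\<close> is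
  \<open>y (l - j)\<close> for \<open>j < l\<close>, and after that the coordinates of \<open>\<xi>\<close> follow.
\<close>

definition past_append :: "(nat \<Rightarrow> 'a) \<Rightarrow> nat \<Rightarrow> (nat \<Rightarrow> 'a) \<Rightarrow> nat \<Rightarrow> 'a" where
  "past_append \<xi> l y = (\<lambda>j. if j < l then y (l - j) else \<xi> (j - l))"


section \<open>Measures\<close>

definition measure_support :: "'b::topological_space measure \<Rightarrow> 'b set" where
  "measure_support \<mu> = {x. \<forall>U. open U \<and> x \<in> U \<longrightarrow> emeasure \<mu> U > 0}"

text \<open>For probability measures the suprema below are over nonempty bounded sets of reals.\<close>

definition var_dist :: "'b measure \<Rightarrow> 'b measure \<Rightarrow> real" where
  "var_dist \<mu> \<nu> = (SUP \<Gamma>\<in>sets \<mu>. \<bar>measure \<mu> \<Gamma> - measure \<nu> \<Gamma>\<bar>)"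

definition dual_lip_dist :: "('b \<Rightarrow> 'b \<Rightarrow> real) \<Rightarrow> 'b measure \<Rightarrow> 'b measure \<Rightarrow> real" where
  "dual_lip_dist d \<mu> \<nu> = Sup {\<bar>integral\<^sup>L \<mu> f - integral\<^sup>L \<nu> f\<bar> | f.
      (\<forall>x\<in>space \<mu>. \<bar>f x\<bar> \<le> 1) \<and>
      (\<forall>x\<in>space \<mu>. \<forall>y\<in>space \<mu>. \<bar>f x - f y\<bar> \<le> d x y)}"

text \<open>
  The power \<open>E\<^sup>m\<close> is rendered as the space of \<open>\<Pi>\<^sub>M i\<in>{1..m}. borel\<close>, with the distance
  coming from the sum of the norms of the components.
\<close>

definition power_dist ::
    "nat \<Rightarrow> (nat \<Rightarrow> 'a::real_normed_vector) \<Rightarrow> (nat \<Rightarrow> 'a) \<Rightarrow> real" where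
  "power_dist m x y = (\<Sum>i\<in>{1..m}. norm (x i - y i))"


section \<open>The transition probabilities\<close>

text \<open>
  \<open>Q \<xi>\<close> is only meaningful for \<open>\<xi> \<in> past_space K\<close>.  In order to have a kernel that is measurable
  on all sequences, as required by \<^const>\<open>bind\<close>, it is extended by the zero measure.  This does not
  affect \<open>path_kernel\<close> below: started in \<open>past_space K\<close>, the path a.s. stays in \<open>K\<close>.
\<close>

definition zero_ext :: "((nat \<Rightarrow> 'a::topological_space) \<Rightarrow> 'a measure) \<Rightarrow> 'a set \<Rightarrow>
    (nat \<Rightarrow> 'a) \<Rightarrow> 'a measure" where
  "zero_ext Q K \<xi> = (if \<xi> \<in> past_space K then Q \<xi> else null_measure borel)"

text \<open>
  \<open>path_kernel Q K k \<xi>\<close> is the measure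
  \<open>Q(\<xi>; dy\<^sub>1) Q((\<xi>, y\<^sub>1); dy\<^sub>2) \<cdots> Q((\<xi>, y\<^sub>1, \<dots>, y\<^bsub>k-1\<^esub>); dy\<^sub>k)\<close>
  on \<open>E\<^sup>k\<close>; \<open>last_kernel Q K k m \<xi>\<close> is the projection of \<open>path_kernel Q K (k + m) \<xi>\<close> to the
  last \<open>m\<close> components.
\<close>

primrec path_kernel :: "((nat \<Rightarrow> 'a::topological_space) \<Rightarrow> 'a measure) \<Rightarrow> 'a set \<Rightarrow> nat \<Rightarrow>
    (nat \<Rightarrow> 'a) \<Rightarrow> (nat \<Rightarrow> 'a) measure" where
  "path_kernel Q K 0 \<xi> = return (\<Pi>\<^sub>M i\<in>{1..0}. borel) (\<lambda>_. undefined)"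
| "path_kernel Q K (Suc k) \<xi> =
     path_kernel Q K k \<xi> \<bind>
       (\<lambda>y. distr (zero_ext Q K (past_append \<xi> k y)) (\<Pi>\<^sub>M i\<in>{1..Suc k}. borel)
              (\<lambda>z. y(Suc k := z)))"

definition last_kernel :: "((nat \<Rightarrow> 'a::topological_space) \<Rightarrow> 'a measure) \<Rightarrow> 'a set \<Rightarrow> nat \<Rightarrow> nat \<Rightarrow>
    (nat \<Rightarrow> 'a) \<Rightarrow> (nat \<Rightarrow> 'a) measure" where
  "last_kernel Q K k m \<xi> =
     distr (path_kernel Q K (k + m) \<xi>) (\<Pi>\<^sub>M i\<in>{1..m}. borel) (\<lambda>y. \<lambda>i\<in>{1..m}. y (k + i))"


section \<open>Hypotheses\<close>

text \<open>
  In \<open>hyp_SF\<close>, the first conjunct is continuity for the weak topology: as \<open>K\<close> is compact, the test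
  functions are the continuous functions on \<open>K\<close>.
\<close>

definition hyp_SF :: "real \<Rightarrow> 'a::real_normed_vector set \<Rightarrow> ((nat \<Rightarrow> 'a) \<Rightarrow> 'a measure) \<Rightarrow> bool" where
  "hyp_SF \<iota> K Q \<longleftrightarrow>
     (\<forall>f :: 'a \<Rightarrow> real. continuous_on K f \<longrightarrow>
        continuous_map (Metric_space.mtopology (past_space K) (past_dist \<iota>)) euclideanreal
          (\<lambda>\<xi>. LINT y:K|Q \<xi>. f y)) \<and>
     (\<exists>C>0. \<forall>\<xi>\<in>past_space K. \<forall>\<xi>'\<in>past_space K.
        var_dist (Q \<xi>) (Q \<xi>') \<le> C * past_dist \<iota> \<xi> \<xi>')"

definition complementary :: "'a::real_vector set \<Rightarrow> 'a set \<Rightarrow> bool" where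
  "complementary V W \<longleftrightarrow> subspace V \<and> subspace W \<and> V \<inter> W = {0} \<and>
     (\<forall>y. \<exists>v\<in>V. \<exists>w\<in>W. y = v + w)"

text \<open>
  Lebesgue measure on a finite-dimensional subspace \<open>V\<close>, regarded as a measure on the whole space:
  the image of Lebesgue measure on \<open>\<real>\<^sup>B\<close> under the coordinate isomorphism of some basis \<open>B\<close> of \<open>V\<close>.
  The choice of the basis only affects a positive multiplicative constant.
\<close>

definition lebesgue_on_subspace :: "'a::real_normed_vector set \<Rightarrow> 'a measure \<Rightarrow> bool" where
  "lebesgue_on_subspace V leb \<longleftrightarrow>
     (\<exists>B. finite B \<and> independent B \<and> span B = V \<and>
          leb = distr (\<Pi>\<^sub>M b\<in>B. lborel) borel (\<lambda>c. \<Sum>b\<in>B. c b *\<^sub>R b))"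

text \<open>
  In \<open>hyp_DLP\<close>, a point \<open>y\<close> corresponds to the pair \<open>(w, z)\<close> with \<open>w = P n y\<close>, \<open>z = y - P n y\<close>.
  The density \<open>\<rho> n \<xi> (w + z)\<close> with respect to \<open>leb n (dw)\<close> is that of \<open>Q\<^sub>n(\<xi>, z; \<sqdot>)\<close>, and the last
  conjunct is the disintegration of \<open>Q \<xi>\<close> evaluated at the Borel set \<open>A\<close>.
\<close>

definition hyp_DLP :: "real \<Rightarrow> 'a::real_normed_vector set \<Rightarrow> ((nat \<Rightarrow> 'a) \<Rightarrow> 'a measure) \<Rightarrow> bool" where
  "hyp_DLP \<iota> K Q \<longleftrightarrow>
     (\<exists>(F :: nat \<Rightarrow> 'a set) (Fd :: nat \<Rightarrow> 'a set) (P :: nat \<Rightarrow> 'a \<Rightarrow> 'a)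
        (leb :: nat \<Rightarrow> 'a measure) (\<rho> :: nat \<Rightarrow> (nat \<Rightarrow> 'a) \<Rightarrow> 'a \<Rightarrow> real).
        (\<forall>n\<ge>1. F n \<subseteq> F (Suc n)) \<and>
        (\<forall>n\<ge>1. complementary (F n) (Fd n)) \<and>
        (\<forall>n\<ge>1. \<forall>y. P n y \<in> F n \<and> y - P n y \<in> Fd n) \<and>
        closure (\<Union>n\<in>{1..}. F n) = UNIV \<and>
        (\<exists>c. \<forall>n\<ge>1. bounded_linear (P n) \<and> onorm (P n) \<le> c) \<and>
        (\<forall>n\<ge>1. lebesgue_on_subspace (F n) (leb n)) \<and>
        (\<forall>n\<ge>1. \<forall>\<xi>\<in>past_space K. \<forall>y. \<rho> n \<xi> y \<ge> 0) \<and>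
        (\<forall>n\<ge>1. \<exists>L. \<forall>\<xi>\<in>past_space K. \<forall>\<xi>'\<in>past_space K. \<forall>y y'.
           \<bar>\<rho> n \<xi> y - \<rho> n \<xi>' y'\<bar> \<le> L * (past_dist \<iota> \<xi> \<xi>' + norm (y - y'))) \<and>
        (\<forall>n\<ge>1. \<forall>\<xi>\<in>past_space K. \<forall>A\<in>sets borel.
           emeasure (Q \<xi>) A =
             (\<integral>\<^sup>+z. emeasure (density (leb n) (\<lambda>w. ennreal (\<rho> n \<xi> (w + z)))) {w. w + z \<in> A}
                \<partial>distr (Q \<xi>) borel (\<lambda>y. y - P n y))))"

definition hyp_SR :: "'a::real_normed_vector set \<Rightarrow> ((nat \<Rightarrow> 'a) \<Rightarrow> 'a measure) \<Rightarrow> bool" where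
  "hyp_SR K Q \<longleftrightarrow>
     (\<forall>n\<ge>1. \<forall>\<delta>>0. \<exists>(x :: nat \<Rightarrow> 'a) s.
        (INF \<xi>\<in>past_space K.
           measure (last_kernel Q K s n \<xi>) (\<Pi>\<^sub>E i\<in>{1..n}. ball (x i) \<delta>)) > 0)"


section \<open>Stationary processes\<close>

definition process_law :: "'w measure \<Rightarrow> (int \<Rightarrow> 'w \<Rightarrow> 'a::topological_space) \<Rightarrow> (int \<Rightarrow> 'a) measure" where
  "process_law M \<eta> = distr M (\<Pi>\<^sub>M k\<in>UNIV. borel) (\<lambda>\<omega> k. \<eta> k \<omega>)"

definition stationary_process :: "'w measure \<Rightarrow> (int \<Rightarrow> 'w \<Rightarrow> 'a::topological_space) \<Rightarrow> bool" where
  "stationary_process M \<eta> \<longleftrightarrow> prob_space M \<and> (\<forall>k. \<eta> k \<in> borel_measurable M) \<and>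
     (\<forall>n. process_law M (\<lambda>k. \<eta> (k + n)) = process_law M \<eta>)"

definition past_of :: "(int \<Rightarrow> 'w \<Rightarrow> 'a) \<Rightarrow> 'w \<Rightarrow> nat \<Rightarrow> 'a" where
  "past_of \<eta> \<omega> = (\<lambda>j. \<eta> (- int j) \<omega>)"

definition past_law :: "'w measure \<Rightarrow> (int \<Rightarrow> 'w \<Rightarrow> 'a::topological_space) \<Rightarrow> (nat \<Rightarrow> 'a) measure" where
  "past_law M \<eta> = distr M borel (past_of \<eta>)"

definition regular_cond_distr ::
    "'w measure \<Rightarrow> ('w \<Rightarrow> 'b::topological_space) \<Rightarrow> ('w \<Rightarrow> 'a::topological_space) \<Rightarrow>
     ('b \<Rightarrow> 'a measure) \<Rightarrow> bool" where
  "regular_cond_distr M X Y \<kappa> \<longleftrightarrow> \<kappa> \<in> borel \<rightarrow>\<^sub>M prob_algebra borel \<and>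
     (\<forall>A\<in>sets borel. \<forall>B\<in>sets borel.
        emeasure M {\<omega>\<in>space M. X \<omega> \<in> A \<and> Y \<omega> \<in> B} =
          (\<integral>\<^sup>+x\<in>A. emeasure (\<kappa> x) B \<partial>distr M borel X))"

text \<open>
  The support of the law of the past has to be contained in \<open>past_space K\<close>, where \<open>Q\<close> is given.
  A conditional measure being determined only almost surely, the requirement is that one version of
  it coincides with \<open>Q \<xi>\<close> at every point \<open>\<xi>\<close> of that support.
\<close>

definition has_transition ::
    "'a set \<Rightarrow> ((nat \<Rightarrow> 'a) \<Rightarrow> 'a measure) \<Rightarrow> 'w measure \<Rightarrow> (int \<Rightarrow> 'w \<Rightarrow> 'a::topological_space) \<Rightarrow> bool"
  where
  "has_transition K Q M \<eta> \<longleftrightarrow> measure_support (past_law M \<eta>) \<subseteq> past_space K \<and>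
     (\<exists>\<kappa>. regular_cond_distr M (past_of \<eta>) (\<eta> 1) \<kappa> \<and>
          (\<forall>\<xi>\<in>measure_support (past_law M \<eta>). \<kappa> \<xi> = Q \<xi>))"

definition block_law :: "'w measure \<Rightarrow> (int \<Rightarrow> 'w \<Rightarrow> 'a::topological_space) \<Rightarrow> nat \<Rightarrow> (nat \<Rightarrow> 'a) measure"
  where
  "block_law M \<eta> m = distr M (\<Pi>\<^sub>M i\<in>{1..m}. borel) (\<lambda>\<omega>. \<lambda>i\<in>{1..m}. \<eta> (int i) \<omega>)"

end

theory Submission
  imports Defs
begin

text \<open>
  Let \<open>T f \<xi> = \<integral> f (\<xi>, y) Q(\<xi>; dy)\<close>. If \<open>f\<close> has oscillation \<open>c\<close> and Lipschitz constant \<open>L\<close>, then by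
  (SF) \<open>T f\<close> has Lipschitz constant at most \<open>L / \<iota> + c C\<close>, because appending a common \<open>y\<close> divides
  distances by \<open>\<iota>\<close>. By (SR), any two copies of the chain reach, with a probability bounded
  below, a set on which \<open>f\<close> is nearly constant. Together these make a power of \<open>T\<close> a contraction for the
  Lipschitz seminorm of \<open>min 1 (\<theta> d)\<close> with \<open>\<theta>\<close> large, and \<open>T\<^sup>k f\<close> becomes constant exponentially fast.
  For \<open>f\<close> bounded and depending on the last \<open>m\<close> coordinates only, \<open>T\<^sup>m f\<close> is Lipschitz with a constant
  independent of \<open>m\<close>, so that the finite-dimensional laws converge even in total variation. The
  limits form a projective family, whose Kolmogorov extension is the stationary process; uniqueness
  follows since an invariant law integrates \<open>f\<close> and \<open>T\<^sup>k f\<close> to the same value.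
\<close>

subsection \<open>Integrals and limits of measures\<close>

text \<open>\<open>Q\<close> remembers the whole past, but the past itself is Markov: one step
  appends one state. The obstacle is that this chain never forgets completely, because the initial
  past survives unchanged behind the new coordinates; laws of entire pasts need not converge in
  total variation. Hence only functions of finitely many recent coordinates are compared. For these
  the first m steps buy a Lipschitz bound and the remaining k steps buy decay, which is why the last
  m coordinates after k + m steps are controlled by a rate in k alone.

  Nor does the Lipschitz constant contract on its own: the term c C is fed back at every step, while
  c shrinks only after a return to the small set. The weight \<theta> solves \<theta>/\<iota> + C =
  a \<theta> for some a strictly between 1/\<iota> and 1. A function with oscillation c and
  Lipschitz constant c \<theta> then gains the factor a in the latter at once, and on a set of
  \<open>d\<close>-diameter at most 1/(2 \<theta>) it oscillates by at most c/2.\<close>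

text \<open>Layer-cake argument: \<open>f\<close> is within 1/n of the average of the indicators of
  the n superlevel sets {f \<ge> i/n}, and each of these contributes at most e/n to the difference.
  Working with superlevel sets gives the constant \<open>e\<close> itself for the supremum over
  events.\<close>

lemma abs_integral_diff_le_unit:
  fixes f :: "'b \<Rightarrow> real"
  assumes mu: "prob_space \<mu>" and nu: "prob_space \<nu>" and sets: "sets \<nu> = sets \<mu>"
    and tv: "\<And>A. A \<in> sets \<mu> \<Longrightarrow> \<bar>measure \<mu> A - measure \<nu> A\<bar> \<le> e"
    and f[measurable]: "f \<in> borel_measurable \<mu>" and f01: "\<And>x. 0 \<le> f x" "\<And>x. f x \<le> 1"
  shows "\<bar>integral\<^sup>L \<mu> f - integral\<^sup>L \<nu> f\<bar> \<le> e"
proof -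
  interpret mu: prob_space \<mu> by fact
  interpret nu: prob_space \<nu> by fact
  have fn[measurable]: "f \<in> borel_measurable \<nu>"
    using f sets measurable_cong_sets by blast
  have bound: "\<bar>integral\<^sup>L \<mu> f - integral\<^sup>L \<nu> f\<bar> \<le> e + 2 / real n" if n: "n > 0" for n :: nat
  proof -
    define S where "S i = {x\<in>space \<mu>. f x \<ge> real i / real n}" for i
    have S[measurable]: "S i \<in> sets \<mu>" for i unfolding S_def by measurable
    have Sn[measurable]: "S i \<in> sets \<nu>" for i using S sets by simp
    define g where "g x = (\<Sum>i=1..n. indicator (S i) x / real n)" for x
    have g_eq: "g x = real (nat \<lfloor>f x * real n\<rfloor>) / real n" if "x \<in> space \<mu>" for x
    proof -
      have "{i\<in>{1..n}. x \<in> S i} = {1..nat \<lfloor>f x * real n\<rfloor>}"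
      proof -
        have "i \<le> n" if "real i \<le> f x * real n" for i
          using f01(2)[of x] n that
          by (metis mult_left_le_one_le f01(1) of_nat_0_le_iff of_nat_le_iff order_trans)
        moreover have "i \<le> nat \<lfloor>f x * real n\<rfloor> \<longleftrightarrow> real i \<le> f x * real n" for i
          using f01(1)[of x] by (simp add: le_nat_floor le_floor_iff nat_le_iff le_nat_iff)
        ultimately show ?thesis
          using n \<open>x \<in> space \<mu>\<close> by (auto simp: S_def field_simps)
      qed
      moreover have "g x = real (card {i\<in>{1..n}. x \<in> S i}) / real n"
        unfolding g_def sum_divide_distrib[symmetric]
        by (simp add: indicator_def sum.If_cases Int_def)
      ultimately show ?thesis by simp
    qed
    have near: "\<bar>f x - g x\<bar> \<le> 1 / real n" if "x \<in> space \<mu>" for x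
    proof -
      have "real (nat \<lfloor>f x * real n\<rfloor>) = of_int \<lfloor>f x * real n\<rfloor>"
        using f01(1)[of x] by simp
      moreover have "\<bar>f x * real n - of_int \<lfloor>f x * real n\<rfloor>\<bar> \<le> 1"
        by linarith
      ultimately show ?thesis
        using n g_eq[OF that] by (auto simp: field_simps abs_le_iff simp del: of_nat_nat; linarith)
    qed
    have gm[measurable]: "g \<in> borel_measurable \<mu>" "g \<in> borel_measurable \<nu>"
      unfolding g_def by measurable
    have "integrable \<mu> f" "integrable \<nu> f"
      using f01 by (auto intro!: mu.integrable_const_bound[where B=1] nu.integrable_const_bound[where B=1])
    moreover have gi: "integrable \<mu> g" "integrable \<nu> g"
      unfolding g_def by (auto simp: mu.emeasure_eq_measure nu.emeasure_eq_measure)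
    ultimately have d: "\<bar>integral\<^sup>L \<mu> f - integral\<^sup>L \<mu> g\<bar> \<le> 1 / real n"
      "\<bar>integral\<^sup>L \<nu> f - integral\<^sup>L \<nu> g\<bar> \<le> 1 / real n"
    proof -
      assume i: "integrable \<mu> f" "integrable \<nu> f"
      have "\<bar>\<integral>x. f x - g x \<partial>\<mu>\<bar> \<le> (\<integral>x. \<bar>f x - g x\<bar> \<partial>\<mu>)" by (rule integral_abs_bound)
      also have "\<dots> \<le> (\<integral>x. 1 / real n \<partial>\<mu>)"
        using i gi near by (intro integral_mono) auto
      finally show "\<bar>integral\<^sup>L \<mu> f - integral\<^sup>L \<mu> g\<bar> \<le> 1 / real n"
        using i gi by (simp add: mu.prob_space)
      have "\<bar>\<integral>x. f x - g x \<partial>\<nu>\<bar> \<le> (\<integral>x. \<bar>f x - g x\<bar> \<partial>\<nu>)" by (rule integral_abs_bound)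
      also have "\<dots> \<le> (\<integral>x. 1 / real n \<partial>\<nu>)"
        using i gi near sets_eq_imp_space_eq[OF sets] by (intro integral_mono) auto
      finally show "\<bar>integral\<^sup>L \<nu> f - integral\<^sup>L \<nu> g\<bar> \<le> 1 / real n"
        using i gi by (simp add: nu.prob_space)
    qed
    have "integral\<^sup>L \<mu> g = (\<Sum>i=1..n. measure \<mu> (S i) / real n)"
      "integral\<^sup>L \<nu> g = (\<Sum>i=1..n. measure \<nu> (S i) / real n)"
      unfolding g_def by (simp_all add: mu.emeasure_eq_measure nu.emeasure_eq_measure)
    then have "\<bar>integral\<^sup>L \<mu> g - integral\<^sup>L \<nu> g\<bar> = \<bar>\<Sum>i=1..n. (measure \<mu> (S i) - measure \<nu> (S i)) / real n\<bar>"
      by (simp add: sum_subtractf diff_divide_distrib)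
    also have "\<dots> \<le> (\<Sum>i=1..n. \<bar>measure \<mu> (S i) - measure \<nu> (S i)\<bar> / real n)"
      by (rule order_trans[OF sum_abs]) simp
    also have "\<dots> \<le> (\<Sum>i=1..n. e / real n)"
      using tv[OF S] by (intro sum_mono divide_right_mono) auto
    also have "\<dots> = e" using n by simp
    finally show ?thesis using d by (auto simp: abs_le_iff)
  qed
  show ?thesis
  proof (rule LIMSEQ_le_const[of "\<lambda>n. e + 2 / real n"])
    have "(\<lambda>n. e + 2 / real n) \<longlonglongrightarrow> e + 0"
      by (intro tendsto_intros lim_const_over_n)
    then show "(\<lambda>n. e + 2 / real n) \<longlonglongrightarrow> e" by simp
    show "\<exists>N. \<forall>n\<ge>N. \<bar>integral\<^sup>L \<mu> f - integral\<^sup>L \<nu> f\<bar> \<le> e + 2 / real n"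
      using bound by (intro exI[of _ 1]) auto
  qed
qed

text \<open>Affine rescaling to the unit interval. Clipping makes the bounds hold everywhere, and
  the range condition, being almost sure, makes the clipping invisible to both integrals.\<close>

lemma abs_integral_diff_le:
  fixes f :: "'b \<Rightarrow> real"
  assumes mu: "prob_space \<mu>" and nu: "prob_space \<nu>" and sets: "sets \<nu> = sets \<mu>"
    and tv: "\<And>A. A \<in> sets \<mu> \<Longrightarrow> \<bar>measure \<mu> A - measure \<nu> A\<bar> \<le> e"
    and f[measurable]: "f \<in> borel_measurable \<mu>"
    and ae: "AE x in \<mu>. m \<le> f x \<and> f x \<le> m + c" "AE x in \<nu>. m \<le> f x \<and> f x \<le> m + c"
  shows "\<bar>integral\<^sup>L \<mu> f - integral\<^sup>L \<nu> f\<bar> \<le> c * e"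
proof -
  interpret mu: prob_space \<mu> by fact
  interpret nu: prob_space \<nu> by fact
  have fn[measurable]: "f \<in> borel_measurable \<nu>"
    using f sets measurable_cong_sets by blast
  define g where "g x = max 0 (min 1 ((f x - m) / c))" for x
  have g[measurable]: "g \<in> borel_measurable \<mu>" "g \<in> borel_measurable \<nu>" unfolding g_def by measurable
  have "\<exists>x. m \<le> f x \<and> f x \<le> m + c"
  proof (rule ccontr)
    assume "\<nexists>x. m \<le> f x \<and> f x \<le> m + c"
    with ae(1) have "AE x in \<mu>. False" by (elim eventually_mono) blast
    then show False by simp
  qed
  then have c: "c \<ge> 0" by auto
  \<comment> \<open>In the degenerate case c = 0 the quotient in \<open>g\<close> is 0, and the
    range condition already forces f x = m.\<close>
  have eq: "f x = m + c * g x" if "m \<le> f x \<and> f x \<le> m + c" for x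
    using that c by (cases "c = 0") (auto simp: g_def field_simps min_def max_def)
  have "integrable \<mu> g" "integrable \<nu> g"
    by (auto intro!: mu.integrable_const_bound[where B=1] nu.integrable_const_bound[where B=1] simp: g_def)
  moreover have "integral\<^sup>L \<mu> f = integral\<^sup>L \<mu> (\<lambda>x. m + c * g x)"
    using ae(1) eq by (intro integral_cong_AE) auto
  moreover have "integral\<^sup>L \<nu> f = integral\<^sup>L \<nu> (\<lambda>x. m + c * g x)"
    using ae(2) eq by (intro integral_cong_AE) auto
  ultimately have "integral\<^sup>L \<mu> f - integral\<^sup>L \<nu> f = c * (integral\<^sup>L \<mu> g - integral\<^sup>L \<nu> g)"
    by (simp add: mu.prob_space nu.prob_space algebra_simps)
  moreover have "\<bar>integral\<^sup>L \<mu> g - integral\<^sup>L \<nu> g\<bar> \<le> e"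
    by (rule abs_integral_diff_le_unit[OF mu nu sets tv]) (auto simp: g_def)
  ultimately show ?thesis using c by (simp add: abs_mult mult_left_mono)
qed

text \<open>The numbers \<open>l\<close> and \<open>u\<close> are the infimum and supremum on
  \<open>X\<close>. The two optimality clauses serve to compare the bounds found on a subset with
  those on the whole set.\<close>

lemma obtain_osc_bounds:
  fixes f :: "'b \<Rightarrow> real"
  assumes "X \<noteq> {}" and "\<And>x y. x \<in> X \<Longrightarrow> y \<in> X \<Longrightarrow> \<bar>f x - f y\<bar> \<le> c"
  obtains l u where "\<And>x. x \<in> X \<Longrightarrow> l \<le> f x" "\<And>x. x \<in> X \<Longrightarrow> f x \<le> u" "u - l \<le> c"
    "\<And>a. (\<And>x. x \<in> X \<Longrightarrow> a \<le> f x) \<Longrightarrow> a \<le> l" "\<And>a. (\<And>x. x \<in> X \<Longrightarrow> f x \<le> a) \<Longrightarrow> u \<le> a"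
proof -
  obtain z where z: "z \<in> X" using assms(1) by auto
  have "f x \<le> f z + c" "f z - c \<le> f x" if "x \<in> X" for x
    using assms(2)[OF that z] by auto
  then have bb: "bdd_below (f ` X)" and ba: "bdd_above (f ` X)"
    by (auto intro!: bdd_belowI2 bdd_aboveI2)
  show thesis
  proof (rule that)
    show "x \<in> X \<Longrightarrow> Inf (f ` X) \<le> f x" for x using bb by (simp add: cINF_lower)
    show "x \<in> X \<Longrightarrow> f x \<le> Sup (f ` X)" for x using ba by (simp add: cSUP_upper)
    show "(\<And>x. x \<in> X \<Longrightarrow> a \<le> f x) \<Longrightarrow> a \<le> Inf (f ` X)" for a using assms(1) by (intro cINF_greatest) auto
    show "(\<And>x. x \<in> X \<Longrightarrow> f x \<le> a) \<Longrightarrow> Sup (f ` X) \<le> a" for a using assms(1) by (intro cSUP_least) auto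
    have "Sup (f ` X) \<le> Inf (f ` X) + c"
    proof (rule cSUP_least[OF assms(1)])
      fix x assume x: "x \<in> X"
      have "f x - c \<le> Inf (f ` X)"
      proof (intro cINF_greatest assms(1))
        show "y \<in> X \<Longrightarrow> f x - c \<le> f y" for y using assms(2)[OF x, of y] by auto
      qed
      then show "f x \<le> Inf (f ` X) + c" by simp
    qed
    then show "Sup (f ` X) - Inf (f ` X) \<le> c" by simp
  qed
qed

text \<open>A coupling estimate without a coupling. On \<open>A\<close>, which has mass at least
  \<open>p\<close> under both laws, the range [l, u] of \<open>f\<close> narrows to [l', u']; so
  both integrals lie between l + (l' - l) p and u - (u - u') p, and the length of this interval is
  (u - l)(1 - p) + (u' - l') p.\<close>

lemma integral_diff_le_minorization:
  fixes f :: "'b \<Rightarrow> real"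
  assumes mu: "prob_space \<mu>" "sets \<mu> = sets N" and nu: "prob_space \<nu>" "sets \<nu> = sets N"
    and f[measurable]: "f \<in> borel_measurable N" and X: "X \<noteq> {}"
    and ae: "AE x in \<mu>. x \<in> X" "AE x in \<nu>. x \<in> X"
    and osc: "\<And>x y. x \<in> X \<Longrightarrow> y \<in> X \<Longrightarrow> \<bar>f x - f y\<bar> \<le> c"
    and A[measurable]: "A \<in> sets N" and p: "0 < p" "p \<le> measure \<mu> A" "p \<le> measure \<nu> A"
    and oscA: "\<And>x y. x \<in> X \<inter> A \<Longrightarrow> y \<in> X \<inter> A \<Longrightarrow> \<bar>f x - f y\<bar> \<le> b"
  shows "\<bar>integral\<^sup>L \<mu> f - integral\<^sup>L \<nu> f\<bar> \<le> c - p * (c - b)"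
proof -
  obtain l u where lu: "\<And>x. x \<in> X \<Longrightarrow> l \<le> f x" "\<And>x. x \<in> X \<Longrightarrow> f x \<le> u" "u - l \<le> c"
    by (rule obtain_osc_bounds[of X f c]) (use X osc in auto)
  have ne: "X \<inter> A \<noteq> {}"
  proof
    assume "X \<inter> A = {}"
    then have "AE x in \<mu>. x \<notin> A" using ae(1) by (auto elim!: eventually_mono)
    then have "A \<in> null_sets \<mu>" using mu A by (subst AE_iff_null_sets) auto
    then have "measure \<mu> A = 0" by (simp add: measure_eq_0_null_sets)
    then show False using p by simp
  qed
  \<comment> \<open>Optimality of the bounds on \<open>X \<inter> A\<close> yields l \<le> l' and u'
    \<le> u; without these signs, mass of \<open>A\<close> exceeding \<open>p\<close> could not be
    discarded below.\<close>
  obtain l' u' where lu': "\<And>x. x \<in> X \<inter> A \<Longrightarrow> l' \<le> f x" "\<And>x. x \<in> X \<inter> A \<Longrightarrow> f x \<le> u'" "u' - l' \<le> b"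
    and opt: "l \<le> l'" "u' \<le> u"
  proof (rule obtain_osc_bounds[OF ne oscA])
    fix l' u' assume *: "\<And>x. x \<in> X \<inter> A \<Longrightarrow> l' \<le> f x" "\<And>x. x \<in> X \<inter> A \<Longrightarrow> f x \<le> u'" "u' - l' \<le> b"
      "\<And>a. (\<And>x. x \<in> X \<inter> A \<Longrightarrow> a \<le> f x) \<Longrightarrow> a \<le> l'" "\<And>a. (\<And>x. x \<in> X \<inter> A \<Longrightarrow> f x \<le> a) \<Longrightarrow> u' \<le> a"
    show thesis using that[OF *(1-3) *(4)[of l] *(5)[of u]] lu by auto
  qed
  have bounds: "l + (l' - l) * p \<le> integral\<^sup>L M f \<and> integral\<^sup>L M f \<le> u - (u - u') * p"
    if M: "prob_space M" "sets M = sets N" "AE x in M. x \<in> X" "p \<le> measure M A" for M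
  proof -
    interpret prob_space M by fact
    have [measurable]: "f \<in> borel_measurable M" using f M(2) measurable_cong_sets by blast
    have [measurable]: "A \<in> sets M" using M(2) by simp
    have fi: "integrable M f"
    proof (rule integrable_const_bound[where B="\<bar>l\<bar> + \<bar>u\<bar>"])
      show "AE x in M. norm (f x) \<le> \<bar>l\<bar> + \<bar>u\<bar>"
        using M(3)
      proof eventually_elim
        case (elim x) then show ?case using lu(1)[of x] lu(2)[of x] by auto
      qed
    qed simp
    have "l + (l' - l) * p \<le> l + (l' - l) * measure M A"
      using opt M(4) by (simp add: mult_left_mono)
    also have "\<dots> = (\<integral>x. l + (l' - l) * indicator A x \<partial>M)"
      by (simp add: prob_space emeasure_eq_measure)
    also have "\<dots> \<le> integral\<^sup>L M f"
    proof (rule integral_mono_AE)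
      show "AE x in M. l + (l' - l) * indicator A x \<le> f x"
        using M(3)
      proof eventually_elim
        case (elim x) then show ?case using lu(1)[of x] lu'(1)[of x] by (auto simp: indicator_def)
      qed
    qed (auto simp: fi emeasure_eq_measure)
    finally have 1: "l + (l' - l) * p \<le> integral\<^sup>L M f" .
    have "integral\<^sup>L M f \<le> (\<integral>x. u - (u - u') * indicator A x \<partial>M)"
    proof (rule integral_mono_AE)
      show "AE x in M. f x \<le> u - (u - u') * indicator A x"
        using M(3)
      proof eventually_elim
        case (elim x) then show ?case using lu(2)[of x] lu'(2)[of x] by (auto simp: indicator_def)
      qed
    qed (auto simp: fi emeasure_eq_measure)
    also have "\<dots> = u - (u - u') * measure M A"
      by (simp add: prob_space emeasure_eq_measure)
    also have "\<dots> \<le> u - (u - u') * p"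
      using opt M(4) by (simp add: mult_left_mono)
    finally show ?thesis using 1 by simp
  qed
  have p1: "p \<le> 1" using p(2) prob_space.prob_le_1[OF mu(1), of A] by simp
  have "u - (u - u') * p - (l + (l' - l) * p) = (u - l) * (1 - p) + (u' - l') * p"
    by (simp add: algebra_simps)
  also have "\<dots> \<le> c * (1 - p) + b * p"
    using lu(3) lu'(3) p1 p(1) by (intro add_mono mult_right_mono) auto
  finally have "u - (u - u') * p - (l + (l' - l) * p) \<le> c - p * (c - b)"
    by (simp add: algebra_simps)
  then show ?thesis
    using bounds[OF mu ae(1) p(2)] bounds[OF nu ae(2) p(3)] by (auto simp: abs_le_iff)
qed

text \<open>The previous estimate with the whole space as the common set: p = 1 and b = c.\<close>

lemma integral_diff_le_osc:
  fixes f :: "'b \<Rightarrow> real"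
  assumes mu: "prob_space \<mu>" "sets \<mu> = sets N" and nu: "prob_space \<nu>" "sets \<nu> = sets N"
    and f[measurable]: "f \<in> borel_measurable N" and X: "X \<noteq> {}"
    and ae: "AE x in \<mu>. x \<in> X" "AE x in \<nu>. x \<in> X"
    and osc: "\<And>x y. x \<in> X \<Longrightarrow> y \<in> X \<Longrightarrow> \<bar>f x - f y\<bar> \<le> c"
  shows "\<bar>integral\<^sup>L \<mu> f - integral\<^sup>L \<nu> f\<bar> \<le> c"
proof -
  have "measure \<mu> (space N) = 1" "measure \<nu> (space N) = 1"
    using prob_space.prob_space[OF mu(1)] prob_space.prob_space[OF nu(1)]
      sets_eq_imp_space_eq[OF mu(2)] sets_eq_imp_space_eq[OF nu(2)] by simp_all
  then show ?thesis
    using integral_diff_le_minorization[OF mu nu f X ae osc, of "space N" 1 c] osc by auto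
qed

text \<open>The complement of the support is the union of all open null sets; by the Lindelof
  property countably many of them already cover it, so it is null.\<close>

lemma AE_in_of_measure_support:
  fixes \<mu> :: "'b::second_countable_topology measure"
  assumes b: "sets \<mu> = sets borel" and "measure_support \<mu> \<subseteq> S" "S \<in> sets borel"
  shows "AE x in \<mu>. x \<in> S"
proof -
  define F where "F = {U. open U \<and> emeasure \<mu> U = 0}"
  obtain F' where F': "F' \<subseteq> F" "countable F'" "\<Union>F' = \<Union>F"
    using Lindelof[of F] unfolding F_def by auto
  have "(\<Union>U\<in>F'. U) \<in> null_sets \<mu>"
    using F' b by (intro null_sets_UN') (auto simp: F_def null_sets_def)
  then have "AE x in \<mu>. x \<notin> \<Union>F" using F'(3) AE_not_in by fastforce
  moreover have "x \<in> S" if "x \<notin> \<Union>F" for x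
  proof -
    have "x \<in> measure_support \<mu>"
      using that unfolding F_def measure_support_def by (auto simp: zero_less_iff_neq_zero)
    then show ?thesis using assms(2) by auto
  qed
  ultimately show ?thesis by (auto elim!: eventually_mono)
qed

text \<open>Setwise limits are finitely additive for free. Countable additivity comes from the
  uniformity in the event: along a sequence decreasing to the empty set, a single
  \<open>\<mu> k\<close> with small \<open>r k\<close> is close to the limit on all members at once,
  and its own continuity from above finishes the argument.\<close>

lemma measure_limit_of_uniformly_Cauchy:
  fixes \<mu> :: "nat \<Rightarrow> 'b measure"
  assumes p: "\<And>k. prob_space (\<mu> k)" and s: "\<And>k. sets (\<mu> k) = sets N"
    and cauchy: "\<And>k l A. A \<in> sets N \<Longrightarrow> k \<le> l \<Longrightarrow> \<bar>measure (\<mu> k) A - measure (\<mu> l) A\<bar> \<le> r k"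
    and r: "r \<longlonglongrightarrow> 0"
  obtains \<mu>' where "prob_space \<mu>'" "sets \<mu>' = sets N"
    "\<And>A. A \<in> sets N \<Longrightarrow> (\<lambda>k. measure (\<mu> k) A) \<longlonglongrightarrow> measure \<mu>' A"
    "\<And>k A. A \<in> sets N \<Longrightarrow> \<bar>measure (\<mu> k) A - measure \<mu>' A\<bar> \<le> r k"
proof -
  define L where "L A = lim (\<lambda>k. measure (\<mu> k) A)" for A
  have lim: "(\<lambda>k. measure (\<mu> k) A) \<longlonglongrightarrow> L A" if A: "A \<in> sets N" for A
  proof -
    have "Cauchy (\<lambda>k. measure (\<mu> k) A)"
    proof (rule CauchyI')
      fix e :: real assume "0 < e"
      then obtain n where n: "\<And>k. k \<ge> n \<Longrightarrow> norm (r k - 0) < e" using LIMSEQ_D[OF r] by blast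
      show "\<exists>M. \<forall>m\<ge>M. \<forall>n>m. dist (measure (\<mu> m) A) (measure (\<mu> n) A) < e"
      proof (intro exI allI impI)
        fix k l assume "n \<le> k" "k < l"
        then show "dist (measure (\<mu> k) A) (measure (\<mu> l) A) < e"
          using n[of k] cauchy[OF A, of k l] by (auto simp: dist_real_def)
      qed
    qed
    then show ?thesis unfolding L_def by (simp add: Cauchy_convergent_iff convergent_LIMSEQ_iff)
  qed
  have near: "\<bar>measure (\<mu> k) A - L A\<bar> \<le> r k" if A: "A \<in> sets N" for k A
  proof (rule LIMSEQ_le_const2)
    show "(\<lambda>l. \<bar>measure (\<mu> k) A - measure (\<mu> l) A\<bar>) \<longlonglongrightarrow> \<bar>measure (\<mu> k) A - L A\<bar>"
      by (intro tendsto_intros lim A)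
    show "\<exists>N. \<forall>n\<ge>N. \<bar>measure (\<mu> k) A - measure (\<mu> n) A\<bar> \<le> r k"
      using cauchy[OF A] by blast
  qed
  have L0: "0 \<le> L A" if "A \<in> sets N" for A
    using lim[OF that] by (rule LIMSEQ_le_const) (auto intro: measure_nonneg)
  define \<mu>' where "\<mu>' = measure_of (space N) (sets N) (\<lambda>A. ennreal (L A))"
  have s': "sets \<mu>' = sets N" unfolding \<mu>'_def by (simp add: sets.sigma_sets_eq)
  have add: "L (A \<union> B) = L A + L B" if "A \<in> sets N" "B \<in> sets N" "A \<inter> B = {}" for A B
  proof (rule LIMSEQ_unique)
    show "(\<lambda>k. measure (\<mu> k) (A \<union> B)) \<longlonglongrightarrow> L (A \<union> B)" using that by (intro lim) auto
    have "measure (\<mu> k) (A \<union> B) = measure (\<mu> k) A + measure (\<mu> k) B" for k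
    proof -
      interpret prob_space "\<mu> k" by (rule p)
      show ?thesis using that s[of k] by (intro finite_measure_Union) auto
    qed
    then show "(\<lambda>k. measure (\<mu> k) (A \<union> B)) \<longlonglongrightarrow> L A + L B" using lim that by (auto intro!: tendsto_add)
  qed
  have L_empty: "L {} = 0" unfolding L_def by simp
  have ca: "countably_additive (sets N) (\<lambda>A. ennreal (L A))"
  proof (rule ring_of_sets.empty_continuous_imp_countably_additive[of "space N"])
    show "ring_of_sets (space N) (sets N)" by (rule sets.ring_of_sets_axioms)
    show "positive (sets N) (\<lambda>A. ennreal (L A))" by (simp add: positive_def L_empty)
    show "additive (sets N) (\<lambda>A. ennreal (L A))"
      using add L0 by (auto simp: additive_def)
    show "\<forall>A\<in>sets N. ennreal (L A) \<noteq> \<infinity>" by simp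
    fix A :: "nat \<Rightarrow> 'b set" assume A: "range A \<subseteq> sets N" "decseq A" "(\<Inter>i. A i) = {}"
    have "(\<lambda>i. L (A i)) \<longlonglongrightarrow> 0"
    proof (rule LIMSEQ_I)
      fix e :: real assume e: "0 < e"
      then obtain k where k: "norm (r k - 0) < e / 2" using LIMSEQ_D[OF r, of "e/2"] by auto
      interpret prob_space "\<mu> k" by (rule p)
      have "(\<lambda>i. measure (\<mu> k) (A i)) \<longlonglongrightarrow> measure (\<mu> k) (\<Inter>i. A i)"
        using A s[of k] by (intro finite_Lim_measure_decseq) auto
      then obtain n where n: "\<And>i. i \<ge> n \<Longrightarrow> norm (measure (\<mu> k) (A i) - 0) < e / 2"
        using LIMSEQ_D[of _ 0 "e/2"] e A(3) by (metis half_gt_zero measure_empty)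
      show "\<exists>no. \<forall>n\<ge>no. norm (L (A n) - 0) < e"
      proof (intro exI allI impI)
        fix i assume "n \<le> i"
        moreover have "A i \<in> sets N" using A by auto
        ultimately show "norm (L (A i) - 0) < e"
          using n[of i] k near[of "A i" k] L0[of "A i"] by (auto simp: abs_le_iff abs_less_iff)
      qed
    qed
    then show "(\<lambda>i. ennreal (L (A i))) \<longlonglongrightarrow> 0"
      by (metis ennreal_0 tendsto_ennrealI)
  qed
  have em: "emeasure \<mu>' A = ennreal (L A)" if "A \<in> sets N" for A
    unfolding \<mu>'_def using that ca
    by (intro emeasure_measure_of_sigma) (auto simp: sets.sigma_algebra_axioms positive_def L_empty)
  then have me: "measure \<mu>' A = L A" if "A \<in> sets N" for A
    using that L0 by (simp add: measure_def)
  have "L (space N) = 1"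
  proof (rule LIMSEQ_unique[OF lim])
    have "measure (\<mu> k) (space N) = 1" for k
      using prob_space.prob_space[OF p] sets_eq_imp_space_eq[OF s] by metis
    then show "(\<lambda>k. measure (\<mu> k) (space N)) \<longlonglongrightarrow> 1" by simp
  qed simp
  then have "prob_space \<mu>'"
    using em[of "space N"] sets_eq_imp_space_eq[OF s'] by (intro prob_spaceI) auto
  then show thesis using s' lim near me by (intro that[of \<mu>']) auto
qed

subsection \<open>Kolmogorov extension over a compact state space\<close>

lemma continuous_dist_sequence:
  fixes e :: "nat \<Rightarrow> 'a::metric_space"
  shows "continuous_on UNIV (\<lambda>x n. dist x (e n))"
  by (intro continuous_on_coordinatewise_then_product continuous_intros)

lemma inj_dist_sequence:
  fixes e :: "nat \<Rightarrow> 'a::metric_space"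
  assumes "closure (range e) = UNIV"
  shows "inj (\<lambda>x n. dist x (e n))"
proof (rule injI)
  fix x y assume eq: "(\<lambda>n. dist x (e n)) = (\<lambda>n. dist y (e n))"
  have "dist x y < 2 * r" if "r > 0" for r
  proof -
    have "x \<in> closure (range e)" using assms by simp
    then obtain n where "dist (e n) x < r"
      using \<open>r > 0\<close> by (auto simp: closure_approachable)
    moreover have "dist x (e n) = dist y (e n)" using eq by meson
    ultimately show ?thesis
      using dist_triangle2[of x y "e n"] by (simp add: dist_commute)
  qed
  from this[of "dist x y / 2"] show "x = y" by (cases "x = y") auto
qed

text \<open>Distances to a dense sequence form a continuous injection into real sequences. On the
  compact \<open>K\<close> its inverse is continuous on a compact image, and a constant value off
  that image extends it to a Borel map.\<close>

lemma compact_embedding_with_inverse: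
  fixes K :: "'a::{metric_space, second_countable_topology} set"
  assumes K: "compact K" and ne: "K \<noteq> {}"
  obtains \<phi> :: "'a \<Rightarrow> nat \<Rightarrow> real" and g
  where "\<phi> \<in> borel_measurable borel" "g \<in> borel_measurable borel" "\<And>x. x \<in> K \<Longrightarrow> g (\<phi> x) = x"
proof -
  obtain D :: "'a set" where D: "countable D" "UNIV \<subseteq> closure D"
    using separable[of "UNIV :: 'a set"] by auto
  have "D \<noteq> {}" using D(2) by auto
  define e where "e = from_nat_into D"
  have e: "closure (range e) = UNIV"
    using D \<open>D \<noteq> {}\<close> by (auto simp: e_def range_from_nat_into)
  define \<phi> where "\<phi> = (\<lambda>x n. dist x (e n))"
  have cont: "continuous_on UNIV \<phi>" and inj: "inj \<phi>"
    using continuous_dist_sequence[of e] inj_dist_sequence[OF e] by (simp_all add: \<phi>_def)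
  obtain z where z: "z \<in> K" using ne by auto
  have inj': "inj_on \<phi> K" using inj by (rule inj_on_subset) simp
  define g where "g y = (if y \<in> \<phi> ` K then the_inv_into K \<phi> y else z)" for y
  have "continuous_on (\<phi> ` K) (the_inv_into K \<phi>)"
    by (rule continuous_on_inv_into[OF continuous_on_subset[OF cont subset_UNIV] K inj'])
  moreover have "compact (\<phi> ` K)"
    using cont K by (intro compact_continuous_image) (auto intro: continuous_on_subset)
  ultimately have "g \<in> borel_measurable borel"
    unfolding g_def by (intro borel_measurable_continuous_on_if continuous_on_const) (auto intro: borel_compact)
  moreover have "\<phi> \<in> borel_measurable borel" using cont by (rule borel_measurable_continuous_onI)
  moreover have "g (\<phi> x) = x" if "x \<in> K" for x using that inj' by (simp add: g_def the_inv_into_f_f)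
  ultimately show thesis by (intro that)
qed

text \<open>
  The library's Kolmogorov theorem requires the class \<^class>\<open>polish_space\<close>, of which the sort of \<open>E\<close>
  is not an instance; a compact state space embeds into \<open>nat \<Rightarrow> real\<close>, which is.
\<close>

lemma Kolmogorov_extension_compact:
  fixes P :: "'i set \<Rightarrow> ('i \<Rightarrow> 'a::{metric_space, second_countable_topology}) measure"
  assumes P: "projective_family UNIV P (\<lambda>_. borel)" and K: "compact K" "K \<noteq> {}"
    and supp: "\<And>J i. finite J \<Longrightarrow> i \<in> J \<Longrightarrow> AE x in P J. x i \<in> K"
  obtains M where "prob_space M" "sets M = sets (\<Pi>\<^sub>M i\<in>UNIV. borel)"
    "\<And>J. finite J \<Longrightarrow> distr M (\<Pi>\<^sub>M i\<in>J. borel) (\<lambda>x. restrict x J) = P J"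
proof -
  interpret P: projective_family UNIV P "\<lambda>_. borel" by fact
  obtain \<phi> :: "'a \<Rightarrow> nat \<Rightarrow> real" and g
    where [measurable]: "\<phi> \<in> borel_measurable borel" "g \<in> borel_measurable borel"
      and g\<phi>: "\<And>x. x \<in> K \<Longrightarrow> g (\<phi> x) = x"
    using compact_embedding_with_inverse[OF K] by metis
  define P' where "P' J = distr (P J) (\<Pi>\<^sub>M i\<in>J. borel) (\<lambda>x. \<lambda>i\<in>J. \<phi> (x i))" for J
  have sP[measurable_cong]: "sets (P J) = sets (\<Pi>\<^sub>M i\<in>J. borel)" if "finite J" for J
    using P.sets_P that by auto
  have m\<phi>: "(\<lambda>x. \<lambda>i\<in>J. \<phi> (x i)) \<in> P J \<rightarrow>\<^sub>M (\<Pi>\<^sub>M i\<in>J. borel)" if "finite J" for J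
    unfolding measurable_cong_sets[OF sP[OF that] refl] by measurable
  have "projective_family UNIV P' (\<lambda>_. borel)"
  proof (rule projective_family.intro)
    fix J H :: "'i set" assume JH: "J \<subseteq> H" "finite H" "H \<subseteq> UNIV"
    then have fJ: "finite J" by (auto intro: finite_subset)
    have "P' J = distr (distr (P H) (Pi\<^sub>M J (\<lambda>_. borel)) (\<lambda>f. restrict f J)) (Pi\<^sub>M J (\<lambda>_. borel)) (\<lambda>x. \<lambda>i\<in>J. \<phi> (x i))"
      unfolding P'_def by (subst P.P[OF JH]) simp
    also have "\<dots> = distr (P H) (Pi\<^sub>M J (\<lambda>_. borel)) ((\<lambda>x. \<lambda>i\<in>J. \<phi> (x i)) \<circ> (\<lambda>f. restrict f J))"
      using JH sP[of H] by (intro distr_distr) (auto simp: measurable_cong_sets[OF sP[of H] refl] intro!: measurable_restrict_subset)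
    also have "((\<lambda>x. \<lambda>i\<in>J. \<phi> (x i)) \<circ> (\<lambda>f. restrict f J)) = (\<lambda>f. restrict f J) \<circ> (\<lambda>x. \<lambda>i\<in>H. \<phi> (x i))"
      using JH by (auto simp: fun_eq_iff restrict_def)
    also have "distr (P H) (Pi\<^sub>M J (\<lambda>_. borel)) \<dots> = distr (P' H) (Pi\<^sub>M J (\<lambda>_. borel)) (\<lambda>f. restrict f J)"
      unfolding P'_def using JH m\<phi>[of H] by (intro distr_distr[symmetric] measurable_restrict_subset) auto
    finally show "P' J = distr (P' H) (Pi\<^sub>M J (\<lambda>_. borel)) (\<lambda>f. restrict f J)" .
  next
    fix J :: "'i set" assume "finite J" "J \<subseteq> UNIV"
    then show "prob_space (P' J)"
      unfolding P'_def by (intro prob_space.prob_space_distr P.prob_space_P m\<phi>)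
  qed
  then interpret P': polish_projective UNIV P'
    by (simp add: polish_projective_def)
  have lim_restrict: "distr P'.lim (\<Pi>\<^sub>M i\<in>J. borel) (\<lambda>x. restrict x J) = P' J" if J: "finite J" for J
  proof (rule measure_eqI)
    fix A assume A: "A \<in> sets (distr P'.lim (\<Pi>\<^sub>M i\<in>J. borel) (\<lambda>x. restrict x J))"
    then show "emeasure (distr P'.lim (\<Pi>\<^sub>M i\<in>J. borel) (\<lambda>x. restrict x J)) A = emeasure (P' J) A"
      using J P'.emeasure_lim_emb[of J A]
      by (subst emeasure_distr)
        (auto simp: prod_emb_def space_PiM measurable_cong_sets[OF P'.sets_lim refl] intro!: measurable_restrict_subset)
  qed (simp add: P'_def)
  \<comment> \<open>The extension is built on real sequences and carried back coordinatewise by the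
    Borel left inverse \<open>g\<close>.\<close>
  define M where "M = distr P'.lim (\<Pi>\<^sub>M i\<in>UNIV. borel) (\<lambda>x i. g (x i))"
  have mg: "(\<lambda>x i. g (x i)) \<in> P'.lim \<rightarrow>\<^sub>M (\<Pi>\<^sub>M i\<in>UNIV. borel)"
    by (intro measurable_PiM_single') (auto simp: measurable_cong_sets[OF P'.sets_lim refl])
  show thesis
  proof (rule that[of M])
    show "prob_space M" unfolding M_def using mg by (rule P'.P.prob_space_distr)
    show "sets M = sets (\<Pi>\<^sub>M i\<in>UNIV. borel)" by (simp add: M_def)
    fix J :: "'i set" assume J: "finite J"
    have mgJ: "(\<lambda>x. \<lambda>i\<in>J. g (x i)) \<in> (\<Pi>\<^sub>M i\<in>J. borel) \<rightarrow>\<^sub>M (\<Pi>\<^sub>M i\<in>J. borel)" by measurable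
    have "distr M (\<Pi>\<^sub>M i\<in>J. borel) (\<lambda>x. restrict x J) = distr P'.lim (\<Pi>\<^sub>M i\<in>J. borel) ((\<lambda>x. restrict x J) \<circ> (\<lambda>x i. g (x i)))"
      unfolding M_def using mg by (intro distr_distr measurable_restrict_subset) auto
    also have "(\<lambda>x. restrict x J) \<circ> (\<lambda>x i. g (x i)) = (\<lambda>x. \<lambda>i\<in>J. g (x i)) \<circ> (\<lambda>x. restrict x J)"
      by (auto simp: fun_eq_iff restrict_def)
    also have "distr P'.lim (\<Pi>\<^sub>M i\<in>J. borel) \<dots> = distr (P' J) (\<Pi>\<^sub>M i\<in>J. borel) (\<lambda>x. \<lambda>i\<in>J. g (x i))"
      unfolding lim_restrict[OF J, symmetric] using mgJ
      by (intro distr_distr[symmetric]) (auto simp: measurable_cong_sets[OF P'.sets_lim refl] intro!: measurable_restrict_subset)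
    also have "\<dots> = distr (P J) (\<Pi>\<^sub>M i\<in>J. borel) ((\<lambda>x. \<lambda>i\<in>J. g (x i)) \<circ> (\<lambda>x. \<lambda>i\<in>J. \<phi> (x i)))"
      unfolding P'_def using m\<phi>[OF J] mgJ by (intro distr_distr)
    \<comment> \<open>The composite of \<open>\<phi>\<close> and \<open>g\<close> is the identity
      only on \<open>K\<close>; this is where the concentration of the marginals on \<open>K\<close>
      enters.\<close>
    also have "\<dots> = distr (P J) (\<Pi>\<^sub>M i\<in>J. borel) (\<lambda>x. x)"
    proof (rule distr_cong_AE)
      have "AE x in P J. \<forall>i\<in>J. x i \<in> K" using supp J by (simp add: AE_ball_countable countable_finite)
      moreover have "AE x in P J. x \<in> space (P J)" by simp
      ultimately show "AE x in P J. ((\<lambda>x. \<lambda>i\<in>J. g (x i)) \<circ> (\<lambda>x. \<lambda>i\<in>J. \<phi> (x i))) x = x"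
      proof eventually_elim
        case (elim x)
        then have "x \<in> extensional J" using P.space_P[OF J] by (auto simp: space_PiM PiE_def)
        then show ?case using elim(1) g\<phi> by (auto simp: fun_eq_iff restrict_def extensional_def)
      qed
    qed (use m\<phi>[OF J] mgJ sP[OF J] in \<open>auto intro: measurable_comp simp: measurable_cong_sets[OF sP[OF J] refl]\<close>)
    also have "\<dots> = P J" using sP[OF J] by (intro distr_id2) simp
    finally show "distr M (\<Pi>\<^sub>M i\<in>J. borel) (\<lambda>x. restrict x J) = P J" .
  qed
qed

subsection \<open>The Markov operator on pasts\<close>

text \<open>Index 0 is the present, so a new state enters at the front and all older ones move up by
  one place. This is the one-step case of \<open>past_append\<close>.\<close>

definition push :: "'a \<Rightarrow> (nat \<Rightarrow> 'a) \<Rightarrow> nat \<Rightarrow> 'a" where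
  "push y \<xi> = case_nat y \<xi>"

definition tail :: "(nat \<Rightarrow> 'a) \<Rightarrow> nat \<Rightarrow> 'a" where
  "tail \<omega> = (\<lambda>j. \<omega> (Suc j))"

lemma push_simps[simp]: "push y \<xi> 0 = y" "push y \<xi> (Suc j) = \<xi> j" "tail (push y \<xi>) = \<xi>"
  by (simp_all add: push_def tail_def)

text \<open>Cylinder functions: by the reversed indexing, the coordinates below \<open>m\<close> are
  the \<open>m\<close> most recent ones.\<close>

definition dep_on :: "nat \<Rightarrow> ((nat \<Rightarrow> 'a) \<Rightarrow> 'c) \<Rightarrow> bool" where
  "dep_on m f \<longleftrightarrow> (\<forall>\<omega> \<omega>'. (\<forall>j<m. \<omega> j = \<omega>' j) \<longrightarrow> f \<omega> = f \<omega>')"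

text \<open>The total variation estimate of (SF) is stated event by event. The point
  \<open>x0\<close> is a filler from \<open>K\<close>: it gives the default value of the kernel
  outside admissible pasts, a reference starting past, and the remote coordinates of truncated
  pasts.\<close>

locale chain =
  fixes K :: "'a::{banach, second_countable_topology} set" and \<iota> C :: real
    and Q :: "(nat \<Rightarrow> 'a) \<Rightarrow> 'a measure" and x0 :: 'a
  assumes compact_K: "compact K" and x0: "x0 \<in> K" and \<iota>: "\<iota> > 1" and C: "C > 0"
    and Q_meas: "Q \<in> restrict_space borel (past_space K) \<rightarrow>\<^sub>M prob_algebra borel"
    and Q_supp: "\<And>\<xi>. \<xi> \<in> past_space K \<Longrightarrow> measure_support (Q \<xi>) \<subseteq> K"
    and Q_lip: "\<And>\<xi> \<xi>' A. \<xi> \<in> past_space K \<Longrightarrow> \<xi>' \<in> past_space K \<Longrightarrow> A \<in> sets borel \<Longrightarrow>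
        \<bar>measure (Q \<xi>) A - measure (Q \<xi>') A\<bar> \<le> C * past_dist \<iota> \<xi> \<xi>'"
begin

abbreviation "X \<equiv> past_space K"
abbreviation "d \<equiv> past_dist \<iota>"

definition "\<xi>0 = (\<lambda>_::nat. x0)"

lemma \<xi>0: "\<xi>0 \<in> X" by (simp add: \<xi>0_def past_space_def x0)

lemma X_ne: "X \<noteq> {}" using \<xi>0 by auto

lemma push_X: "\<xi> \<in> X \<Longrightarrow> y \<in> K \<Longrightarrow> push y \<xi> \<in> X"
  by (auto simp: past_space_def push_def split: nat.split)

lemma X_component: "\<xi> \<in> X \<Longrightarrow> \<xi> j \<in> K"
  by (simp add: past_space_def)

lemma K_borel[measurable]: "K \<in> sets borel"
  using compact_K by (rule borel_compact)

lemma X_borel[measurable]: "X \<in> sets borel"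
proof -
  have "X = (\<Inter>j. (\<lambda>\<xi>. \<xi> j) -` K)" by (auto simp: past_space_def)
  moreover have "(\<lambda>\<xi>. \<xi> j) -` K \<in> sets (borel :: (nat \<Rightarrow> 'a) measure)" for j
    using measurable_sets[OF measurable_product_coordinates[of j] K_borel] by simp
  ultimately show ?thesis by auto
qed

text \<open>States in the compact \<open>K\<close> are bounded, so the weights \<iota>^(-j) dominate
  and the unordered sum is an ordinary convergent series; from here on series lemmas apply.\<close>

lemma past_dist_suminf:
  assumes "\<xi> \<in> X" "\<xi>' \<in> X"
  shows "summable (\<lambda>j. (1/\<iota>)^j * norm (\<xi> j - \<xi>' j))" "d \<xi> \<xi>' = (\<Sum>j. (1/\<iota>)^j * norm (\<xi> j - \<xi>' j))"
proof -
  obtain B where B: "\<And>x. x \<in> K \<Longrightarrow> norm x \<le> B"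
    using compact_imp_bounded[OF compact_K] by (auto simp: bounded_iff)
  have le: "norm (norm ((1/\<iota>)^j * norm (\<xi> j - \<xi>' j))) \<le> (1/\<iota>)^j * (2 * B)" for j
  proof -
    have "norm (\<xi> j - \<xi>' j) \<le> 2 * B"
      using norm_triangle_ineq4[of "\<xi> j" "\<xi>' j"] B[OF X_component[OF assms(1), of j]] B[OF X_component[OF assms(2), of j]]
      by linarith
    then have "(1/\<iota>)^j * norm (\<xi> j - \<xi>' j) \<le> (1/\<iota>)^j * (2 * B)"
      using \<iota> by (intro mult_left_mono) auto
    then show ?thesis using \<iota> by (simp add: abs_mult)
  qed
  have "summable (\<lambda>j. (1/\<iota>)^j * (2 * B))"
    using \<iota> by (intro summable_mult2 summable_geometric) auto
  then have s: "summable (\<lambda>j. norm ((1/\<iota>)^j * norm (\<xi> j - \<xi>' j)))"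
    by (rule summable_comparison_test') (rule le)
  have "d \<xi> \<xi>' = (\<Sum>\<^sub>\<infinity>j. (1/\<iota>)^j * norm (\<xi> j - \<xi>' j))"
    by (simp add: past_dist_def power_int_minus power_one_over inverse_eq_divide)
  also have "\<dots> = (\<Sum>j. (1/\<iota>)^j * norm (\<xi> j - \<xi>' j))"
    by (rule infsumI[OF norm_summable_imp_has_sum[OF s summable_sums[OF summable_norm_cancel[OF s]]]])
  finally show "d \<xi> \<xi>' = (\<Sum>j. (1/\<iota>)^j * norm (\<xi> j - \<xi>' j))" .
  show "summable (\<lambda>j. (1/\<iota>)^j * norm (\<xi> j - \<xi>' j))" by (rule summable_norm_cancel[OF s])
qed

lemma d_nonneg: "\<xi> \<in> X \<Longrightarrow> \<xi>' \<in> X \<Longrightarrow> 0 \<le> d \<xi> \<xi>'"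
  using past_dist_suminf[of \<xi> \<xi>'] \<iota> by (auto intro!: suminf_nonneg)

lemma d_push:
  assumes "\<xi> \<in> X" "\<xi>' \<in> X" "y \<in> K"
  shows "d (push y \<xi>) (push y \<xi>') = d \<xi> \<xi>' / \<iota>"
proof -
  let ?f = "\<lambda>j. (1/\<iota>)^j * norm (push y \<xi> j - push y \<xi>' j)"
  note p = past_dist_suminf[OF push_X[OF assms(1,3)] push_X[OF assms(2,3)]]
  have "suminf ?f = ?f 0 + (\<Sum>j. ?f (Suc j))"
    using suminf_split_head[OF p(1)] by simp
  also have "(\<Sum>j. ?f (Suc j)) = (\<Sum>j. (1/\<iota>)^j * norm (\<xi> j - \<xi>' j) / \<iota>)" by simp
  also have "\<dots> = d \<xi> \<xi>' / \<iota>"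
    using past_dist_suminf[OF assms(1,2)] by (simp add: suminf_divide)
  finally show ?thesis using p(2) by simp
qed

text \<open>Boundedness of \<open>K\<close> makes the coordinates from \<open>n\<close> on
  contribute at most \<epsilon>/2, and uniform closeness \<epsilon>/(2a) of the others contributes
  at most \<epsilon>/2, where \<open>a\<close> is the sum of the weights. This turns the boxes of
  (SR) into sets of small \<open>d\<close>-diameter and makes truncations close to the original
  past.\<close>

lemma d_close:
  assumes "\<epsilon> > 0"
  obtains n \<delta> where "n \<ge> 1" "\<delta> > 0"
    "\<And>\<omega> \<omega>'. \<omega> \<in> X \<Longrightarrow> \<omega>' \<in> X \<Longrightarrow> (\<And>j. j < n \<Longrightarrow> norm (\<omega> j - \<omega>' j) \<le> \<delta>) \<Longrightarrow> d \<omega> \<omega>' \<le> \<epsilon>"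
proof -
  obtain B where B: "B > 0" "\<And>x. x \<in> K \<Longrightarrow> norm x \<le> B"
    using compact_imp_bounded[OF compact_K] unfolding bounded_pos by auto
  define a where "a = 1 / (1 - 1/\<iota>)"
  have a: "a > 0" "(\<Sum>j. (1/\<iota>)^j) = a" "summable (\<lambda>j. (1/\<iota>)^j)"
    using \<iota> by (auto simp: a_def suminf_geometric intro!: summable_geometric)
  have "(\<lambda>n. (1/\<iota>)^n) \<longlonglongrightarrow> 0" using \<iota> by (intro LIMSEQ_realpow_zero) auto
  moreover have "\<epsilon> / (4 * B * a) > 0" using assms B(1) a(1) by simp
  ultimately obtain N where N: "\<And>n. n \<ge> N \<Longrightarrow> norm ((1/\<iota>)^n - 0) < \<epsilon> / (4 * B * a)"
    using LIMSEQ_D[of _ 0 "\<epsilon> / (4 * B * a)"] by blast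
  define n where "n = Suc N"
  have n: "(1/\<iota>)^n * (2 * B * a) \<le> \<epsilon> / 2"
  proof -
    have "(1/\<iota>)^n < \<epsilon> / (4 * B * a)" using N[of n] \<iota> by (simp add: n_def)
    moreover have "0 < 4 * B * a" using B(1) a(1) by simp
    ultimately have "(1/\<iota>)^n * (4 * B * a) < \<epsilon>" by (simp only: pos_less_divide_eq)
    then show ?thesis by (simp del: power_one_over)
  qed
  show thesis
  proof (rule that[of n "\<epsilon> / (2 * a)"])
    show "n \<ge> 1" "\<epsilon> / (2 * a) > 0" using assms a by (auto simp: n_def)
    fix \<omega> \<omega>' assume w: "\<omega> \<in> X" "\<omega>' \<in> X" and close: "\<And>j. j < n \<Longrightarrow> norm (\<omega> j - \<omega>' j) \<le> \<epsilon> / (2 * a)"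
    let ?f = "\<lambda>j. (1/\<iota>)^j * norm (\<omega> j - \<omega>' j)"
    \<comment> \<open>A summable majorant in two pieces: the first is summed over all j, the second
      starts at n and is a shifted geometric series.\<close>
    let ?g = "\<lambda>j. (1/\<iota>)^j * (\<epsilon> / (2 * a)) + (if j < n then 0 else (1/\<iota>)^(j - n) * ((1/\<iota>)^n * (2 * B)))"
    note p = past_dist_suminf[OF w]
    have h: "(\<lambda>j. (1/\<iota>)^j * c) sums (a * c)" for c
      using sums_mult2[OF summable_sums[OF a(3)], of c] a(2) by simp
    have "(\<lambda>j. if j < n then 0 else (1/\<iota>)^(j - n) * ((1/\<iota>)^n * (2 * B))) sums (a * ((1/\<iota>)^n * (2 * B)))"
      using h[of "(1/\<iota>)^n * (2 * B)"]
      by (subst sums_iff_shift'[of _ n, symmetric]) (auto cong: if_cong)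
    from sums_add[OF h[of "\<epsilon> / (2 * a)"] this]
    have g: "?g sums (a * (\<epsilon> / (2 * a)) + a * ((1/\<iota>)^n * (2 * B)))" .
    have "?f j \<le> ?g j" for j
    proof (cases "j < n")
      case True then show ?thesis using mult_left_mono[OF close[OF True], of "(1/\<iota>)^j"] \<iota> by simp
    next
      case False
      have "norm (\<omega> j - \<omega>' j) \<le> 2 * B"
        using norm_triangle_ineq4[of "\<omega> j" "\<omega>' j"] B(2)[OF X_component[OF w(1), of j]] B(2)[OF X_component[OF w(2), of j]] by simp
      moreover have "(1/\<iota>)^(j - n) * (1/\<iota>)^n = (1/\<iota>)^j" using False by (simp flip: power_add)
      moreover have "0 \<le> (1/\<iota>)^j * (\<epsilon> / (2 * a))" using \<iota> a assms by simp
      moreover have "(1/\<iota>)^j * norm (\<omega> j - \<omega>' j) \<le> (1/\<iota>)^j * (2 * B)"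
        using calculation(1) \<iota> by (intro mult_left_mono) auto
      moreover have "?g j = (1/\<iota>)^j * (\<epsilon> / (2 * a)) + (1/\<iota>)^(j - n) * (1/\<iota>)^n * (2 * B)"
        using False by (simp only: if_False mult.assoc)
      ultimately show ?thesis by (simp only:)
    qed
    then have "d \<omega> \<omega>' \<le> a * (\<epsilon> / (2 * a)) + a * ((1/\<iota>)^n * (2 * B))"
      using suminf_le[OF _ p(1) sums_summable[OF g]] unfolding p(2) sums_unique[OF g] by blast
    also have "\<dots> \<le> \<epsilon>" using n a(1) by (simp add: mult_ac)
    finally show "d \<omega> \<omega>' \<le> \<epsilon>" .
  qed
qed

text \<open>A probability kernel on all sequences, in contrast to \<open>zero_ext\<close>, which
  loses mass outside \<open>X\<close>. The chain below is thus Markov from every starting point, and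
  integrals of bounded functions always exist.\<close>

definition Q' :: "(nat \<Rightarrow> 'a) \<Rightarrow> 'a measure" where
  "Q' \<xi> = (if \<xi> \<in> X then Q \<xi> else return borel x0)"

lemma Q'_eq: "\<xi> \<in> X \<Longrightarrow> Q' \<xi> = Q \<xi>" by (simp add: Q'_def)

lemma Q'_meas[measurable]: "Q' \<in> borel \<rightarrow>\<^sub>M prob_algebra borel"
proof -
  have "(\<lambda>\<xi>. if \<xi> \<in> X then Q \<xi> else return borel x0) \<in> borel \<rightarrow>\<^sub>M prob_algebra borel"
  proof (rule measurable_If_restrict_space_iff[THEN iffD2])
    show "{x \<in> space borel. x \<in> X} \<in> sets borel" by simp
    show "Q \<in> restrict_space borel {\<xi>. \<xi> \<in> X} \<rightarrow>\<^sub>M prob_algebra borel \<and>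
      (\<lambda>\<xi>. return borel x0) \<in> restrict_space borel {\<xi>. \<xi> \<notin> X} \<rightarrow>\<^sub>M prob_algebra borel"
      using Q_meas by (auto simp: space_prob_algebra prob_space_return)
  qed
  then show ?thesis by (simp add: Q'_def[abs_def])
qed

lemma Q'_prob: "prob_space (Q' \<xi>)" "sets (Q' \<xi>) = sets borel"
  using measurable_space[OF Q'_meas, of \<xi>] by (auto simp: space_prob_algebra)

lemma AE_Q': "\<xi> \<in> X \<Longrightarrow> AE y in Q' \<xi>. y \<in> K"
  using Q_supp[of \<xi>] Q'_prob(2)[of \<xi>] by (intro AE_in_of_measure_support) (auto simp: Q'_eq)

lemma push_measurable[measurable]:
  assumes [measurable]: "f \<in> M \<rightarrow>\<^sub>M borel" "g \<in> M \<rightarrow>\<^sub>M borel"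
  shows "(\<lambda>x. push (f x) (g x) :: nat \<Rightarrow> 'a) \<in> M \<rightarrow>\<^sub>M borel"
proof (rule measurable_coordinatewise_then_product)
  fix i show "(\<lambda>x. push (f x) (g x) i) \<in> borel_measurable M"
    by (cases i) (auto intro: measurable_product_then_coordinatewise)
qed

lemma tail_measurable[measurable]: "(tail :: (nat \<Rightarrow> 'a) \<Rightarrow> _) \<in> borel \<rightarrow>\<^sub>M borel"
  unfolding tail_def by (rule measurable_coordinatewise_then_product) simp

text \<open>The transition kernel of the Markov chain of pasts: the old past is kept and one state
  drawn from \<open>Q'\<close> is put in front of it.\<close>

definition R :: "(nat \<Rightarrow> 'a) \<Rightarrow> (nat \<Rightarrow> 'a) measure" where
  "R \<xi> = distr (Q' \<xi>) borel (\<lambda>y. push y \<xi>)"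

lemma R_meas[measurable]: "R \<in> borel \<rightarrow>\<^sub>M prob_algebra borel"
  unfolding R_def by (intro measurable_distr_prob_space2[where M=borel]) measurable

lemma R_prob: "prob_space (R \<xi>)" "sets (R \<xi>) = sets borel"
  using measurable_space[OF R_meas, of \<xi>] by (auto simp: space_prob_algebra)

lemma AE_R: "\<xi> \<in> X \<Longrightarrow> AE \<omega> in R \<xi>. \<omega> \<in> X"
proof -
  assume x: "\<xi> \<in> X"
  have "(\<lambda>y. push y \<xi>) \<in> Q' \<xi> \<rightarrow>\<^sub>M borel"
    unfolding measurable_cong_sets[OF Q'_prob(2) refl] by measurable
  then show ?thesis
    unfolding R_def using AE_Q'[OF x] push_X[OF x] by (subst AE_distr_iff) auto
qed

primrec \<nu> :: "nat \<Rightarrow> (nat \<Rightarrow> 'a) \<Rightarrow> (nat \<Rightarrow> 'a) measure" where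
  "\<nu> 0 \<xi> = return borel \<xi>"
| "\<nu> (Suc k) \<xi> = \<nu> k \<xi> \<bind> R"

lemma \<nu>_meas[measurable]: "\<nu> k \<in> borel \<rightarrow>\<^sub>M prob_algebra borel"
proof (induction k)
  case 0
  have "\<nu> 0 = return borel" by (rule ext) simp
  then show ?case using measurable_return_prob_space by simp
next
  case (Suc k)
  have "\<nu> (Suc k) = (\<lambda>\<xi>. \<nu> k \<xi> \<bind> R)" by (rule ext) simp
  then show ?case using measurable_bind_prob_space[OF Suc R_meas] by simp
qed

lemma \<nu>_prob: "prob_space (\<nu> k \<xi>)" "sets (\<nu> k \<xi>) = sets borel"
  using measurable_space[OF \<nu>_meas, of \<xi>] by (auto simp: space_prob_algebra)

lemma \<nu>_space[simp]: "space (\<nu> k \<xi>) = UNIV"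
  using sets_eq_imp_space_eq[OF \<nu>_prob(2)] by simp

lemma AE_\<nu>: "\<xi> \<in> X \<Longrightarrow> AE \<omega> in \<nu> k \<xi>. \<omega> \<in> X"
proof (induction k)
  case 0 then show ?case by (simp only: \<nu>.simps, subst AE_return) auto
next
  case (Suc k)
  then have "AE \<eta> in \<nu> k \<xi>. AE \<omega> in R \<eta>. \<omega> \<in> X"
    by (auto elim!: eventually_mono intro: AE_R)
  moreover have "R \<in> \<nu> k \<xi> \<rightarrow>\<^sub>M subprob_algebra borel"
    unfolding measurable_cong_sets[OF \<nu>_prob(2) refl] by (intro measurable_prob_algebraD R_meas)
  moreover have "Measurable.pred borel (\<lambda>\<omega>. \<omega> \<in> X)" by simp
  ultimately show ?case
    unfolding \<nu>.simps using AE_bind[of R "\<nu> k \<xi>" borel "\<lambda>\<omega>. \<omega> \<in> X"] by blast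
qed

section \<open>Bounded measurable functions and the operator of the chain\<close>

definition bm :: "((nat \<Rightarrow> 'a) \<Rightarrow> real) \<Rightarrow> bool" where
  "bm f \<longleftrightarrow> f \<in> borel_measurable borel \<and> (\<exists>B. \<forall>x. \<bar>f x\<bar> \<le> B)"

lemma bm_integrable:
  assumes "bm f" "prob_space M" "sets M = sets borel"
  shows "integrable M f"
proof -
  interpret prob_space M by fact
  obtain B where "\<And>x. \<bar>f x\<bar> \<le> B" using assms(1) by (auto simp: bm_def)
  then show ?thesis
    using assms by (intro integrable_const_bound[where B=B]) (auto simp: bm_def measurable_cong_sets[OF assms(3) refl])
qed

definition T :: "((nat \<Rightarrow> 'a) \<Rightarrow> real) \<Rightarrow> (nat \<Rightarrow> 'a) \<Rightarrow> real" where
  "T f \<xi> = integral\<^sup>L (R \<xi>) f"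

lemma T_bounded:
  assumes "\<And>x. \<bar>f x\<bar> \<le> B" "f \<in> borel_measurable borel"
  shows "\<bar>T f \<xi>\<bar> \<le> B"
proof -
  interpret R: prob_space "R \<xi>" by (rule R_prob)
  have i: "integrable (R \<xi>) f" using assms by (intro bm_integrable R_prob) (auto simp: bm_def)
  have "\<bar>T f \<xi>\<bar> \<le> (\<integral>x. \<bar>f x\<bar> \<partial>R \<xi>)" unfolding T_def by (rule integral_abs_bound)
  also have "\<dots> \<le> (\<integral>x. B \<partial>R \<xi>)" using i assms by (intro integral_mono) auto
  finally show ?thesis by (simp add: R.prob_space)
qed

lemma T_bm: "bm f \<Longrightarrow> bm (T f)"
proof -
  assume f: "bm f"
  then have [measurable]: "f \<in> borel_measurable borel" by (simp add: bm_def)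
  have "T f \<in> borel_measurable borel"
    unfolding T_def[abs_def]
    by (rule measurable_compose[OF measurable_prob_algebraD[OF R_meas] integral_measurable_subprob_algebra]) simp
  moreover obtain B where "\<And>x. \<bar>f x\<bar> \<le> B" using f by (auto simp: bm_def)
  ultimately show ?thesis using T_bounded[of f B] by (auto simp: bm_def)
qed

lemma funpow_T_bm: "bm f \<Longrightarrow> bm ((T ^^ k) f)"
  by (induction k) (auto intro: T_bm)

lemma integral_bind_R:
  assumes "bm f" "prob_space \<mu>" "sets \<mu> = sets borel"
  shows "integral\<^sup>L (\<mu> \<bind> R) f = integral\<^sup>L \<mu> (T f)"
proof -
  interpret prob_space \<mu> by fact
  obtain B where B: "\<And>x. \<bar>f x\<bar> \<le> B" using assms(1) by (auto simp: bm_def)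
  show ?thesis unfolding T_def
  proof (rule integral_bind[where K=borel and B'=1 and B=B])
    show "R \<in> \<mu> \<rightarrow>\<^sub>M subprob_algebra borel"
      unfolding measurable_cong_sets[OF assms(3) refl] by (intro measurable_prob_algebraD R_meas)
  qed (use assms B not_empty prob_space.emeasure_space_1[OF R_prob(1)] in \<open>auto simp: bm_def intro!: AE_I2\<close>)
qed

text \<open>Duality of laws and functions. The last factor \<open>R\<close> of the law acts on
  \<open>f\<close> before the induction hypothesis applies, which is why the induction generalizes
  over \<open>f\<close>.\<close>

lemma integral_\<nu>: "bm f \<Longrightarrow> integral\<^sup>L (\<nu> k \<xi>) f = (T ^^ k) f \<xi>"
proof (induction k arbitrary: f)
  case 0 then show ?case by (auto simp: bm_def integral_return)
next
  case (Suc k)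
  then show ?case using integral_bind_R[OF Suc.prems \<nu>_prob, of k \<xi>] Suc.IH[OF T_bm]
    by (simp add: funpow_swap1)
qed

end

subsection \<open>Contraction\<close>

context chain begin

section \<open>Path kernels as projections of the chain of pasts\<close>

lemma zero_ext_meas[measurable]: "zero_ext Q K \<in> borel \<rightarrow>\<^sub>M subprob_algebra borel"
proof -
  have "(\<lambda>\<xi>. if \<xi> \<in> X then Q \<xi> else null_measure borel) \<in> borel \<rightarrow>\<^sub>M subprob_algebra borel"
  proof (rule measurable_If_restrict_space_iff[THEN iffD2])
    show "{x \<in> space borel. x \<in> X} \<in> sets borel" by simp
    have "null_measure borel \<in> space (subprob_algebra (borel :: 'a measure))"
      by (auto simp: space_subprob_algebra intro!: subprob_spaceI)
    then show "Q \<in> restrict_space borel {\<xi>. \<xi> \<in> X} \<rightarrow>\<^sub>M subprob_algebra borel \<and>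
      (\<lambda>\<xi>. null_measure borel) \<in> restrict_space borel {\<xi>. \<xi> \<notin> X} \<rightarrow>\<^sub>M subprob_algebra borel"
      using measurable_prob_algebraD[OF Q_meas] by simp
  qed
  then show ?thesis by (simp add: zero_ext_def[abs_def])
qed

lemma past_append_meas:
  "past_append \<xi> k \<in> (\<Pi>\<^sub>M i\<in>{1..k}. borel) \<rightarrow>\<^sub>M (borel :: (nat \<Rightarrow> 'a) measure)"
proof (rule measurable_coordinatewise_then_product)
  fix j show "(\<lambda>y. past_append \<xi> k y j) \<in> borel_measurable (\<Pi>\<^sub>M i\<in>{1..k}. borel)"
    unfolding past_append_def by (cases "j < k") (auto intro!: measurable_component_singleton)
qed

text \<open>Reads the \<open>m\<close> most recent states in forward time order: component
  \<open>m\<close> is the present, which has index 0 in the past.\<close>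

definition block :: "nat \<Rightarrow> (nat \<Rightarrow> 'a) \<Rightarrow> nat \<Rightarrow> 'a" where
  "block m \<omega> = (\<lambda>i\<in>{1..m}. \<omega> (m - i))"

lemma block_meas[measurable]: "block m \<in> borel \<rightarrow>\<^sub>M (\<Pi>\<^sub>M i\<in>{1..m}. borel)"
  unfolding block_def by (intro measurable_restrict) simp

text \<open>The simplifier turns the lower index 1 into \<open>Suc 0\<close>; this variant matches
  the goals it leaves.\<close>

lemmas block_meas_Suc_0 = block_meas[unfolded One_nat_def]

lemma block_push: "block (Suc k) (push z \<omega>) = (block k \<omega>)(Suc k := z)"
  by (auto simp: block_def fun_eq_iff Suc_diff_le)

text \<open>The start sits untouched behind the k new states. It is needed because
  \<open>path_kernel\<close> attaches \<open>\<xi>\<close> anew at each step, whereas the chain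
  carries it along.\<close>

lemma AE_\<nu>_remote: "AE \<omega> in \<nu> k \<xi>. \<forall>j. \<omega> (j + k) = \<xi> j"
proof -
  have pred: "Measurable.pred borel (\<lambda>\<omega>::nat \<Rightarrow> 'a. \<forall>j. \<omega> (j + k) = \<xi> j)" for k \<xi>
    by measurable
  show ?thesis
  proof (induction k)
    case 0 then show ?case by (simp only: \<nu>.simps, subst AE_return) (use pred[of 0] in auto)
  next
    case (Suc k)
    have "AE \<omega> in R \<eta>. \<forall>j. \<omega> (j + Suc k) = \<xi> j" if "\<forall>j. \<eta> (j + k) = \<xi> j" for \<eta>
    proof -
      have "(\<lambda>y. push y \<eta>) \<in> Q' \<eta> \<rightarrow>\<^sub>M borel"
        unfolding measurable_cong_sets[OF Q'_prob(2) refl] by measurable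
      then show ?thesis
        unfolding R_def using that pred[of "Suc k" \<xi>] by (subst AE_distr_iff) auto
    qed
    then have "AE \<eta> in \<nu> k \<xi>. AE \<omega> in R \<eta>. \<forall>j. \<omega> (j + Suc k) = \<xi> j"
      using Suc by (auto elim!: eventually_mono)
    moreover have "R \<in> \<nu> k \<xi> \<rightarrow>\<^sub>M subprob_algebra borel"
      unfolding measurable_cong_sets[OF \<nu>_prob(2) refl] by (intro measurable_prob_algebraD R_meas)
    ultimately show ?case
      unfolding \<nu>.simps using AE_bind[of R "\<nu> k \<xi>" borel "\<lambda>\<omega>. \<forall>j. \<omega> (j + Suc k) = \<xi> j"] pred[of "Suc k" \<xi>] by blast
  qed
qed

text \<open>Almost surely the current past is the concatenation of \<open>\<xi>\<close> with its k
  newest states and lies in \<open>X\<close>. At such pasts \<open>zero_ext\<close> and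
  \<open>Q'\<close> both equal \<open>Q\<close>, so the two recursions perform the same
  step.\<close>

lemma path_kernel_eq:
  assumes \<xi>: "\<xi> \<in> X"
  shows "path_kernel Q K k \<xi> = distr (\<nu> k \<xi>) (\<Pi>\<^sub>M i\<in>{1..k}. borel) (block k)"
proof (induction k)
  case 0
  have "block 0 \<xi> = (\<lambda>_. undefined)" by (auto simp: block_def)
  then show ?case using block_meas[of 0] by (simp add: distr_return)
next
  case (Suc k)
  let ?N = "\<Pi>\<^sub>M i\<in>{1..k}. (borel :: 'a measure)" and ?N' = "\<Pi>\<^sub>M i\<in>{1..Suc k}. (borel :: 'a measure)"
  define G where "G y = distr (zero_ext Q K (past_append \<xi> k y)) ?N' (\<lambda>z. y(Suc k := z))" for y
  have upd: "(\<lambda>(y, z). y(Suc k := z)) \<in> ?N \<Otimes>\<^sub>M borel \<rightarrow>\<^sub>M ?N'"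
    using measurable_add_dim[of "Suc k" "{1..k}" "\<lambda>_. borel :: 'a measure"] by (simp add: atLeastAtMostSuc_conv)
  have G: "G \<in> ?N \<rightarrow>\<^sub>M subprob_algebra ?N'"
    unfolding G_def
    by (rule measurable_distr2[OF upd]) (rule measurable_compose[OF past_append_meas zero_ext_meas])
  have Rk: "(\<lambda>\<omega>. distr (R \<omega>) ?N' (block (Suc k))) \<in> borel \<rightarrow>\<^sub>M subprob_algebra ?N'"
    by (intro measurable_compose[OF measurable_prob_algebraD[OF R_meas] measurable_distr] block_meas)
  have "path_kernel Q K (Suc k) \<xi> = distr (\<nu> k \<xi>) ?N (block k) \<bind> G"
    unfolding path_kernel.simps Suc G_def ..
  also have "\<dots> = \<nu> k \<xi> \<bind> (\<lambda>\<omega>. G (block k \<omega>))"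
    using G by (intro bind_distr) (auto simp: measurable_cong_sets[OF \<nu>_prob(2) refl] block_meas_Suc_0)
  also have "\<dots> = \<nu> k \<xi> \<bind> (\<lambda>\<omega>. distr (R \<omega>) ?N' (block (Suc k)))"
  proof (rule bind_cong_AE[where B="?N'" and M="\<nu> k \<xi>"])
    show "AE \<omega> in \<nu> k \<xi>. G (block k \<omega>) = distr (R \<omega>) ?N' (block (Suc k))"
      using AE_\<nu>[OF \<xi>] AE_\<nu>_remote[of k \<xi>]
    proof eventually_elim
      case (elim \<omega>)
      have "past_append \<xi> k (block k \<omega>) = \<omega>"
      proof
        fix j show "past_append \<xi> k (block k \<omega>) j = \<omega> j"
          using elim(2)[rule_format, of "j - k"] by (auto simp: past_append_def block_def)
      qed
      moreover have "(\<lambda>y. push y \<omega>) \<in> Q' \<omega> \<rightarrow>\<^sub>M borel"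
        unfolding measurable_cong_sets[OF Q'_prob(2) refl] by measurable
      ultimately show ?case
        using elim(1) by (simp add: G_def R_def zero_ext_def Q'_eq distr_distr comp_def block_push block_meas_Suc_0)
    qed
  qed (use measurable_compose[OF block_meas[of k] G] Rk in \<open>auto simp: measurable_cong_sets[OF \<nu>_prob(2) refl]\<close>)
  also have "\<dots> = distr (\<nu> k \<xi> \<bind> R) ?N' (block (Suc k))"
    by (rule distr_bind[symmetric, where K=borel])
      (auto simp: measurable_cong_sets[OF \<nu>_prob(2) refl] intro!: measurable_prob_algebraD block_meas_Suc_0)
  finally show ?case by simp
qed

lemma last_kernel_eq:
  assumes \<xi>: "\<xi> \<in> X"
  shows "last_kernel Q K k m \<xi> = distr (\<nu> (k + m) \<xi>) (\<Pi>\<^sub>M i\<in>{1..m}. borel) (block m)"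
proof -
  have "(\<lambda>y. \<lambda>i\<in>{1..m}. y (k + i)) \<in> (\<Pi>\<^sub>M i\<in>{1..k + m}. (borel :: 'a measure)) \<rightarrow>\<^sub>M (\<Pi>\<^sub>M i\<in>{1..m}. borel)"
    by (intro measurable_restrict measurable_component_singleton) auto
  then have "last_kernel Q K k m \<xi> = distr (\<nu> (k + m) \<xi>) (\<Pi>\<^sub>M i\<in>{1..m}. borel)
      ((\<lambda>y. \<lambda>i\<in>{1..m}. y (k + i)) \<circ> block (k + m))"
    unfolding last_kernel_def path_kernel_eq[OF \<xi>]
    by (intro distr_distr) (auto simp: measurable_cong_sets[OF \<nu>_prob(2) refl] block_meas_Suc_0)
  also have "(\<lambda>y. \<lambda>i\<in>{1..m}. y (k + i)) \<circ> block (k + m) = block m"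
    by (auto simp: block_def fun_eq_iff)
  finally show ?thesis .
qed

text \<open>The mixed integral of f(\<xi>', y) against Q(\<xi>; dy) is inserted. One difference then
  has a common law and two integrands, which costs \<open>b\<close>; the other has a common
  integrand of oscillation \<open>c\<close> and two laws, which costs \<open>c\<close> times their
  total variation distance.\<close>

lemma T_diff:
  assumes f: "bm f" and \<xi>: "\<xi> \<in> X" "\<xi>' \<in> X"
    and osc: "\<And>\<omega> \<omega>'. \<omega> \<in> X \<Longrightarrow> \<omega>' \<in> X \<Longrightarrow> \<bar>f \<omega> - f \<omega>'\<bar> \<le> c"
    and b: "\<And>y. y \<in> K \<Longrightarrow> \<bar>f (push y \<xi>) - f (push y \<xi>')\<bar> \<le> b"
  shows "\<bar>T f \<xi> - T f \<xi>'\<bar> \<le> b + c * (C * d \<xi> \<xi>')"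
proof -
  have [measurable]: "f \<in> borel_measurable borel" using f by (simp add: bm_def)
  interpret Q1: prob_space "Q' \<xi>" by (rule Q'_prob)
  have fm: "(\<lambda>y. f (push y \<eta>)) \<in> borel_measurable (Q' \<zeta>)" for \<eta> \<zeta>
    unfolding measurable_cong_sets[OF Q'_prob(2) refl] by measurable
  have pm: "(\<lambda>y. push y \<eta>) \<in> Q' \<eta> \<rightarrow>\<^sub>M borel" for \<eta>
    unfolding measurable_cong_sets[OF Q'_prob(2) refl] by measurable
  have T: "T f \<eta> = (\<integral>y. f (push y \<eta>) \<partial>Q' \<eta>)" for \<eta>
    unfolding T_def R_def using pm by (intro integral_distr) auto
  obtain B where B: "\<And>x. \<bar>f x\<bar> \<le> B" using f by (auto simp: bm_def)
  have int: "integrable (Q' \<xi>) (\<lambda>y. f (push y \<eta>))" for \<eta>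
    using B fm by (intro Q1.integrable_const_bound[where B=B]) auto
  have "\<bar>T f \<xi> - (\<integral>y. f (push y \<xi>') \<partial>Q' \<xi>)\<bar> = \<bar>\<integral>y. f (push y \<xi>) - f (push y \<xi>') \<partial>Q' \<xi>\<bar>"
    unfolding T using int by simp
  also have "\<dots> \<le> (\<integral>y. \<bar>f (push y \<xi>) - f (push y \<xi>')\<bar> \<partial>Q' \<xi>)" by (rule integral_abs_bound)
  also have "\<dots> \<le> (\<integral>y. b \<partial>Q' \<xi>)"
    using int b AE_Q'[OF \<xi>(1)] by (intro integral_mono_AE) (auto elim!: eventually_mono)
  finally have 1: "\<bar>T f \<xi> - (\<integral>y. f (push y \<xi>') \<partial>Q' \<xi>)\<bar> \<le> b" by (simp add: Q1.prob_space)
  obtain l u where lu: "\<And>x. x \<in> X \<Longrightarrow> l \<le> f x" "\<And>x. x \<in> X \<Longrightarrow> f x \<le> u" "u - l \<le> c"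
    by (rule obtain_osc_bounds[of X f c]) (use X_ne osc in auto)
  have ae: "AE y in Q' \<eta>. l \<le> f (push y \<xi>') \<and> f (push y \<xi>') \<le> l + c" if "\<eta> \<in> X" for \<eta>
    using AE_Q'[OF that]
  proof eventually_elim
    case (elim y) then show ?case using lu(1,2)[OF push_X[OF \<xi>(2) elim]] lu(3) by auto
  qed
  have "\<bar>(\<integral>y. f (push y \<xi>') \<partial>Q' \<xi>) - (\<integral>y. f (push y \<xi>') \<partial>Q' \<xi>')\<bar> \<le> c * (C * d \<xi> \<xi>')"
  proof (rule abs_integral_diff_le[where m=l])
    fix A assume "A \<in> sets (Q' \<xi>)"
    then show "\<bar>measure (Q' \<xi>) A - measure (Q' \<xi>') A\<bar> \<le> C * d \<xi> \<xi>'"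
      using Q_lip[OF \<xi>, of A] \<xi> unfolding Q'_prob(2) by (simp add: Q'_eq)
  qed (use \<xi> fm ae in \<open>simp_all add: Q'_prob\<close>)
  then show ?thesis using 1 T[of \<xi>'] by linarith
qed

section \<open>Oscillation and Lipschitz bounds along the iteration\<close>

definition osc_le :: "((nat \<Rightarrow> 'a) \<Rightarrow> real) \<Rightarrow> real \<Rightarrow> bool" where
  "osc_le f c \<longleftrightarrow> (\<forall>\<omega>\<in>X. \<forall>\<omega>'\<in>X. \<bar>f \<omega> - f \<omega>'\<bar> \<le> c)"

definition lip_le :: "((nat \<Rightarrow> 'a) \<Rightarrow> real) \<Rightarrow> real \<Rightarrow> bool" where
  "lip_le f L \<longleftrightarrow> (\<forall>\<omega>\<in>X. \<forall>\<omega>'\<in>X. \<bar>f \<omega> - f \<omega>'\<bar> \<le> L * d \<omega> \<omega>')"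

text \<open>Both values are averages of \<open>f\<close> over laws carried by \<open>X\<close>. The
  exponents may differ, which later yields the Cauchy property in time.\<close>

lemma funpow_T_close:
  assumes "bm f" "osc_le f c" "\<xi> \<in> X" "\<xi>' \<in> X"
  shows "\<bar>(T ^^ k) f \<xi> - (T ^^ l) f \<xi>'\<bar> \<le> c"
  unfolding integral_\<nu>[OF assms(1), symmetric]
  using assms by (intro integral_diff_le_osc[where N=borel and X=X] \<nu>_prob AE_\<nu> X_ne)
    (auto simp: osc_le_def bm_def)

lemma funpow_T_osc: "bm f \<Longrightarrow> osc_le f c \<Longrightarrow> osc_le ((T ^^ k) f) c"
  using funpow_T_close[of f c] by (auto simp: osc_le_def)

lemma T_osc: "bm f \<Longrightarrow> osc_le f c \<Longrightarrow> osc_le (T f) c"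
  using funpow_T_osc[of f c 1] by simp

lemma osc_le_nonneg: "osc_le f c \<Longrightarrow> 0 \<le> c"
  using \<xi>0 by (force simp: osc_le_def)

lemma T_lip:
  assumes "bm f" "osc_le f c" "lip_le f L"
  shows "lip_le (T f) (L / \<iota> + c * C)"
  unfolding lip_le_def
proof (intro ballI)
  fix \<xi> \<xi>' assume \<xi>: "\<xi> \<in> X" "\<xi>' \<in> X"
  have "\<bar>T f \<xi> - T f \<xi>'\<bar> \<le> L * (d \<xi> \<xi>' / \<iota>) + c * (C * d \<xi> \<xi>')"
  proof (rule T_diff[OF assms(1) \<xi>])
    fix y assume y: "y \<in> K"
    show "\<bar>f (push y \<xi>) - f (push y \<xi>')\<bar> \<le> L * (d \<xi> \<xi>' / \<iota>)"
      using assms(3) push_X[OF \<xi>(1) y] push_X[OF \<xi>(2) y] d_push[OF \<xi> y] unfolding lip_le_def by metis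
  qed (use assms(2) in \<open>auto simp: osc_le_def\<close>)
  then show "\<bar>T f \<xi> - T f \<xi>'\<bar> \<le> (L / \<iota> + c * C) * d \<xi> \<xi>'" by (simp add: algebra_simps)
qed

text \<open>
  If \<open>f\<close> depends on the last \<open>m\<close> coordinates only, two copies of the chain which share their next \<open>m\<close>
  coordinates give \<open>f\<close> the same value; this bounds the Lipschitz constant independently of \<open>m\<close>.
\<close>

lemma funpow_T_lip_of_dep_on:
  assumes f: "bm f" "osc_le f c" "dep_on m f"
  shows "lip_le ((T ^^ m) f) (c * (C * \<iota> / (\<iota> - 1)))"
proof -
  \<comment> \<open>The fixed point of x \<mapsto> x/\<iota> + C, that is, the sum of the geometric
    series with first term C and ratio 1/\<iota>.\<close>
  define L where "L = C * \<iota> / (\<iota> - 1)"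
  have L: "L / \<iota> + C = L" "L > 0" using \<iota> C by (auto simp: L_def field_simps)
  \<comment> \<open>Strengthened for the induction: after \<open>k\<close> applications the two
    pasts need to agree only on m - k recent coordinates. For k = 0 this gives equal values, and for
    k = m no condition is left.\<close>
  have "\<bar>(T ^^ k) f \<xi> - (T ^^ k) f \<xi>'\<bar> \<le> c * L * d \<xi> \<xi>'"
    if "k \<le> m" "\<xi> \<in> X" "\<xi>' \<in> X" "\<And>j. j < m - k \<Longrightarrow> \<xi> j = \<xi>' j" for k \<xi> \<xi>'
    using that
  proof (induction k arbitrary: \<xi> \<xi>')
    case 0
    then have "f \<xi> = f \<xi>'" using f(3) by (auto simp: dep_on_def)
    then show ?case using osc_le_nonneg[OF f(2)] L d_nonneg[of \<xi> \<xi>'] 0 by simp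
  next
    case (Suc k)
    have "\<bar>T ((T ^^ k) f) \<xi> - T ((T ^^ k) f) \<xi>'\<bar> \<le> c * L * (d \<xi> \<xi>' / \<iota>) + c * (C * d \<xi> \<xi>')"
    proof (rule T_diff[OF funpow_T_bm[OF f(1)] Suc.prems(2,3)])
      fix y assume y: "y \<in> K"
      have "push y \<xi> j = push y \<xi>' j" if "j < m - k" for j
        using that Suc.prems by (cases j) auto
      then show "\<bar>(T ^^ k) f (push y \<xi>) - (T ^^ k) f (push y \<xi>')\<bar> \<le> c * L * (d \<xi> \<xi>' / \<iota>)"
        using Suc.IH[of "push y \<xi>" "push y \<xi>'"] Suc.prems push_X[OF _ y] d_push[OF Suc.prems(2,3) y] by simp
    qed (use funpow_T_osc[OF f(1,2), of k] in \<open>auto simp: osc_le_def\<close>)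
    also have "\<dots> = c * (L / \<iota> + C) * d \<xi> \<xi>'" by (simp add: algebra_simps)
    finally show ?case using L by simp
  qed
  from this[of m] show ?thesis by (auto simp: lip_le_def L_def)
qed

text \<open>
  Contraction in the seminorm attached to the distance \<open>min 1 (\<theta> d)\<close>: nearby points are handled by
  the Lipschitz bound of \<^term>\<open>T\<close>, distant ones by the common return to a small set.
\<close>

lemma contraction:
  assumes SR: "hyp_SR K Q"
  obtains N \<alpha> \<theta> where "N \<ge> 1" "0 < \<alpha>" "\<alpha> < 1" "0 < \<theta>"
    "\<And>f c. bm f \<Longrightarrow> osc_le f c \<Longrightarrow> lip_le f (c * \<theta>) \<Longrightarrow>
      osc_le ((T ^^ N) f) (\<alpha> * c) \<and> lip_le ((T ^^ N) f) (\<alpha> * c * \<theta>)"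
proof -
  \<comment> \<open>The midpoint of 1/\<iota> and 1 leaves room for the additive term C: with this
    \<open>\<theta>\<close>, one step takes the Lipschitz constant c \<theta> to a c
    \<theta>.\<close>
  define a where "a = (1 + 1/\<iota>) / 2"
  have a: "0 < a" "a < 1" "1/\<iota> < a" using \<iota> by (auto simp: a_def field_simps)
  define \<theta> where "\<theta> = C / (a - 1/\<iota>)"
  have \<theta>: "\<theta> > 0" using C a by (simp add: \<theta>_def)
  have "\<theta> * (a - 1/\<iota>) = C" using a by (simp add: \<theta>_def)
  then have a\<theta>: "\<theta> / \<iota> + C = a * \<theta>" by (simp add: algebra_simps)
  \<comment> \<open>At \<open>d\<close>-distance at most 1/(2 \<theta>) a function with Lipschitz
    constant c \<theta> varies by at most c/2.\<close>
  obtain n \<delta> where n: "n \<ge> 1" "\<delta> > 0" and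
    close: "\<And>\<omega> \<omega>'. \<omega> \<in> X \<Longrightarrow> \<omega>' \<in> X \<Longrightarrow> (\<And>j. j < n \<Longrightarrow> norm (\<omega> j - \<omega>' j) \<le> \<delta>) \<Longrightarrow> d \<omega> \<omega>' \<le> 1 / (2 * \<theta>)"
    using d_close[of "1 / (2 * \<theta>)"] \<theta> by auto
  \<comment> \<open>Balls of radius \<delta>/2, so that two points of the same ball are less than
    \<delta> apart.\<close>
  have "\<delta> / 2 > 0" using n by simp
  then obtain x s where p0: "(INF \<xi>\<in>X. measure (last_kernel Q K s n \<xi>) (\<Pi>\<^sub>E i\<in>{1..n}. ball (x i) (\<delta>/2))) > 0"
    using SR n(1) unfolding hyp_SR_def by blast
  define p where "p = (INF \<xi>\<in>X. measure (last_kernel Q K s n \<xi>) (\<Pi>\<^sub>E i\<in>{1..n}. ball (x i) (\<delta>/2)))"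
  define A where "A = block n -` (\<Pi>\<^sub>E i\<in>{1..n}. ball (x i) (\<delta>/2))"
  have Em: "(\<Pi>\<^sub>E i\<in>{1..n}. ball (x i) (\<delta>/2)) \<in> sets (\<Pi>\<^sub>M i\<in>{1..n}. borel)"
    by (intro sets_PiM_I_finite) auto
  have A: "A \<in> sets borel"
    unfolding A_def using measurable_sets[OF block_meas Em] by simp
  have pA: "p \<le> measure (\<nu> (s + n) \<xi>) A" if "\<xi> \<in> X" for \<xi>
  proof -
    have "p \<le> measure (last_kernel Q K s n \<xi>) (\<Pi>\<^sub>E i\<in>{1..n}. ball (x i) (\<delta>/2))"
      unfolding p_def by (intro cINF_lower that bdd_belowI2[where m=0]) auto
    also have "\<dots> = measure (\<nu> (s + n) \<xi>) A"
      unfolding last_kernel_eq[OF that] A_def using Em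
      by (subst measure_distr) (auto simp: measurable_cong_sets[OF \<nu>_prob(2) refl] block_meas_Suc_0)
    finally show ?thesis .
  qed
  have p: "p > 0" using p0 by (simp add: p_def)
  have p1: "p \<le> 1" using pA[OF \<xi>0] prob_space.prob_le_1[OF \<nu>_prob(1), of "s + n" \<xi>0 A] by linarith
  define N where "N = s + n"
  \<comment> \<open>The first entry is the gain in the Lipschitz constant; the second is the gain in
    oscillation, from c - p (c - c/2).\<close>
  define \<alpha> where "\<alpha> = max a (1 - p / 2)"
  show thesis
  proof (rule that[of N \<alpha> \<theta>])
    show "N \<ge> 1" "0 < \<alpha>" "\<alpha> < 1" "0 < \<theta>" using n a p \<theta> by (auto simp: N_def \<alpha>_def)
    fix f c assume f: "bm f" "osc_le f c" "lip_le f (c * \<theta>)"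
    have c: "c \<ge> 0" using osc_le_nonneg[OF f(2)] .
    have "osc_le ((T ^^ N) f) (\<alpha> * c)"
      unfolding osc_le_def integral_\<nu>[OF f(1), symmetric]
    proof (intro ballI)
      fix \<xi> \<xi>' assume \<xi>: "\<xi> \<in> X" "\<xi>' \<in> X"
      have "\<bar>integral\<^sup>L (\<nu> N \<xi>) f - integral\<^sup>L (\<nu> N \<xi>') f\<bar> \<le> c - p * (c - c / 2)"
      proof (rule integral_diff_le_minorization[where N=borel and X=X and A=A])
        fix \<omega> \<omega>' assume w: "\<omega> \<in> X \<inter> A" "\<omega>' \<in> X \<inter> A"
        have "norm (\<omega> j - \<omega>' j) \<le> \<delta>" if "j < n" for j
        proof -
          have "n - j \<in> {1..n}" "n - (n - j) = j" using that by auto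
          moreover have "block n \<omega> (n - j) \<in> ball (x (n - j)) (\<delta>/2)" "block n \<omega>' (n - j) \<in> ball (x (n - j)) (\<delta>/2)"
            using w calculation(1) by (auto simp only: A_def Int_iff vimage_eq intro: PiE_mem)
          ultimately have "\<omega> j \<in> ball (x (n - j)) (\<delta>/2)" "\<omega>' j \<in> ball (x (n - j)) (\<delta>/2)"
            by (simp_all add: block_def)
          then have "dist (\<omega> j) (\<omega>' j) < \<delta>" by (auto intro: dist_triangle_half_r)
          then show ?thesis by (simp add: dist_norm)
        qed
        then have "d \<omega> \<omega>' \<le> 1 / (2 * \<theta>)" using w close by auto
        then have "c * \<theta> * d \<omega> \<omega>' \<le> c * \<theta> * (1 / (2 * \<theta>))"
          using c \<theta> by (intro mult_left_mono) auto
        moreover have "\<bar>f \<omega> - f \<omega>'\<bar> \<le> c * \<theta> * d \<omega> \<omega>'" using w f(3) by (auto simp: lip_le_def)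
        ultimately show "\<bar>f \<omega> - f \<omega>'\<bar> \<le> c / 2" using \<theta> by simp
      qed (use \<xi> f(1,2) pA p A in \<open>auto simp: N_def bm_def osc_le_def intro!: \<nu>_prob AE_\<nu> X_ne \<close>)
      also have "\<dots> = (1 - p / 2) * c" by (simp add: algebra_simps)
      also have "\<dots> \<le> \<alpha> * c" using c by (intro mult_right_mono) (auto simp: \<alpha>_def)
      finally show "\<bar>integral\<^sup>L (\<nu> N \<xi>) f - integral\<^sup>L (\<nu> N \<xi>') f\<bar> \<le> \<alpha> * c" .
    qed
    moreover have "lip_le ((T ^^ N) f) (\<alpha> * c * \<theta>)"
    proof -
      \<comment> \<open>The factor \<open>a\<close> is gained at the first step and merely kept
        afterwards, since the bound \<open>c\<close> on the oscillation enters again at every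
        step.\<close>
      have *: "lip_le ((T ^^ Suc k) f) (a * c * \<theta>)" for k
      proof (induction k)
        case 0
        have "c * \<theta> / \<iota> + c * C = a * c * \<theta>" using arg_cong[OF a\<theta>, of "\<lambda>x. c * x"] by (simp add: algebra_simps)
        then show ?case using T_lip[OF f] by simp
      next
        case (Suc k)
        have "a * c * \<theta> / \<iota> + c * C \<le> c * (\<theta> / \<iota> + C)"
          using a c \<theta> \<iota> by (simp add: algebra_simps divide_right_mono mult_left_le_one_le mult_left_mono)
        then have le: "a * c * \<theta> / \<iota> + c * C \<le> a * c * \<theta>" unfolding a\<theta> by (simp add: mult_ac)
        have l: "lip_le (T ((T ^^ Suc k) f)) (a * c * \<theta> / \<iota> + c * C)"
          by (rule T_lip[OF funpow_T_bm[OF f(1)] funpow_T_osc[OF f(1,2)] Suc])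
        show ?case unfolding lip_le_def
        proof (intro ballI)
          fix \<omega> \<omega>' assume w: "\<omega> \<in> X" "\<omega>' \<in> X"
          have "\<bar>T ((T ^^ Suc k) f) \<omega> - T ((T ^^ Suc k) f) \<omega>'\<bar> \<le> (a * c * \<theta> / \<iota> + c * C) * d \<omega> \<omega>'"
            using l w unfolding lip_le_def by blast
          also have "\<dots> \<le> (a * c * \<theta>) * d \<omega> \<omega>'" using le d_nonneg[OF w] by (rule mult_right_mono)
          finally show "\<bar>(T ^^ Suc (Suc k)) f \<omega> - (T ^^ Suc (Suc k)) f \<omega>'\<bar> \<le> a * c * \<theta> * d \<omega> \<omega>'" by simp
        qed
      qed
      obtain k where k: "N = Suc k" using n by (cases N) (auto simp: N_def)
      have "a * c * \<theta> \<le> \<alpha> * c * \<theta>" using c \<theta> by (intro mult_right_mono) (auto simp: \<alpha>_def)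
      then show ?thesis
        using *[of k] unfolding k lip_le_def by (meson d_nonneg mult_right_mono order_trans)
    qed
    ultimately show "osc_le ((T ^^ N) f) (\<alpha> * c) \<and> lip_le ((T ^^ N) f) (\<alpha> * c * \<theta>)" ..
  qed
qed

text \<open>After \<open>m\<close> steps a cylinder function has become Lipschitz. The other
  \<open>k\<close> steps are split into k div N contracting blocks of length N and a remainder k mod
  N, which does not increase the oscillation.\<close>

lemma exponential_forgetting:
  assumes SR: "hyp_SR K Q"
  obtains D \<gamma> where "D > 0" "\<gamma> > 0"
    "\<And>f c m k. bm f \<Longrightarrow> osc_le f c \<Longrightarrow> dep_on m f \<Longrightarrow> osc_le ((T ^^ (k + m)) f) (c * (D * exp (- \<gamma> * real k)))"
proof -
  obtain N \<alpha> \<theta> where N: "N \<ge> 1" "0 < \<alpha>" "\<alpha> < 1" "0 < \<theta>" and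
    contr: "\<And>f c. bm f \<Longrightarrow> osc_le f c \<Longrightarrow> lip_le f (c * \<theta>) \<Longrightarrow>
      osc_le ((T ^^ N) f) (\<alpha> * c) \<and> lip_le ((T ^^ N) f) (\<alpha> * c * \<theta>)"
    using contraction[OF SR] by metis
  define L where "L = C * \<iota> / (\<iota> - 1)"
  have L: "L > 0" using C \<iota> by (simp add: L_def)
  \<comment> \<open>Enlarging the nominal oscillation from c to c b makes the Lipschitz constant c L
    admissible for the contraction.\<close>
  define b where "b = max 1 (L / \<theta>)"
  have b: "b \<ge> 1" "L \<le> b * \<theta>" using N(4) by (auto simp: b_def field_simps max_def)
  define \<gamma> where "\<gamma> = - ln \<alpha> / real N"
  have \<gamma>: "\<gamma> > 0" using N by (simp add: \<gamma>_def divide_neg_pos)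
  \<comment> \<open>The factor 1/\<alpha> pays for rounding k/N down to k div N.\<close>
  define D where "D = b / \<alpha>"
  have D: "D > 0" using b N by (simp add: D_def)
  have iter: "osc_le (((T ^^ N) ^^ q) f) (\<alpha> ^ q * c) \<and> lip_le (((T ^^ N) ^^ q) f) (\<alpha> ^ q * c * \<theta>) \<and> bm (((T ^^ N) ^^ q) f)"
    if f: "bm f" "osc_le f c" "lip_le f (c * \<theta>)" for f c q
  proof (induction q)
    case 0 then show ?case using f by simp
  next
    case (Suc q)
    then show ?case using contr[of "((T ^^ N) ^^ q) f" "\<alpha> ^ q * c"] funpow_T_bm[of "((T ^^ N) ^^ q) f" N]
      by (simp add: mult.assoc)
  qed
  have rate: "\<alpha> ^ (k div N) \<le> exp (- \<gamma> * real k) / \<alpha>" for k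
  proof -
    have "real k \<le> real N * (real (k div N) + 1)"
    proof -
      have "k \<le> N * (k div N + 1)"
        using N(1) by (metis div_less_iff_less_mult dual_order.strict_iff_order less_add_one mult.commute nat_less_le not_less_eq Suc_eq_plus1 lessI zero_less_one order_less_le_trans)
      then show ?thesis by (metis of_nat_1 of_nat_add of_nat_le_iff of_nat_mult)
    qed
    then have "real k / real N \<le> real (k div N) + 1" using N(1) by (simp add: field_simps)
    then have "ln \<alpha> * (real (k div N) + 1) \<le> ln \<alpha> * (real k / real N)"
      using N by (intro mult_left_mono_neg) auto
    then have "exp (ln \<alpha> * real (k div N) + ln \<alpha>) \<le> exp (- \<gamma> * real k)"
      by (subst exp_le_cancel_iff) (simp add: \<gamma>_def algebra_simps)
    moreover have "exp (ln \<alpha> * real (k div N) + ln \<alpha>) = \<alpha> ^ (k div N) * \<alpha>"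
      using N(2) by (simp add: exp_add exp_of_nat2_mult mult.commute)
    ultimately show ?thesis using N(2) by (simp add: pos_le_divide_eq)
  qed
  show thesis
  proof (rule that[OF D \<gamma>])
    fix f c m k assume f: "bm f" "osc_le f c" "dep_on m f"
    define g where "g = (T ^^ m) f"
    have c: "c \<ge> 0" using osc_le_nonneg[OF f(2)] .
    have g: "bm g" "osc_le g c" "lip_le g (c * L)"
      using f funpow_T_bm funpow_T_osc funpow_T_lip_of_dep_on by (auto simp: g_def L_def)
    have "c * 1 \<le> c * b" using b c by (intro mult_left_mono) auto
    then have g2: "osc_le g (c * b)" using g(2) by (force simp: osc_le_def)
    have "c * L \<le> c * b * \<theta>" using b c by (simp add: mult.assoc mult_left_mono)
    then have g3: "lip_le g (c * b * \<theta>)"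
      using g(3) unfolding lip_le_def by (meson d_nonneg mult_right_mono order_trans)
    have "(T ^^ (k + m)) f = (T ^^ (k mod N + N * (k div N))) g"
      by (simp add: g_def funpow_add)
    also have "\<dots> = (T ^^ (k mod N)) (((T ^^ N) ^^ (k div N)) g)"
      by (simp only: funpow_add funpow_mult o_apply)
    finally have eq: "(T ^^ (k + m)) f = (T ^^ (k mod N)) (((T ^^ N) ^^ (k div N)) g)" .
    have "osc_le ((T ^^ (k + m)) f) (\<alpha> ^ (k div N) * (c * b))"
      unfolding eq using iter[OF g(1) g2 g3] by (intro funpow_T_osc) auto
    moreover have "\<alpha> ^ (k div N) * (c * b) \<le> c * (D * exp (- \<gamma> * real k))"
      using mult_right_mono[OF rate[of k], of "c * b"] c b by (simp add: D_def field_simps)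
    ultimately show "osc_le ((T ^^ (k + m)) f) (c * (D * exp (- \<gamma> * real k)))"
      by (force simp: osc_le_def)
  qed
qed

end

subsection \<open>The limiting two-sided law\<close>

text \<open>Finite-dimensional boxes determine a law of sequences. Coordinate 0 is written apart
  because it is the one that a step of the chain adds.\<close>

lemma seq_measure_eqI:
  fixes \<mu>1 \<mu>2 :: "(nat \<Rightarrow> 'b::second_countable_topology) measure"
  assumes p: "prob_space \<mu>1" "prob_space \<mu>2" and s: "sets \<mu>1 = sets borel" "sets \<mu>2 = sets borel"
    and eq: "\<And>n A. (\<And>j. A j \<in> sets borel) \<Longrightarrow>
      emeasure \<mu>1 {\<omega>. \<omega> 0 \<in> A 0 \<and> (\<forall>j<n. \<omega> (Suc j) \<in> A (Suc j))} = emeasure \<mu>2 {\<omega>. \<omega> 0 \<in> A 0 \<and> (\<forall>j<n. \<omega> (Suc j) \<in> A (Suc j))}"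
  shows "\<mu>1 = \<mu>2"
proof (rule measure_eqI_PiM_infinite[where I=UNIV and M="\<lambda>_. borel"])
  fix A :: "nat \<Rightarrow> 'b set" and J assume J: "finite J" "\<And>i. i \<in> J \<Longrightarrow> A i \<in> sets borel"
  define A' where "A' i = (if i \<in> J then A i else UNIV)" for i
  define n where "n = Suc (Max (insert 0 J))"
  have n: "j < n" if "j \<in> J" for j using that J(1) by (simp add: n_def less_Suc_eq_le)
  have "prod_emb UNIV (\<lambda>_. borel) J (Pi\<^sub>E J A) = {\<omega>. \<omega> 0 \<in> A' 0 \<and> (\<forall>j<n. \<omega> (Suc j) \<in> A' (Suc j))}"
  proof -
    have "(\<forall>i\<in>J. \<omega> i \<in> A i) \<longleftrightarrow> \<omega> 0 \<in> A' 0 \<and> (\<forall>j<n. \<omega> (Suc j) \<in> A' (Suc j))" for \<omega>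
    proof
      assume r: "\<omega> 0 \<in> A' 0 \<and> (\<forall>j<n. \<omega> (Suc j) \<in> A' (Suc j))"
      show "\<forall>i\<in>J. \<omega> i \<in> A i"
      proof
        fix i assume i: "i \<in> J"
        show "\<omega> i \<in> A i"
        proof (cases i)
          case 0 then show ?thesis using r i by (auto simp: A'_def)
        next
          case (Suc j)
          then have "j < n" using n[OF i] by simp
          then have "\<omega> (Suc j) \<in> A' (Suc j)" using r by blast
          then show ?thesis using Suc i by (simp add: A'_def)
        qed
      qed
    qed (auto simp: A'_def)
    then have "{\<omega>. \<forall>i\<in>J. \<omega> i \<in> A i} = {\<omega>. \<omega> 0 \<in> A' 0 \<and> (\<forall>j<n. \<omega> (Suc j) \<in> A' (Suc j))}"
      by (simp only:)
    moreover have "prod_emb UNIV (\<lambda>_. borel) J (Pi\<^sub>E J A) = {\<omega>. \<forall>i\<in>J. \<omega> i \<in> A i}"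
      by (auto simp: prod_emb_def space_PiM Pi_iff)
    ultimately show ?thesis by simp
  qed
  then show "emeasure \<mu>1 (prod_emb UNIV (\<lambda>_. borel) J (Pi\<^sub>E J A)) = emeasure \<mu>2 (prod_emb UNIV (\<lambda>_. borel) J (Pi\<^sub>E J A))"
    using eq[of A' n] J(2) by (simp add: A'_def)
qed (use s p in \<open>simp_all add: sets_PiM_equal_borel prob_space.finite_measure\<close>)

text \<open>The history of a two-sided path up to and including time \<open>a\<close>, in the
  reversed indexing of pasts.\<close>

definition pst :: "int \<Rightarrow> (int \<Rightarrow> 'b) \<Rightarrow> nat \<Rightarrow> 'b" where
  "pst a x = (\<lambda>j. x (a - int j))"

lemma pst_measurable[measurable]:
  "(pst a :: (int \<Rightarrow> 'b::second_countable_topology) \<Rightarrow> _) \<in> (\<Pi>\<^sub>M k\<in>UNIV. borel) \<rightarrow>\<^sub>M borel"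
  unfolding pst_def by (rule measurable_coordinatewise_then_product) simp

text \<open>A finite set of times has an upper bound, so each finite-dimensional event is an event
  of some one-sided history. Questions about two-sided laws thereby reduce to laws of pasts.\<close>

lemma two_sided_measure_eqI:
  fixes N1 N2 :: "(int \<Rightarrow> 'b::second_countable_topology) measure"
  assumes p: "prob_space N1" and s: "sets N1 = sets (\<Pi>\<^sub>M k\<in>UNIV. borel)" "sets N2 = sets (\<Pi>\<^sub>M k\<in>UNIV. borel)"
    and eq: "\<And>a. distr N1 borel (pst a) = distr N2 borel (pst a)"
  shows "N1 = N2"
proof (rule measure_eqI_PiM_infinite[OF s])
  fix A :: "int \<Rightarrow> 'b set" and J assume J: "finite J" "\<And>i. i \<in> J \<Longrightarrow> A i \<in> sets borel"
  define a where "a = Max (insert 0 J)"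
  have a: "t \<le> a" if "t \<in> J" for t using that J(1) by (simp add: a_def)
  define B where "B = (\<Inter>t\<in>J. (\<lambda>\<omega>. \<omega> (nat (a - t))) -` A t)"
  have "(\<lambda>\<omega>. \<omega> (nat (a - t))) -` A t \<in> sets borel" if "t \<in> J" for t
    using measurable_sets[OF measurable_product_coordinates[of "nat (a - t)"] J(2)[OF that]] by simp
  then have B: "B \<in> sets borel"
    unfolding B_def using J(1) by (cases "J = {}") auto
  have e: "prod_emb UNIV (\<lambda>_. borel) J (Pi\<^sub>E J A) = pst a -` B \<inter> space (\<Pi>\<^sub>M k\<in>UNIV. borel)"
    using a by (auto simp: prod_emb_def space_PiM B_def pst_def)
  have "emeasure N (pst a -` B \<inter> space (\<Pi>\<^sub>M k\<in>UNIV. borel)) = emeasure (distr N borel (pst a)) B"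
    if "sets N = sets (\<Pi>\<^sub>M k\<in>UNIV. borel)" for N :: "(int \<Rightarrow> 'b) measure"
    using B that sets_eq_imp_space_eq[OF that]
    by (subst emeasure_distr) (auto simp: measurable_cong_sets[OF that refl])
  then show "emeasure N1 (prod_emb UNIV (\<lambda>_. borel) J (Pi\<^sub>E J A)) = emeasure N2 (prod_emb UNIV (\<lambda>_. borel) J (Pi\<^sub>E J A))"
    unfolding e using s eq[of a] by simp
qed (use p in \<open>simp add: prob_space.finite_measure\<close>)

lemma closed_measure_support: "closed (measure_support (\<mu> :: 'b::topological_space measure))"
proof -
  have "- measure_support \<mu> = \<Union>{U. open U \<and> emeasure \<mu> U = 0}"
    by (auto simp: measure_support_def zero_less_iff_neq_zero)
  then have "open (- measure_support \<mu>)" by (auto intro: open_Union)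
  then show ?thesis by (simp add: closed_def)
qed

context chain begin

section \<open>Cylinder events and the forgetting of the newest states\<close>

lemma bm_indicator: "A \<in> sets borel \<Longrightarrow> bm (indicator A)"
  by (auto simp: bm_def indicator_def intro!: exI[of _ 1])

lemma osc_indicator: "osc_le (indicator A) 1"
  by (auto simp: osc_le_def indicator_def)

lemma dep_on_indicator: "dep_on m (\<lambda>\<omega>. \<omega> \<in> A) \<Longrightarrow> dep_on m (indicator A :: _ \<Rightarrow> real)"
  by (auto simp: dep_on_def indicator_def)

lemma measure_\<nu>: "A \<in> sets borel \<Longrightarrow> measure (\<nu> k \<xi>) A = (T ^^ k) (indicator A) \<xi>"
  using integral_\<nu>[OF bm_indicator, of A k \<xi>] prob_space.emeasure_space_1[OF \<nu>_prob(1), of k \<xi>]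
  by (simp add: \<nu>_prob(2))

text \<open>One step leaves the old past intact behind the new state, so deleting that state undoes
  the step.\<close>

lemma \<nu>_tail: "distr (\<nu> (Suc k) \<xi>) borel tail = \<nu> k \<xi>"
proof -
  have "distr (R \<eta>) borel tail = return borel \<eta>" for \<eta>
  proof -
    interpret prob_space "Q' \<eta>" by (rule Q'_prob)
    have "(\<lambda>y. push y \<eta>) \<in> Q' \<eta> \<rightarrow>\<^sub>M borel"
      unfolding measurable_cong_sets[OF Q'_prob(2) refl] by measurable
    then show ?thesis unfolding R_def by (simp add: distr_distr comp_def)
  qed
  moreover have "R \<in> \<nu> k \<xi> \<rightarrow>\<^sub>M subprob_algebra borel"
    unfolding measurable_cong_sets[OF \<nu>_prob(2) refl] by (intro measurable_prob_algebraD R_meas)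
  ultimately have "distr (\<nu> k \<xi> \<bind> R) borel tail = \<nu> k \<xi> \<bind> return borel"
    by (subst distr_bind[where K=borel]) auto
  then show ?thesis using bind_return''[OF \<nu>_prob(2), of k \<xi>] by simp
qed

text \<open>For \<open>\<omega>\<close> read as a past ending at time \<open>a\<close>, \<open>fr a J \<omega>\<close> restricts it to the times in \<open>J\<close>.\<close>

definition fr :: "int \<Rightarrow> int set \<Rightarrow> (nat \<Rightarrow> 'a) \<Rightarrow> int \<Rightarrow> 'a" where
  "fr a J \<omega> = (\<lambda>t\<in>J. \<omega> (nat (a - t)))"

lemma fr_measurable[measurable]: "fr a J \<in> borel \<rightarrow>\<^sub>M (\<Pi>\<^sub>M t\<in>J. borel)"
  unfolding fr_def by (intro measurable_restrict) simp

lemma fr_vimage[measurable]: "A \<in> sets (\<Pi>\<^sub>M t\<in>J. borel) \<Longrightarrow> fr a J -` A \<in> sets borel"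
  using measurable_sets[OF fr_measurable, of A J a] by simp

lemma fr_Suc: "J \<subseteq> {..a} \<Longrightarrow> fr (a + 1) J \<omega> = fr a J (tail \<omega>)"
  by (auto simp: fr_def tail_def fun_eq_iff Suc_nat_eq_nat_zadd1 algebra_simps)

text \<open>Running \<open>n\<close> steps longer while declaring the end time to be
  \<open>n\<close> later leaves the states at the times in \<open>J\<close> where they were. This
  makes the limits below independent of the end time.\<close>

lemma measure_\<nu>_fr_shift:
  assumes J: "J \<subseteq> {..a}" and A: "A \<in> sets (\<Pi>\<^sub>M t\<in>J. borel)"
  shows "measure (\<nu> (k + n) \<xi>) (fr (a + int n) J -` A) = measure (\<nu> k \<xi>) (fr a J -` A)"
proof (induction n)
  case (Suc n)
  have J': "J \<subseteq> {..a + int n}" using J by auto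
  have "measure (\<nu> (k + n) \<xi>) (fr (a + int n) J -` A) = measure (distr (\<nu> (Suc (k + n)) \<xi>) borel tail) (fr (a + int n) J -` A)"
    unfolding \<nu>_tail ..
  also have "\<dots> = measure (\<nu> (Suc (k + n)) \<xi>) (tail -` (fr (a + int n) J -` A))"
    using A by (subst measure_distr) (auto simp: measurable_cong_sets[OF \<nu>_prob(2) refl] simp del: \<nu>.simps)
  also have "tail -` (fr (a + int n) J -` A) = fr (a + int (Suc n)) J -` A"
    using fr_Suc[OF J'] by (auto simp: algebra_simps)
  finally show ?case using Suc by simp
qed simp

end

locale mixing_chain = chain +
  fixes D \<gamma> :: real
  assumes D: "D > 0" and \<gamma>: "\<gamma> > 0"
    and osc_decay: "\<And>f c m k. bm f \<Longrightarrow> osc_le f c \<Longrightarrow> dep_on m f \<Longrightarrow>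
      osc_le ((T ^^ (k + m)) f) (c * (D * exp (- \<gamma> * real k)))"
begin

section \<open>Convergence of the finite-dimensional laws\<close>

lemma rate_tendsto: "(\<lambda>k. D * exp (- \<gamma> * real k)) \<longlonglongrightarrow> 0"
proof -
  have "(\<lambda>k. exp (- \<gamma>) ^ k) \<longlonglongrightarrow> 0" using \<gamma> by (intro LIMSEQ_realpow_zero) auto
  from tendsto_mult_left[OF this, of D] show ?thesis by (simp add: exp_of_nat_mult[symmetric] mult.commute)
qed

text \<open>The extra l - k steps only average values of the function obtained after k + m steps,
  whose oscillation is already small.\<close>

lemma funpow_T_cauchy:
  assumes f: "bm f" "osc_le f c" "dep_on m f" and \<xi>: "\<xi> \<in> X" "\<xi>' \<in> X" and "k \<le> l"
  shows "\<bar>(T ^^ (k + m)) f \<xi> - (T ^^ (l + m)) f \<xi>'\<bar> \<le> c * (D * exp (- \<gamma> * real k))"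
proof -
  have "(T ^^ (l + m)) f = (T ^^ (l - k)) ((T ^^ (k + m)) f)"
    using \<open>k \<le> l\<close> by (simp flip: funpow_add o_apply[of "T ^^ (l - k)"])
  then show ?thesis
    using funpow_T_close[OF funpow_T_bm[OF f(1)] osc_decay[OF f, of k] \<xi>, of 0 "l - k"] by simp
qed

text \<open>For one end time \<open>a0\<close> the events indexed by \<open>J\<close> depend on
  boundedly many recent coordinates, so their probabilities are Cauchy uniformly in the event. One
  limit measure then serves every admissible end time.\<close>

lemma limit_marginal:
  assumes J: "finite J"
  shows "\<exists>\<mu>'. prob_space \<mu>' \<and> sets \<mu>' = sets (\<Pi>\<^sub>M t\<in>J. borel) \<and>
    (\<forall>a. J \<subseteq> {..a} \<longrightarrow> (\<forall>A\<in>sets (\<Pi>\<^sub>M t\<in>J. borel). (\<lambda>k. measure (\<nu> k \<xi>0) (fr a J -` A)) \<longlonglongrightarrow> measure \<mu>' A))"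
proof -
  define a0 where "a0 = Max (insert 0 J)"
  have a0: "J \<subseteq> {..a0}" using J by (auto simp: a0_def)
  define m where "m = Suc (Max (insert 0 ((\<lambda>t. nat (a0 - t)) ` J)))"
  have m: "nat (a0 - t) < m" if "t \<in> J" for t using that J by (simp add: m_def less_Suc_eq_le)
  have cyl: "dep_on m (indicator (fr a0 J -` A) :: _ \<Rightarrow> real)" for A
  proof (rule dep_on_indicator, unfold dep_on_def, intro allI impI)
    fix \<omega> \<omega>' :: "nat \<Rightarrow> 'a" assume "\<forall>j<m. \<omega> j = \<omega>' j"
    then have "fr a0 J \<omega> = fr a0 J \<omega>'" using m by (auto simp: fr_def)
    then show "(\<omega> \<in> fr a0 J -` A) = (\<omega>' \<in> fr a0 J -` A)" by simp
  qed
  let ?N = "\<Pi>\<^sub>M t\<in>J. (borel :: 'a measure)"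
  have distr: "measure (distr (\<nu> (k + m) \<xi>0) ?N (fr a0 J)) A = measure (\<nu> (k + m) \<xi>0) (fr a0 J -` A)"
    if "A \<in> sets ?N" for k A
    using that by (subst measure_distr) (auto simp: measurable_cong_sets[OF \<nu>_prob(2) refl])
  obtain \<mu>' where \<mu>': "prob_space \<mu>'" "sets \<mu>' = sets ?N"
    "\<And>A. A \<in> sets ?N \<Longrightarrow> (\<lambda>k. measure (distr (\<nu> (k + m) \<xi>0) ?N (fr a0 J)) A) \<longlonglongrightarrow> measure \<mu>' A"
  proof (rule measure_limit_of_uniformly_Cauchy[of "\<lambda>k. distr (\<nu> (k + m) \<xi>0) ?N (fr a0 J)" ?N "\<lambda>k. D * exp (- \<gamma> * real k)"])
    show "prob_space (distr (\<nu> (k + m) \<xi>0) ?N (fr a0 J))" for k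
      by (intro prob_space.prob_space_distr \<nu>_prob) (auto simp: measurable_cong_sets[OF \<nu>_prob(2) refl])
    fix k l A assume A: "A \<in> sets ?N" "k \<le> (l::nat)"
    show "\<bar>measure (distr (\<nu> (k + m) \<xi>0) ?N (fr a0 J)) A - measure (distr (\<nu> (l + m) \<xi>0) ?N (fr a0 J)) A\<bar> \<le> D * exp (- \<gamma> * real k)"
      unfolding distr[OF A(1)] measure_\<nu>[OF fr_vimage[OF A(1)]]
      using funpow_T_cauchy[OF bm_indicator[OF fr_vimage[OF A(1), of a0]] osc_indicator cyl \<xi>0 \<xi>0 A(2)] by simp
  qed (use rate_tendsto in auto)
  have "(\<lambda>k. measure (\<nu> k \<xi>0) (fr a J -` A)) \<longlonglongrightarrow> measure \<mu>' A"
    if a: "J \<subseteq> {..a}" and A: "A \<in> sets ?N" for a A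
  proof -
    have "(\<lambda>k. measure (\<nu> (k + m) \<xi>0) (fr a0 J -` A)) \<longlonglongrightarrow> measure \<mu>' A"
      using \<mu>'(3)[OF A] unfolding distr[OF A] .
    then have l0: "(\<lambda>k. measure (\<nu> k \<xi>0) (fr a0 J -` A)) \<longlonglongrightarrow> measure \<mu>' A"
      by (rule LIMSEQ_offset)
    \<comment> \<open>Both end times are compared with the later one; the shifts only offset the
      index of the sequence.\<close>
    define b where "b = max a a0"
    have "(\<lambda>k. measure (\<nu> (k + nat (b - a0)) \<xi>0) (fr b J -` A)) \<longlonglongrightarrow> measure \<mu>' A"
      using l0 measure_\<nu>_fr_shift[OF a0 A, of _ "nat (b - a0)"] by (simp add: b_def)
    then have "(\<lambda>k. measure (\<nu> k \<xi>0) (fr b J -` A)) \<longlonglongrightarrow> measure \<mu>' A"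
      by (rule LIMSEQ_offset)
    then have "(\<lambda>k. measure (\<nu> (k + nat (b - a)) \<xi>0) (fr b J -` A)) \<longlonglongrightarrow> measure \<mu>' A"
      by (rule LIMSEQ_ignore_initial_segment)
    then show ?thesis
      using measure_\<nu>_fr_shift[OF a A, of _ "nat (b - a)"] by (simp add: b_def)
  qed
  then show ?thesis using \<mu>' by blast
qed

lemma two_sided_limit:
  obtains M where "prob_space M" "sets M = sets (\<Pi>\<^sub>M t\<in>UNIV. borel)"
    "\<And>J a A. finite J \<Longrightarrow> J \<subseteq> {..a} \<Longrightarrow> A \<in> sets (\<Pi>\<^sub>M t\<in>J. borel) \<Longrightarrow>
      (\<lambda>k. measure (\<nu> k \<xi>0) (fr a J -` A)) \<longlonglongrightarrow> measure M {x. restrict x J \<in> A}"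
proof -
  obtain P where P: "\<And>J. finite J \<Longrightarrow> prob_space (P J)" "\<And>J. finite J \<Longrightarrow> sets (P J) = sets (\<Pi>\<^sub>M t\<in>J. borel)"
    "\<And>J a A. finite J \<Longrightarrow> J \<subseteq> {..a} \<Longrightarrow> A \<in> sets (\<Pi>\<^sub>M t\<in>J. borel) \<Longrightarrow>
      (\<lambda>k. measure (\<nu> k \<xi>0) (fr a J -` A)) \<longlonglongrightarrow> measure (P J) A"
    using limit_marginal by metis
  have restr: "(\<lambda>f. restrict f J) \<in> P H \<rightarrow>\<^sub>M (\<Pi>\<^sub>M t\<in>J. borel)"
    if "J \<subseteq> H" "finite H" for J H :: "int set"
    unfolding measurable_cong_sets[OF P(2)[OF that(2)] refl] using that by (intro measurable_restrict_subset)
  have bnd: "J \<subseteq> {..Max (insert 0 J)}" if "finite J" for J :: "int set" using that by auto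
  have pf: "projective_family UNIV P (\<lambda>_. borel)"
  proof (rule projective_family.intro)
    fix J H :: "int set" assume JH: "J \<subseteq> H" "finite H"
    then have J: "finite J" by (auto intro: finite_subset)
    let ?N = "\<Pi>\<^sub>M t\<in>J. (borel :: 'a measure)" and ?D = "distr (P H) (\<Pi>\<^sub>M t\<in>J. borel) (\<lambda>f. restrict f J)"
    have pD: "prob_space ?D" using P(1)[OF JH(2)] restr[OF JH] by (rule prob_space.prob_space_distr)
    show "P J = ?D"
    \<comment> \<open>Consistency holds because both sides are limits of the same probabilities,
      once the end time is taken beyond the larger index set.\<close>
    proof (rule measure_eqI)
      fix A assume "A \<in> sets (P J)"
      then have A: "A \<in> sets ?N" using P(2)[OF J] by simp
      define a where "a = Max (insert 0 H)"
      have a: "H \<subseteq> {..a}" "J \<subseteq> {..a}" using bnd[OF JH(2)] JH(1) by (auto simp: a_def)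
      define A' where "A' = (\<lambda>f. restrict f J) -` A \<inter> space (P H)"
      have A': "A' \<in> sets (\<Pi>\<^sub>M t\<in>H. borel)"
        using measurable_sets[OF restr[OF JH] A] P(2)[OF JH(2)] by (simp add: A'_def)
      have "restrict (fr a H \<omega>) J = fr a J \<omega>" for \<omega>
        using JH(1) by (auto simp: fr_def fun_eq_iff)
      moreover have "fr a H \<omega> \<in> space (P H)" for \<omega>
        using sets_eq_imp_space_eq[OF P(2)[OF JH(2)]] by (simp add: fr_def space_PiM)
      ultimately have "fr a H -` A' = fr a J -` A" by (auto simp: A'_def)
      then have "(\<lambda>k. measure (\<nu> k \<xi>0) (fr a J -` A)) \<longlonglongrightarrow> measure (P H) A'"
        using P(3)[OF JH(2) a(1) A'] by simp
      then have "measure (P J) A = measure (P H) A'"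
        using LIMSEQ_unique P(3)[OF J a(2) A] by blast
      also have "\<dots> = measure ?D A" unfolding A'_def using restr[OF JH] A by (subst measure_distr) auto
      finally show "emeasure (P J) A = emeasure ?D A"
        using finite_measure.emeasure_eq_measure[OF prob_space.finite_measure[OF pD]]
          finite_measure.emeasure_eq_measure[OF prob_space.finite_measure[OF P(1)[OF J]]] by simp
    qed (use P(2)[OF J] in simp)
  qed (use P in auto)
  have supp: "AE x in P J. x i \<in> K" if J: "finite J" "i \<in> J" for J :: "int set" and i
  proof -
    interpret PJ: prob_space "P J" using P(1) J by auto
    define A where "A = {x \<in> space (\<Pi>\<^sub>M t\<in>J. borel). x i \<in> K}"
    have A: "A \<in> sets (\<Pi>\<^sub>M t\<in>J. borel)" unfolding A_def using J(2) by measurable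
    define a where "a = Max (insert 0 J)"
    have "measure (\<nu> k \<xi>0) (fr a J -` A) = 1" for k
    proof -
      interpret nu: prob_space "\<nu> k \<xi>0" by (rule \<nu>_prob)
      have "AE \<omega> in \<nu> k \<xi>0. \<omega> \<in> fr a J -` A"
        using AE_\<nu>[OF \<xi>0, of k] J(2) by (auto elim!: eventually_mono simp: A_def fr_def space_PiM X_component)
      then show ?thesis using fr_vimage[OF A] \<nu>_prob(2) by (subst nu.prob_eq_1) auto
    qed
    then have "(\<lambda>k. 1) \<longlonglongrightarrow> measure (P J) A" using P(3)[OF J(1) bnd[OF J(1)] A] by (simp add: a_def)
    then have "measure (P J) A = 1" using LIMSEQ_unique tendsto_const by blast
    then have "AE x in P J. x \<in> A" using A P(2)[OF J(1)] by (subst PJ.prob_eq_1[symmetric]) auto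
    then show ?thesis by (auto elim!: eventually_mono simp: A_def)
  qed
  have "K \<noteq> {}" using x0 by auto
  obtain M where M: "prob_space M" "sets M = sets (\<Pi>\<^sub>M i\<in>UNIV. borel)"
    "\<And>J. finite J \<Longrightarrow> distr M (\<Pi>\<^sub>M i\<in>J. borel) (\<lambda>x. restrict x J) = P J"
    using Kolmogorov_extension_compact[OF pf compact_K \<open>K \<noteq> {}\<close> supp] by blast
  show thesis
  proof (rule that[OF M(1,2)])
    fix J :: "int set" and a A assume J: "finite J" "J \<subseteq> {..a}" "A \<in> sets (\<Pi>\<^sub>M t\<in>J. (borel :: 'a measure))"
    have "measure (P J) A = measure M {x. restrict x J \<in> A}"
      unfolding M(3)[OF J(1), symmetric] using J sets_eq_imp_space_eq[OF M(2)]
      by (subst measure_distr) (auto simp: measurable_cong_sets[OF M(2) refl] space_PiM vimage_def intro!: measurable_restrict_subset)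
    then show "(\<lambda>k. measure (\<nu> k \<xi>0) (fr a J -` A)) \<longlonglongrightarrow> measure M {x. restrict x J \<in> A}"
      using P(3)[OF J] by simp
  qed
qed

end

subsection \<open>Invariant laws\<close>

context chain begin

section \<open>Invariance of laws of pasts and its reduction to cylinder events\<close>

lemma closed_X: "closed X"
proof -
  have "X = (\<Inter>j. (\<lambda>\<xi>. \<xi> j) -` K)" by (auto simp: past_space_def)
  moreover have "closed ((\<lambda>\<xi> :: nat \<Rightarrow> 'a. \<xi> j) -` K)" for j
    using compact_imp_closed[OF compact_K] by (intro closed_vimage continuous_on_product_coordinates) auto
  ultimately show ?thesis by auto
qed

text \<open>Under \<open>R \<xi>\<close> the tail is \<xi> itself, so its constraint becomes an
  indicator and the newest state has law \<open>Q' \<xi>\<close>. This is the bridge between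
  invariance of a law of pasts and the conditional law of the next state.\<close>

lemma emeasure_bind_R:
  assumes \<sigma>: "sets \<sigma> = sets borel" and A: "A \<in> sets borel" and B: "B \<in> sets borel"
  shows "emeasure (\<sigma> \<bind> R) {\<omega>. \<omega> 0 \<in> B \<and> tail \<omega> \<in> A} = (\<integral>\<^sup>+\<xi>\<in>A. emeasure (Q' \<xi>) B \<partial>\<sigma>)"
proof -
  have E: "{\<omega>. \<omega> 0 \<in> B \<and> tail \<omega> \<in> A} \<in> sets borel"
  proof -
    have "{\<omega>. \<omega> 0 \<in> B \<and> tail \<omega> \<in> A} = (\<lambda>\<omega>. \<omega> 0) -` B \<inter> tail -` A" by auto
    then show ?thesis
      using measurable_sets[OF measurable_product_coordinates[of 0] B] measurable_sets[OF tail_measurable A] by auto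
  qed
  have R: "R \<in> \<sigma> \<rightarrow>\<^sub>M subprob_algebra borel"
    unfolding measurable_cong_sets[OF \<sigma> refl] by (intro measurable_prob_algebraD R_meas)
  have "emeasure (R \<xi>) {\<omega>. \<omega> 0 \<in> B \<and> tail \<omega> \<in> A} = emeasure (Q' \<xi>) B * indicator A \<xi>" for \<xi>
  proof -
    have "(\<lambda>y. push y \<xi>) \<in> Q' \<xi> \<rightarrow>\<^sub>M borel"
      unfolding measurable_cong_sets[OF Q'_prob(2) refl] by measurable
    then have "emeasure (R \<xi>) {\<omega>. \<omega> 0 \<in> B \<and> tail \<omega> \<in> A}
      = emeasure (Q' \<xi>) ((\<lambda>y. push y \<xi>) -` {\<omega>. \<omega> 0 \<in> B \<and> tail \<omega> \<in> A} \<inter> space (Q' \<xi>))"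
      unfolding R_def using E by (rule emeasure_distr)
    also have "(\<lambda>y. push y \<xi>) -` {\<omega>. \<omega> 0 \<in> B \<and> tail \<omega> \<in> A} \<inter> space (Q' \<xi>) = (if \<xi> \<in> A then B else {})"
      using sets_eq_imp_space_eq[OF Q'_prob(2)] by auto
    finally show ?thesis by simp
  qed
  then show ?thesis
    using sets_eq_imp_space_eq[OF \<sigma>] R E by (subst emeasure_bind) auto
qed

definition invariant :: "(nat \<Rightarrow> 'a) measure \<Rightarrow> bool" where
  "invariant \<sigma> \<longleftrightarrow> prob_space \<sigma> \<and> sets \<sigma> = sets borel \<and> (AE \<omega> in \<sigma>. \<omega> \<in> X) \<and> \<sigma> \<bind> R = \<sigma>"

lemma invariant_integral:
  assumes "invariant \<sigma>" "bm f"
  shows "integral\<^sup>L \<sigma> ((T ^^ k) f) = integral\<^sup>L \<sigma> f"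
proof (induction k)
  case (Suc k)
  then show ?case
    using integral_bind_R[OF funpow_T_bm[OF assms(2), of k], of \<sigma>] assms(1) by (simp add: invariant_def)
qed simp

text \<open>Filling with a point of \<open>K\<close> keeps truncated pasts in \<open>X\<close>,
  where the Lipschitz and oscillation bounds are available.\<close>

definition trunc :: "nat \<Rightarrow> (nat \<Rightarrow> 'a) \<Rightarrow> nat \<Rightarrow> 'a" where
  "trunc m \<omega> = (\<lambda>j. if j < m then \<omega> j else x0)"

lemma trunc_measurable[measurable]: "trunc m \<in> borel \<rightarrow>\<^sub>M borel"
  unfolding trunc_def
proof (rule measurable_coordinatewise_then_product)
  fix i show "(\<lambda>\<omega>. if i < m then \<omega> i else x0) \<in> borel_measurable borel" by (cases "i < m") auto
qed

lemma trunc_X: "\<omega> \<in> X \<Longrightarrow> trunc m \<omega> \<in> X"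
  by (auto simp: trunc_def past_space_def x0)

lemma dep_on_trunc: "dep_on m (\<lambda>\<omega>. f (trunc m \<omega>))"
proof -
  have "trunc m \<omega> = trunc m \<omega>'" if "\<forall>j<m. \<omega> j = \<omega>' j" for \<omega> \<omega>'
    using that by (auto simp: trunc_def)
  then show ?thesis unfolding dep_on_def by metis
qed

lemma bm_trunc: "bm f \<Longrightarrow> bm (\<lambda>\<omega>. f (trunc m \<omega>))"
  unfolding bm_def by (auto intro: measurable_compose[OF trunc_measurable])

lemma box_sets:
  assumes "\<And>j. A j \<in> sets (borel :: 'a measure)"
  shows "{\<omega>. \<forall>j<n::nat. \<omega> j \<in> A j} \<in> sets borel"
proof -
  have "{\<omega>. \<forall>j<n. \<omega> j \<in> A j} = (\<Inter>j\<in>{..<n}. (\<lambda>\<omega>. \<omega> j) -` A j)" by auto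
  moreover have "(\<lambda>\<omega>. \<omega> j) -` A j \<in> sets borel" for j
    using measurable_sets[OF measurable_product_coordinates[of j] assms] by simp
  ultimately show ?thesis by (cases "n = 0") auto
qed

lemma box_dep_on: "dep_on n (\<lambda>\<omega>. \<omega> \<in> {\<omega>. \<forall>j<n. \<omega> j \<in> A j})"
  by (simp add: dep_on_def)

lemma box_Suc_eq:
  "{\<omega>. \<omega> 0 \<in> A 0 \<and> (\<forall>j<n. \<omega> (Suc j) \<in> A (Suc j))} = {\<omega> :: nat \<Rightarrow> 'a. \<forall>j<Suc n. \<omega> j \<in> A j}"
  by (auto simp: less_Suc_eq_0_disj)

lemma invariantI_box:
  assumes \<sigma>: "prob_space \<sigma>" "sets \<sigma> = sets borel" "AE \<omega> in \<sigma>. \<omega> \<in> X"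
    and eq: "\<And>A n. (\<And>j. A j \<in> sets borel) \<Longrightarrow>
      emeasure \<sigma> {\<omega>. \<omega> 0 \<in> A 0 \<and> (\<forall>j<n. \<omega> (Suc j) \<in> A (Suc j))} =
      emeasure (\<sigma> \<bind> R) {\<omega>. \<omega> 0 \<in> A 0 \<and> (\<forall>j<n. \<omega> (Suc j) \<in> A (Suc j))}"
  shows "invariant \<sigma>"
proof -
  have \<sigma>a: "\<sigma> \<in> space (prob_algebra borel)" using \<sigma> by (simp add: space_prob_algebra)
  have "\<sigma> \<bind> R = \<sigma>"
  proof (rule seq_measure_eqI)
    show "sets (\<sigma> \<bind> R) = sets borel" by (rule sets_bind'[OF \<sigma>a R_meas])
    show "prob_space (\<sigma> \<bind> R)"
      using measurable_space[OF measurable_bind_prob_space[OF measurable_const[OF \<sigma>a] R_meas, of "count_space UNIV"]]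
      by (simp add: space_prob_algebra)
  qed (use \<sigma> eq in auto)
  then show ?thesis using \<sigma> by (simp add: invariant_def)
qed

end

context mixing_chain begin

text \<open>By invariance the integral of \<open>f\<close> equals that of its iterate, which has
  small oscillation on \<open>X\<close>; the value of this iterate at \<xi> is therefore close to
  its average.\<close>

lemma invariant_close:
  assumes \<sigma>: "invariant \<sigma>" and f: "bm f" "osc_le f c" "dep_on m f" and \<xi>: "\<xi> \<in> X"
  shows "\<bar>integral\<^sup>L (\<nu> (k + m) \<xi>) f - integral\<^sup>L \<sigma> f\<bar> \<le> c * (D * exp (- \<gamma> * real k))"
proof -
  have "\<bar>integral\<^sup>L (\<nu> 0 \<xi>) ((T ^^ (k + m)) f) - integral\<^sup>L \<sigma> ((T ^^ (k + m)) f)\<bar> \<le> c * (D * exp (- \<gamma> * real k))"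
    using osc_decay[OF f, of k] funpow_T_bm[OF f(1), of "k + m"] \<sigma> AE_\<nu>[OF \<xi>, of 0] \<nu>_prob[of 0 \<xi>]
    by (intro integral_diff_le_osc[where N=borel and X=X] X_ne) (auto simp: osc_le_def bm_def invariant_def)
  then show ?thesis
    using invariant_integral[OF \<sigma> f(1)] integral_\<nu>[OF f(1)] integral_\<nu>[OF funpow_T_bm[OF f(1)], of 0 \<xi>] by simp
qed

text \<open>Both numbers are the limit of the same probabilities of the chain started at
  \<open>\<xi>0\<close>.\<close>

lemma invariant_measure_eq:
  assumes \<sigma>: "invariant \<sigma>" "invariant \<sigma>'" and B: "B \<in> sets borel" and cyl: "dep_on m (\<lambda>\<omega>. \<omega> \<in> B)"
  shows "emeasure \<sigma> B = emeasure \<sigma>' B"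
proof -
  have lim: "(\<lambda>k. integral\<^sup>L (\<nu> (k + m) \<xi>0) (indicator B)) \<longlonglongrightarrow> measure s B" if "invariant s" for s
  proof -
    have "space s = UNIV" using that sets_eq_imp_space_eq[of s borel] by (simp add: invariant_def)
    then have "integral\<^sup>L s (indicator B :: _ \<Rightarrow> real) = measure s B" by simp
    then have "\<bar>integral\<^sup>L (\<nu> (k + m) \<xi>0) (indicator B) - measure s B\<bar> \<le> D * exp (- \<gamma> * real k)" for k
      using invariant_close[OF that bm_indicator[OF B] osc_indicator dep_on_indicator[OF cyl] \<xi>0, of k] by simp
    then have "(\<lambda>k. \<bar>integral\<^sup>L (\<nu> (k + m) \<xi>0) (indicator B) - measure s B\<bar>) \<longlonglongrightarrow> 0"
      by (intro tendsto_sandwich[OF _ _ tendsto_const rate_tendsto] always_eventually) auto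
    then show ?thesis by (rule LIM_zero_cancel[OF tendsto_rabs_zero_cancel])
  qed
  have "finite_measure \<sigma>" "finite_measure \<sigma>'"
    using \<sigma> by (auto simp: invariant_def prob_space.finite_measure)
  then show ?thesis
    using LIMSEQ_unique[OF lim[OF \<sigma>(1)] lim[OF \<sigma>(2)]] by (simp add: finite_measure.emeasure_eq_measure)
qed

lemma invariant_unique:
  assumes \<sigma>: "invariant \<sigma>" "invariant \<sigma>'"
  shows "\<sigma> = \<sigma>'"
proof (rule seq_measure_eqI)
  fix n and A :: "nat \<Rightarrow> 'a set" assume A: "\<And>j. A j \<in> sets borel"
  show "emeasure \<sigma> {\<omega>. \<omega> 0 \<in> A 0 \<and> (\<forall>j<n. \<omega> (Suc j) \<in> A (Suc j))} =
      emeasure \<sigma>' {\<omega>. \<omega> 0 \<in> A 0 \<and> (\<forall>j<n. \<omega> (Suc j) \<in> A (Suc j))}"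
    unfolding box_Suc_eq by (rule invariant_measure_eq[OF \<sigma> box_sets[OF A] box_dep_on])
qed (use \<sigma> in \<open>simp_all add: invariant_def\<close>)

text \<open>Convergence is asked for cylinder events only. The event of being eventually equal to
  \<open>x0\<close> has probability 1 under every \<open>\<nu> k \<xi>0\<close>, since the starting
  past is never erased.\<close>

definition limit_law :: "(nat \<Rightarrow> 'a) measure \<Rightarrow> bool" where
  "limit_law \<sigma> \<longleftrightarrow> prob_space \<sigma> \<and> sets \<sigma> = sets borel \<and>
    (\<forall>A\<in>sets borel. \<forall>m. dep_on m (\<lambda>\<omega>. \<omega> \<in> A) \<longrightarrow> (\<lambda>k. measure (\<nu> k \<xi>0) A) \<longlonglongrightarrow> measure \<sigma> A)"

lemma limit_law_AE:
  assumes "limit_law \<sigma>"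
  shows "AE \<omega> in \<sigma>. \<omega> \<in> X"
proof -
  have s: "sets \<sigma> = sets borel" using assms by (simp add: limit_law_def)
  interpret prob_space \<sigma> using assms by (simp add: limit_law_def)
  have "AE \<omega> in \<sigma>. \<omega> j \<in> K" for j
  proof -
    let ?A = "(\<lambda>\<omega>. \<omega> j) -` K"
    have A: "?A \<in> sets borel" using measurable_sets[OF measurable_product_coordinates[of j] K_borel] by simp
    have "measure (\<nu> k \<xi>0) ?A = 1" for k
    proof -
      interpret nu: prob_space "\<nu> k \<xi>0" by (rule \<nu>_prob)
      show ?thesis using A AE_\<nu>[OF \<xi>0, of k] \<nu>_prob(2)
        by (subst nu.prob_eq_1) (auto elim!: eventually_mono intro: X_component)
    qed
    moreover have "dep_on (Suc j) (\<lambda>\<omega>. \<omega> \<in> ?A)" by (auto simp: dep_on_def)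
    ultimately have "(\<lambda>k. 1) \<longlonglongrightarrow> measure \<sigma> ?A" using assms A by (auto simp: limit_law_def)
    then have "measure \<sigma> ?A = 1" using LIMSEQ_unique tendsto_const by blast
    then have "AE \<omega> in \<sigma>. \<omega> \<in> ?A" using A s by (subst prob_eq_1[symmetric]) auto
    then show ?thesis by simp
  qed
  then have "AE \<omega> in \<sigma>. \<forall>j. \<omega> j \<in> K" by (simp add: AE_all_countable)
  then show ?thesis by (simp add: past_space_def)
qed

text \<open>Total variation control is available only for events of the first \<open>m\<close>
  coordinates. Pushing both laws forward by \<open>trunc m\<close> turns every Borel event into such
  an event and leaves the integral of \<open>f\<close> unchanged, so the passage from events to
  functions applies.\<close>

lemma limit_law_close:
  assumes \<sigma>: "limit_law \<sigma>" and f: "bm f" "osc_le f c" "dep_on m f"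
  shows "\<bar>integral\<^sup>L \<sigma> f - (T ^^ (k + m)) f \<xi>0\<bar> \<le> c * (D * exp (- \<gamma> * real k))"
proof -
  have s: "sets \<sigma> = sets borel" and p: "prob_space \<sigma>" using \<sigma> by (auto simp: limit_law_def)
  have [measurable]: "f \<in> borel_measurable borel" using f by (simp add: bm_def)
  have f_trunc: "f (trunc m \<omega>) = f \<omega>" for \<omega> using f(3) by (auto simp: dep_on_def trunc_def)
  obtain l u where lu: "\<And>x. x \<in> X \<Longrightarrow> l \<le> f x" "\<And>x. x \<in> X \<Longrightarrow> f x \<le> u" "u - l \<le> c"
    by (rule obtain_osc_bounds[of X f c]) (use X_ne f(2) in \<open>auto simp: osc_le_def\<close>)
  have in_X: "l \<le> f \<omega> \<and> f \<omega> \<le> l + c" if "\<omega> \<in> X" for \<omega> using lu(1,2)[OF that] lu(3) by auto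
  have tm: "trunc m \<in> N \<rightarrow>\<^sub>M borel" if "sets N = sets borel" for N
    unfolding measurable_cong_sets[OF that refl] by measurable
  let ?tr = "\<lambda>N. distr N borel (trunc m)"
  have tr: "integral\<^sup>L (?tr N) f = integral\<^sup>L N f" if "sets N = sets borel" for N
    using tm[OF that] by (subst integral_distr) (auto simp: f_trunc)
  have ae: "AE \<omega> in ?tr N. l \<le> f \<omega> \<and> f \<omega> \<le> l + c" if "sets N = sets borel" "AE \<omega> in N. \<omega> \<in> X" for N
    using that(2) tm[OF that(1)] by (subst AE_distr_iff) (auto elim!: eventually_mono dest: in_X simp: f_trunc)
  have "\<bar>integral\<^sup>L (?tr \<sigma>) f - integral\<^sup>L (?tr (\<nu> (k + m) \<xi>0)) f\<bar> \<le> c * (D * exp (- \<gamma> * real k))"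
  proof (rule abs_integral_diff_le[where m=l])
    show "prob_space (?tr \<sigma>)" "prob_space (?tr (\<nu> (k + m) \<xi>0))"
      by (intro prob_space.prob_space_distr p \<nu>_prob tm s)+
    fix A assume "A \<in> sets (?tr \<sigma>)"
    then have A: "A \<in> sets borel" by simp
    let ?B = "trunc m -` A"
    have B: "?B \<in> sets borel" using measurable_sets[OF trunc_measurable A] by simp
    have cyl: "dep_on m (\<lambda>\<omega>. \<omega> \<in> ?B)" using dep_on_trunc[of m "\<lambda>\<omega>. \<omega> \<in> A"] by simp
    have eq: "measure (?tr N) A = measure N ?B" if "sets N = sets borel" for N
      using A tm[OF that] sets_eq_imp_space_eq[OF that] by (subst measure_distr) auto
    have "(\<lambda>l. measure (\<nu> (l + m) \<xi>0) ?B) \<longlonglongrightarrow> measure \<sigma> ?B"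
      using \<sigma> B cyl by (intro LIMSEQ_ignore_initial_segment) (auto simp: limit_law_def)
    then have "(\<lambda>l. \<bar>measure (\<nu> (l + m) \<xi>0) ?B - measure (\<nu> (k + m) \<xi>0) ?B\<bar>) \<longlonglongrightarrow> \<bar>measure \<sigma> ?B - measure (\<nu> (k + m) \<xi>0) ?B\<bar>"
      by (intro tendsto_intros)
    moreover have "\<bar>measure (\<nu> (l + m) \<xi>0) ?B - measure (\<nu> (k + m) \<xi>0) ?B\<bar> \<le> D * exp (- \<gamma> * real k)" if "k \<le> l" for l
      using funpow_T_cauchy[OF bm_indicator[OF B] osc_indicator dep_on_indicator[OF cyl] \<xi>0 \<xi>0 that]
      unfolding measure_\<nu>[OF B] by (simp add: abs_minus_commute)
    ultimately show "\<bar>measure (?tr \<sigma>) A - measure (?tr (\<nu> (k + m) \<xi>0)) A\<bar> \<le> D * exp (- \<gamma> * real k)"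
      unfolding eq[OF s] eq[OF \<nu>_prob(2)] by (intro LIMSEQ_le_const2) auto
  qed (use ae[OF s limit_law_AE[OF \<sigma>]] ae[OF \<nu>_prob(2) AE_\<nu>[OF \<xi>0]] in simp_all)
  then show ?thesis unfolding tr[OF s] tr[OF \<nu>_prob(2)] integral_\<nu>[OF f(1)] .
qed

lemma limit_law_tendsto:
  assumes "limit_law \<sigma>" "bm f" "osc_le f c" "dep_on m f"
  shows "(\<lambda>k. (T ^^ k) f \<xi>0) \<longlonglongrightarrow> integral\<^sup>L \<sigma> f"
proof (rule LIMSEQ_offset[of _ m], rule LIM_zero_cancel, rule tendsto_rabs_zero_cancel, rule tendsto_sandwich[OF _ _ tendsto_const])
  show "(\<lambda>k. c * (D * exp (- \<gamma> * real k))) \<longlonglongrightarrow> 0"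
    using tendsto_mult_left[OF rate_tendsto, of c] by simp
  show "\<forall>\<^sub>F k in sequentially. \<bar>(T ^^ (k + m)) f \<xi>0 - integral\<^sup>L \<sigma> f\<bar> \<le> c * (D * exp (- \<gamma> * real k))"
    using limit_law_close[OF assms] by (auto simp: abs_minus_commute)
qed auto

text \<open>
  \<^term>\<open>T f\<close> depends on all coordinates even if \<open>f\<close> does not, but only weakly on the remote ones, so that it
  is a uniform limit of functions of finitely many coordinates.
\<close>

lemma limit_law_T:
  assumes \<sigma>: "limit_law \<sigma>" and f: "bm f" "osc_le f c" "dep_on m f"
  shows "integral\<^sup>L \<sigma> (T f) = integral\<^sup>L \<sigma> f"
proof -
  have s: "sets \<sigma> = sets borel" and p: "prob_space \<sigma>" using \<sigma> by (auto simp: limit_law_def)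
  interpret prob_space \<sigma> by (rule p)
  have c: "c \<ge> 0" using osc_le_nonneg[OF f(2)] .
  \<comment> \<open>The truncation error is paid twice: once under \<open>\<sigma>\<close>, and once
    along the chain, where the step from \<open>k\<close> to \<open>Suc k\<close> identifies the
    limit of the integrals of \<open>T f\<close>.\<close>
  have "\<bar>integral\<^sup>L \<sigma> (T f) - integral\<^sup>L \<sigma> f\<bar> \<le> 2 * (c * C) * \<epsilon>" if \<epsilon>: "\<epsilon> > 0" for \<epsilon>
  proof -
    obtain n0 \<delta> where n0: "n0 \<ge> 1" "\<delta> > 0"
      "\<And>\<omega> \<omega>'. \<omega> \<in> X \<Longrightarrow> \<omega>' \<in> X \<Longrightarrow> (\<And>j. j < n0 \<Longrightarrow> norm (\<omega> j - \<omega>' j) \<le> \<delta>) \<Longrightarrow> d \<omega> \<omega>' \<le> \<epsilon>"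
      using d_close[OF \<epsilon>] by metis
    define n where "n = max n0 m"
    define g where "g \<omega> = T f (trunc n \<omega>)" for \<omega>
    have near: "\<bar>T f \<omega> - g \<omega>\<bar> \<le> c * C * \<epsilon>" if w: "\<omega> \<in> X" for \<omega>
    proof -
      have "\<bar>T f \<omega> - T f (trunc n \<omega>)\<bar> \<le> 0 + c * (C * d \<omega> (trunc n \<omega>))"
      proof (rule T_diff[OF f(1) w trunc_X[OF w]])
        \<comment> \<open>As n \<ge> m, the two pasts extended by the same y agree in all
          coordinates seen by \<open>f\<close>; only the difference of the kernels is left.\<close>
        fix y
        have "push y \<omega> j = push y (trunc n \<omega>) j" if "j < m" for j
          using that by (cases j) (auto simp: trunc_def n_def)
        then have "f (push y \<omega>) = f (push y (trunc n \<omega>))" using f(3) unfolding dep_on_def by blast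
        then show "\<bar>f (push y \<omega>) - f (push y (trunc n \<omega>))\<bar> \<le> 0" by simp
      qed (use f(2) in \<open>auto simp: osc_le_def\<close>)
      also have "d \<omega> (trunc n \<omega>) \<le> \<epsilon>"
        using n0(2) by (intro n0(3) w trunc_X) (auto simp: trunc_def n_def)
      finally show ?thesis using c C by (simp add: g_def mult_left_mono mult.assoc)
    qed
    have Tf: "bm (T f)" "osc_le (T f) c" using T_bm T_osc f by auto
    have g: "bm g" "osc_le g c" "dep_on n g"
      using bm_trunc[OF Tf(1)] Tf(2) trunc_X dep_on_trunc[of n "T f"] by (auto simp: g_def[abs_def] osc_le_def)
    have diff_le: "\<bar>integral\<^sup>L N (T f) - integral\<^sup>L N g\<bar> \<le> c * C * \<epsilon>"
      if N: "prob_space N" "sets N = sets borel" "AE \<omega> in N. \<omega> \<in> X" for N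
    proof -
      interpret N: prob_space N by (rule N)
      note i = bm_integrable[OF Tf(1) N(1,2)] bm_integrable[OF g(1) N(1,2)]
      have "\<bar>\<integral>\<omega>. T f \<omega> - g \<omega> \<partial>N\<bar> \<le> (\<integral>\<omega>. \<bar>T f \<omega> - g \<omega>\<bar> \<partial>N)" by (rule integral_abs_bound)
      also have "\<dots> \<le> (\<integral>\<omega>. c * C * \<epsilon> \<partial>N)"
        using i N(3) near by (intro integral_mono_AE) (auto elim!: eventually_mono)
      finally show ?thesis using i by (simp add: N.prob_space)
    qed
    have "(\<lambda>k. \<bar>(T ^^ Suc k) f \<xi>0 - (T ^^ k) g \<xi>0\<bar>) \<longlonglongrightarrow> \<bar>integral\<^sup>L \<sigma> f - integral\<^sup>L \<sigma> g\<bar>"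
      by (intro tendsto_intros limit_law_tendsto[OF \<sigma> g] LIMSEQ_Suc limit_law_tendsto[OF \<sigma> f])
    moreover have "\<bar>(T ^^ Suc k) f \<xi>0 - (T ^^ k) g \<xi>0\<bar> \<le> c * C * \<epsilon>" for k
      using diff_le[OF \<nu>_prob AE_\<nu>[OF \<xi>0], of k] unfolding integral_\<nu>[OF Tf(1)] integral_\<nu>[OF g(1)]
      by (simp add: funpow_swap1)
    ultimately have "\<bar>integral\<^sup>L \<sigma> f - integral\<^sup>L \<sigma> g\<bar> \<le> c * C * \<epsilon>"
      by (intro LIMSEQ_le_const2) auto
    then show ?thesis using diff_le[OF p s limit_law_AE[OF \<sigma>]] by linarith
  qed
  note * = this
  have le: "\<bar>integral\<^sup>L \<sigma> (T f) - integral\<^sup>L \<sigma> f\<bar> \<le> 0 + e" if "e > 0" for e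
  proof -
    \<comment> \<open>The summand 1 keeps the denominator positive when c = 0.\<close>
    have q: "2 * (c * C) + 1 > 0" using c C by (simp add: add_nonneg_pos)
    then have e: "e / (2 * (c * C) + 1) > 0" using that by simp
    then have "2 * (c * C) * (e / (2 * (c * C) + 1)) \<le> (2 * (c * C) + 1) * (e / (2 * (c * C) + 1))"
      by (intro mult_right_mono) auto
    also have "\<dots> = e" using q by simp
    finally have "2 * (c * C) * (e / (2 * (c * C) + 1)) \<le> e" .
    moreover note e
    ultimately show ?thesis using *[of "e / (2 * (c * C) + 1)"] by linarith
  qed
  have "\<bar>integral\<^sup>L \<sigma> (T f) - integral\<^sup>L \<sigma> f\<bar> \<le> 0" by (rule field_le_epsilon) (rule le)
  then show ?thesis by simp
qed

text \<open>The identity for \<open>T f\<close>, applied to indicators of cylinder events, says that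
  \<open>\<sigma>\<close> and its image under one step agree on them, and such events determine a
  law of pasts.\<close>

lemma limit_law_invariant:
  assumes \<sigma>: "limit_law \<sigma>"
  shows "invariant \<sigma>"
proof (rule invariantI_box)
  show s: "sets \<sigma> = sets borel" and p: "prob_space \<sigma>" using \<sigma> by (auto simp: limit_law_def)
  show "AE \<omega> in \<sigma>. \<omega> \<in> X" by (rule limit_law_AE[OF \<sigma>])
  interpret prob_space \<sigma> by (rule p)
  have \<sigma>a: "\<sigma> \<in> space (prob_algebra borel)" using s p by (simp add: space_prob_algebra)
  have sR: "sets (\<sigma> \<bind> R) = sets borel" by (rule sets_bind'[OF \<sigma>a R_meas])
  interpret R: prob_space "\<sigma> \<bind> R"
    using measurable_space[OF measurable_bind_prob_space[OF measurable_const[OF \<sigma>a] R_meas, of "count_space UNIV"]]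
    by (simp add: space_prob_algebra)
  have eq: "emeasure \<sigma> B = emeasure (\<sigma> \<bind> R) B" if B: "B \<in> sets borel" and cyl: "dep_on m (\<lambda>\<omega>. \<omega> \<in> B)" for B m
  proof -
    have "integral\<^sup>L (\<sigma> \<bind> R) (indicator B) = integral\<^sup>L \<sigma> (indicator B :: _ \<Rightarrow> real)"
      using integral_bind_R[OF bm_indicator[OF B] p s] limit_law_T[OF \<sigma> bm_indicator[OF B] osc_indicator dep_on_indicator[OF cyl]]
      by simp
    then show ?thesis
      using B sets_eq_imp_space_eq[OF s] sets_eq_imp_space_eq[OF sR]
      by (simp add: emeasure_eq_measure R.emeasure_eq_measure)
  qed
  fix A :: "nat \<Rightarrow> 'a set" and n assume A: "\<And>j. A j \<in> sets borel"
  show "emeasure \<sigma> {\<omega>. \<omega> 0 \<in> A 0 \<and> (\<forall>j<n. \<omega> (Suc j) \<in> A (Suc j))} =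
      emeasure (\<sigma> \<bind> R) {\<omega>. \<omega> 0 \<in> A 0 \<and> (\<forall>j<n. \<omega> (Suc j) \<in> A (Suc j))}"
    unfolding box_Suc_eq by (rule eq[OF box_sets[OF A] box_dep_on])
qed

end

subsection \<open>The stationary process\<close>

lemma past_of_measurable:
  fixes \<eta> :: "int \<Rightarrow> 'w \<Rightarrow> 'b::second_countable_topology"
  assumes "\<And>k. \<eta> k \<in> borel_measurable M"
  shows "(\<lambda>\<omega> j. \<eta> (a - int j) \<omega>) \<in> borel_measurable M"
  by (rule measurable_coordinatewise_then_product) (rule assms)

lemma process_measurable:
  assumes "\<And>k. \<eta> k \<in> borel_measurable M"
  shows "(\<lambda>\<omega> k. \<eta> k \<omega>) \<in> M \<rightarrow>\<^sub>M (\<Pi>\<^sub>M k\<in>UNIV. borel)"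
  by (rule measurable_PiM_single') (use assms in auto)

lemma distr_process_law_pst:
  fixes \<eta> :: "int \<Rightarrow> 'w \<Rightarrow> 'b::second_countable_topology"
  assumes "\<And>k. \<eta> k \<in> borel_measurable M"
  shows "distr (process_law M \<eta>) borel (pst a) = distr M borel (\<lambda>\<omega> j. \<eta> (a - int j) \<omega>)"
  unfolding process_law_def
  by (subst distr_distr[OF pst_measurable process_measurable[OF assms]]) (simp add: comp_def pst_def)

lemma stationary_pst:
  fixes \<eta> :: "int \<Rightarrow> 'w \<Rightarrow> 'b::second_countable_topology"
  assumes "stationary_process M \<eta>"
  shows "distr (process_law M \<eta>) borel (pst a) = past_law M \<eta>"
proof -
  have m: "\<eta> k \<in> borel_measurable M" for k using assms by (simp add: stationary_process_def)
  have "distr (process_law M \<eta>) borel (pst 0) = past_law M \<eta>"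
    unfolding distr_process_law_pst[OF m] past_law_def past_of_def[abs_def] by simp
  moreover have "distr (process_law M (\<lambda>k. \<eta> (k + (- a)))) borel (pst a) = distr (process_law M \<eta>) borel (pst 0)"
    unfolding distr_process_law_pst[OF m] by simp
  moreover have "process_law M (\<lambda>k. \<eta> (k + (- a))) = process_law M \<eta>"
    using assms unfolding stationary_process_def by blast
  ultimately show ?thesis by simp
qed

context chain begin

text \<open>The history at time 1 is a state with conditional law \<open>Q\<close> put in front of
  the history at time 0, and by stationarity both histories have the same law.\<close>

lemma has_transition_invariant:
  fixes \<eta> :: "int \<Rightarrow> 'w \<Rightarrow> 'a"
  assumes st: "stationary_process M \<eta>" and tr: "has_transition K Q M \<eta>"
  shows "invariant (past_law M \<eta>)"
proof -
  let ?\<sigma> = "past_law M \<eta>"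
  have m[measurable]: "\<eta> k \<in> borel_measurable M" for k using st by (simp add: stationary_process_def)
  have p: "prob_space M" using st by (simp add: stationary_process_def)
  have pm: "past_of \<eta> \<in> M \<rightarrow>\<^sub>M borel"
    using past_of_measurable[of \<eta> M 0, OF m] by (simp add: past_of_def[abs_def])
  have s: "sets ?\<sigma> = sets borel" by (simp add: past_law_def)
  have sub: "measure_support ?\<sigma> \<subseteq> X" using tr by (simp add: has_transition_def)
  obtain \<kappa> where \<kappa>: "regular_cond_distr M (past_of \<eta>) (\<eta> 1) \<kappa>" "\<And>\<xi>. \<xi> \<in> measure_support ?\<sigma> \<Longrightarrow> \<kappa> \<xi> = Q \<xi>"
    using tr unfolding has_transition_def by blast
  show ?thesis
  proof (rule invariantI_box)
    show "prob_space ?\<sigma>" unfolding past_law_def by (rule prob_space.prob_space_distr[OF p pm])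
    show "sets ?\<sigma> = sets borel" by (rule s)
    show "AE \<omega> in ?\<sigma>. \<omega> \<in> X" by (rule AE_in_of_measure_support[OF s sub X_borel])
    fix A :: "nat \<Rightarrow> 'a set" and n assume A: "\<And>j. A j \<in> sets borel"
    define B where "B = {\<omega>. \<forall>j<n. \<omega> j \<in> A (Suc j)}"
    have B: "B \<in> sets borel" unfolding B_def by (rule box_sets[OF A])
    have box: "{\<omega>. \<omega> 0 \<in> A 0 \<and> (\<forall>j<n. \<omega> (Suc j) \<in> A (Suc j))} = {\<omega>. \<omega> 0 \<in> A 0 \<and> tail \<omega> \<in> B}"
      by (simp add: B_def tail_def)
    have "{\<omega>. \<omega> 0 \<in> A 0 \<and> tail \<omega> \<in> B} = (\<lambda>\<omega>. \<omega> 0) -` A 0 \<inter> tail -` B" by auto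
    then have E: "{\<omega>. \<omega> 0 \<in> A 0 \<and> tail \<omega> \<in> B} \<in> sets borel"
      using measurable_sets[OF measurable_product_coordinates[of 0] A] measurable_sets[OF tail_measurable B] by auto
    have "?\<sigma> = distr M borel (\<lambda>\<omega> j. \<eta> (1 - int j) \<omega>)"
      unfolding stationary_pst[OF st, of 1, symmetric] by (rule distr_process_law_pst[OF m])
    then have "emeasure ?\<sigma> {\<omega>. \<omega> 0 \<in> A 0 \<and> tail \<omega> \<in> B}
        = emeasure M ((\<lambda>\<omega> j. \<eta> (1 - int j) \<omega>) -` {\<omega>. \<omega> 0 \<in> A 0 \<and> tail \<omega> \<in> B} \<inter> space M)"
      using emeasure_distr[OF past_of_measurable[of \<eta> M 1, OF m] E] by simp
    also have "(\<lambda>\<omega> j. \<eta> (1 - int j) \<omega>) -` {\<omega>. \<omega> 0 \<in> A 0 \<and> tail \<omega> \<in> B} \<inter> space M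
        = {\<omega>\<in>space M. past_of \<eta> \<omega> \<in> B \<and> \<eta> 1 \<omega> \<in> A 0}"
      by (auto simp: tail_def past_of_def)
    also have "emeasure M \<dots> = (\<integral>\<^sup>+x\<in>B. emeasure (\<kappa> x) (A 0) \<partial>?\<sigma>)"
      using \<kappa>(1) B A by (simp add: regular_cond_distr_def past_law_def)
    also have "\<dots> = (\<integral>\<^sup>+x\<in>B. emeasure (Q' x) (A 0) \<partial>?\<sigma>)"
    proof (rule nn_integral_cong_AE)
      \<comment> \<open>The kernel \<kappa> is prescribed on the support only, which suffices
        because the support has full measure.\<close>
      have "AE x in ?\<sigma>. x \<in> measure_support ?\<sigma>"
        by (rule AE_in_of_measure_support[OF s order_refl]) (rule borel_closed[OF closed_measure_support])
      then show "AE x in ?\<sigma>. emeasure (\<kappa> x) (A 0) * indicator B x = emeasure (Q' x) (A 0) * indicator B x"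
        using \<kappa>(2) sub by (auto elim!: eventually_mono simp: Q'_eq subset_iff)
    qed
    also have "\<dots> = emeasure (?\<sigma> \<bind> R) {\<omega>. \<omega> 0 \<in> A 0 \<and> tail \<omega> \<in> B}"
      by (rule emeasure_bind_R[OF s B A, symmetric])
    finally show "emeasure ?\<sigma> {\<omega>. \<omega> 0 \<in> A 0 \<and> (\<forall>j<n. \<omega> (Suc j) \<in> A (Suc j))} =
      emeasure (?\<sigma> \<bind> R) {\<omega>. \<omega> 0 \<in> A 0 \<and> (\<forall>j<n. \<omega> (Suc j) \<in> A (Suc j))}"
      unfolding box .
  qed
qed

text \<open>\<open>X\<close> is closed, so its complement is an open null set and cannot meet the
  support.\<close>

lemma support_subset_X:
  assumes "sets \<sigma> = sets borel" "AE \<omega> in \<sigma>. \<omega> \<in> X"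
  shows "measure_support \<sigma> \<subseteq> X"
proof
  fix \<omega> assume w: "\<omega> \<in> measure_support \<sigma>"
  have "- X \<in> null_sets \<sigma>"
    using assms by (subst AE_iff_null_sets) auto
  then have "emeasure \<sigma> (- X) = 0" by auto
  moreover have "open (- X)" using closed_X by auto
  ultimately show "\<omega> \<in> X" using w unfolding measure_support_def by force
qed

end

context mixing_chain begin

text \<open>All histories of a stationary process share the law of its past, which is the only
  invariant law; the histories in turn determine the two-sided law.\<close>

lemma process_law_unique:
  fixes \<eta>1 :: "int \<Rightarrow> 'u \<Rightarrow> 'a" and \<eta>2 :: "int \<Rightarrow> 'v \<Rightarrow> 'a"
  assumes 1: "stationary_process M1 \<eta>1" "has_transition K Q M1 \<eta>1"
    and 2: "stationary_process M2 \<eta>2" "has_transition K Q M2 \<eta>2"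
  shows "process_law M1 \<eta>1 = process_law M2 \<eta>2"
proof (rule two_sided_measure_eqI)
  have "(\<lambda>\<omega> k. \<eta>1 k \<omega>) \<in> M1 \<rightarrow>\<^sub>M (\<Pi>\<^sub>M k\<in>UNIV. borel)"
    using 1 by (intro process_measurable) (auto simp: stationary_process_def)
  then show "prob_space (process_law M1 \<eta>1)"
    unfolding process_law_def using 1 by (intro prob_space.prob_space_distr) (auto simp: stationary_process_def)
  have "past_law M1 \<eta>1 = past_law M2 \<eta>2"
    by (rule invariant_unique[OF has_transition_invariant[OF 1] has_transition_invariant[OF 2]])
  then show "distr (process_law M1 \<eta>1) borel (pst a) = distr (process_law M2 \<eta>2) borel (pst a)" for a
    unfolding stationary_pst[OF 1(1)] stationary_pst[OF 2(1)] .
qed (auto simp: process_law_def)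

text \<open>Translation between the two ways to write a cylinder: \<open>m\<close> recent
  coordinates of a past, and the times a, a - 1, ..., a - m + 1. The map \<open>ext\<close> rebuilds
  a sequence from these values, with \<open>x0\<close> elsewhere, which a cylinder event of length
  \<open>m\<close> does not notice.\<close>

lemma pst_limit_law:
  assumes M: "prob_space M" "sets M = sets (\<Pi>\<^sub>M t\<in>UNIV. (borel :: 'a measure))"
    and lim: "\<And>J a A. finite J \<Longrightarrow> J \<subseteq> {..a} \<Longrightarrow> A \<in> sets (\<Pi>\<^sub>M t\<in>J. borel) \<Longrightarrow>
      (\<lambda>k. measure (\<nu> k \<xi>0) (fr a J -` A)) \<longlonglongrightarrow> measure M {x. restrict x J \<in> A}"
  shows "limit_law (distr M borel (pst a))"
proof -
  have pm: "pst a \<in> M \<rightarrow>\<^sub>M borel" unfolding measurable_cong_sets[OF M(2) refl] by (rule pst_measurable)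
  have sM: "space M = UNIV" using sets_eq_imp_space_eq[OF M(2)] by (simp add: space_PiM)
  have "(\<lambda>k. measure (\<nu> k \<xi>0) A) \<longlonglongrightarrow> measure (distr M borel (pst a)) A"
    if A: "A \<in> sets borel" and cyl: "dep_on m (\<lambda>\<omega>. \<omega> \<in> A)" for A m
  proof -
    let ?J = "(\<lambda>j. a - int j) ` {..<m}"
    define ext :: "(int \<Rightarrow> 'a) \<Rightarrow> nat \<Rightarrow> 'a" where "ext y = (\<lambda>j. if j < m then y (a - int j) else x0)" for y
    have ext: "ext \<in> (\<Pi>\<^sub>M t\<in>?J. borel) \<rightarrow>\<^sub>M borel"
    proof (rule measurable_coordinatewise_then_product)
      fix j show "(\<lambda>y. ext y j) \<in> borel_measurable (\<Pi>\<^sub>M t\<in>?J. borel)"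
        unfolding ext_def by (cases "j < m") (auto intro!: measurable_component_singleton)
    qed
    define E where "E = ext -` A \<inter> space (\<Pi>\<^sub>M t\<in>?J. (borel :: 'a measure))"
    have E: "E \<in> sets (\<Pi>\<^sub>M t\<in>?J. borel)" unfolding E_def by (rule measurable_sets[OF ext A])
    have "ext (fr a ?J \<omega>) \<in> A \<longleftrightarrow> \<omega> \<in> A" for \<omega>
      using cyl unfolding dep_on_def by (rule allE[of _ "ext (fr a ?J \<omega>)"]) (auto simp: ext_def fr_def)
    then have "fr a ?J -` E = A" by (auto simp: E_def fr_def space_PiM)
    moreover have "ext (restrict x ?J) \<in> A \<longleftrightarrow> pst a x \<in> A" for x
      using cyl unfolding dep_on_def by (rule allE[of _ "ext (restrict x ?J)"]) (auto simp: ext_def pst_def)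
    then have "{x. restrict x ?J \<in> E} = pst a -` A \<inter> space M" by (auto simp: E_def space_PiM sM)
    moreover have "measure (distr M borel (pst a)) A = measure M (pst a -` A \<inter> space M)"
      by (rule measure_distr[OF pm A])
    moreover have "?J \<subseteq> {..a}" by auto
    ultimately show ?thesis using lim[of ?J a E] E by simp
  qed
  then show ?thesis
    using prob_space.prob_space_distr[OF M(1) pm] by (simp add: limit_law_def)
qed

text \<open>Test functions bounded by 1 have oscillation at most 2, which is the factor 2. As
  functions of a past they depend on \<open>m\<close> coordinates, so the rate applies uniformly in
  \<open>m\<close> and in the start.\<close>

lemma dual_lip_dist_le:
  assumes \<sigma>: "invariant \<sigma>" and \<xi>: "\<xi> \<in> X"
  shows "dual_lip_dist (power_dist m) (last_kernel Q K k m \<xi>) (distr \<sigma> (\<Pi>\<^sub>M i\<in>{1..m}. borel) (block m))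
    \<le> 2 * D * exp (- \<gamma> * real k)"
  unfolding dual_lip_dist_def
proof (rule cSup_least)
  let ?N = "\<Pi>\<^sub>M i\<in>{1..m}. (borel :: 'a measure)"
  let ?\<mu> = "last_kernel Q K k m \<xi>" and ?\<mu>' = "distr \<sigma> ?N (block m)"
  show "{\<bar>integral\<^sup>L ?\<mu> f - integral\<^sup>L ?\<mu>' f\<bar> | f. (\<forall>x\<in>space ?\<mu>. \<bar>f x\<bar> \<le> 1) \<and>
      (\<forall>x\<in>space ?\<mu>. \<forall>y\<in>space ?\<mu>. \<bar>f x - f y\<bar> \<le> power_dist m x y)} \<noteq> {}"
    by (auto intro!: exI[of _ "\<lambda>_. 0"] sum_nonneg simp: power_dist_def)
  fix z assume "z \<in> {\<bar>integral\<^sup>L ?\<mu> f - integral\<^sup>L ?\<mu>' f\<bar> | f. (\<forall>x\<in>space ?\<mu>. \<bar>f x\<bar> \<le> 1) \<and>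
      (\<forall>x\<in>space ?\<mu>. \<forall>y\<in>space ?\<mu>. \<bar>f x - f y\<bar> \<le> power_dist m x y)}"
  then obtain f where z: "z = \<bar>integral\<^sup>L ?\<mu> f - integral\<^sup>L ?\<mu>' f\<bar>" and f1: "\<And>x. x \<in> space ?\<mu> \<Longrightarrow> \<bar>f x\<bar> \<le> 1"
    by blast
  have \<sigma>s: "sets \<sigma> = sets borel" using \<sigma> by (simp add: invariant_def)
  have bl: "block m \<in> N \<rightarrow>\<^sub>M ?N" if "sets N = sets borel" for N
    unfolding measurable_cong_sets[OF that refl] by (rule block_meas)
  have sp: "sets ?\<mu> = sets ?N" "sets ?\<mu>' = sets ?N" by (auto simp: last_kernel_eq[OF \<xi>])
  show "z \<le> 2 * D * exp (- \<gamma> * real k)"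
  proof (cases "f \<in> borel_measurable ?N")
    case True
    have "block m \<omega> \<in> space ?\<mu>" for \<omega>
      unfolding sets_eq_imp_space_eq[OF sp(1)] by (auto simp: block_def space_PiM)
    then have b: "\<bar>f (block m \<omega>)\<bar> \<le> 1" for \<omega> using f1 by blast
    have bm: "bm (\<lambda>\<omega>. f (block m \<omega>))"
      using b measurable_compose[OF block_meas True] by (auto simp: bm_def)
    have osc: "osc_le (\<lambda>\<omega>. f (block m \<omega>)) 2"
      unfolding osc_le_def
    proof (intro ballI)
      fix \<omega> \<omega>' show "\<bar>f (block m \<omega>) - f (block m \<omega>')\<bar> \<le> 2" using b[of \<omega>] b[of \<omega>'] by linarith
    qed
    have "block m \<omega> = block m \<omega>'" if "\<forall>j<m. \<omega> j = \<omega>' j" for \<omega> \<omega>' :: "nat \<Rightarrow> 'a"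
      using that by (auto simp: block_def fun_eq_iff)
    then have dep: "dep_on m (\<lambda>\<omega>. f (block m \<omega>))" unfolding dep_on_def by metis
    have "integral\<^sup>L ?\<mu> f = integral\<^sup>L (\<nu> (k + m) \<xi>) (\<lambda>\<omega>. f (block m \<omega>))"
      unfolding last_kernel_eq[OF \<xi>] by (rule integral_distr[OF bl[OF \<nu>_prob(2)] True])
    moreover have "integral\<^sup>L ?\<mu>' f = integral\<^sup>L \<sigma> (\<lambda>\<omega>. f (block m \<omega>))"
      by (rule integral_distr[OF bl[OF \<sigma>s] True])
    ultimately show ?thesis
      using invariant_close[OF \<sigma> bm osc dep \<xi>, of k] unfolding z by (simp add: mult.assoc)
  next
    \<comment> \<open>For a non-measurable test function both integrals are 0 by convention.\<close>
    case False
    then have "\<not> integrable ?\<mu> f" "\<not> integrable ?\<mu>' f"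
      using measurable_cong_sets[OF sp(1) refl] measurable_cong_sets[OF sp(2) refl] by (auto dest: borel_measurable_integrable)
    then show ?thesis using D unfolding z by (simp add: not_integrable_integral_eq)
  qed
qed

text \<open>The process consists of the coordinates under the two-sided limit. The law of its
  history at every time is invariant, and uniqueness makes these laws equal; that is
  stationarity.\<close>

lemma stationary_process_exists:
  obtains M :: "(int \<Rightarrow> 'a) measure" and \<eta>
  where "stationary_process M \<eta>" "has_transition K Q M \<eta>"
    "\<And>m k \<xi>. \<xi> \<in> X \<Longrightarrow> dual_lip_dist (power_dist m) (last_kernel Q K k m \<xi>) (block_law M \<eta> m)
      \<le> 2 * D * exp (- \<gamma> * real k)"
proof -
  let ?U = "\<Pi>\<^sub>M t\<in>(UNIV :: int set). (borel :: 'a measure)"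
  obtain M where M: "prob_space M" "sets M = sets ?U"
    and lim: "\<And>J a A. finite J \<Longrightarrow> J \<subseteq> {..a} \<Longrightarrow> A \<in> sets (\<Pi>\<^sub>M t\<in>J. borel) \<Longrightarrow>
      (\<lambda>k. measure (\<nu> k \<xi>0) (fr a J -` A)) \<longlonglongrightarrow> measure M {x. restrict x J \<in> A}"
    using two_sided_limit by metis
  have sM: "space M = UNIV" using sets_eq_imp_space_eq[OF M(2)] by (simp add: space_PiM)
  define \<eta> :: "int \<Rightarrow> (int \<Rightarrow> 'a) \<Rightarrow> 'a" where "\<eta> k x = x k" for k x
  have m: "\<eta> k \<in> borel_measurable M" for k
    unfolding measurable_cong_sets[OF M(2) refl] \<eta>_def[abs_def] by (rule measurable_component_singleton) simp
  have pm: "pst a \<in> M \<rightarrow>\<^sub>M borel" for a unfolding measurable_cong_sets[OF M(2) refl] by (rule pst_measurable)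
  define \<sigma> where "\<sigma> = distr M borel (pst 0)"
  have inv: "invariant (distr M borel (pst a))" for a
    by (rule limit_law_invariant[OF pst_limit_law[OF M lim]])
  have pst_eq: "distr M borel (pst a) = \<sigma>" for a
    unfolding \<sigma>_def by (rule invariant_unique[OF inv inv])
  have \<sigma>: "invariant \<sigma>" using inv by (simp add: \<sigma>_def)
  have s: "sets \<sigma> = sets borel" by (simp add: \<sigma>_def)
  have st: "stationary_process M \<eta>"
    unfolding stationary_process_def
  proof (intro conjI allI)
    fix n
    show "process_law M (\<lambda>k. \<eta> (k + n)) = process_law M \<eta>"
    proof (rule two_sided_measure_eqI)
      show "prob_space (process_law M (\<lambda>k. \<eta> (k + n)))"
        unfolding process_law_def by (intro prob_space.prob_space_distr M process_measurable m)
      show "distr (process_law M (\<lambda>k. \<eta> (k + n))) borel (pst a) = distr (process_law M \<eta>) borel (pst a)" for a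
        unfolding distr_process_law_pst[OF m] using pst_eq[of "a + n"] pst_eq[of a]
        by (simp add: \<eta>_def pst_def[abs_def] algebra_simps)
    qed (auto simp: process_law_def)
  qed (use M m in auto)
  have past: "past_of \<eta> = pst 0" by (auto simp: past_of_def pst_def \<eta>_def fun_eq_iff)
  then have pl: "past_law M \<eta> = \<sigma>" by (simp add: past_law_def \<sigma>_def)
  have sub: "measure_support \<sigma> \<subseteq> X"
    using \<sigma> by (intro support_subset_X s) (simp add: invariant_def)
  \<comment> \<open>The everywhere defined \<open>Q'\<close> is the required version: it agrees with
    \<open>Q\<close> on \<open>X\<close>, hence on the support.\<close>
  have "regular_cond_distr M (past_of \<eta>) (\<eta> 1) Q'"
    unfolding regular_cond_distr_def past
  proof (intro conjI ballI Q'_meas)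
    fix A :: "(nat \<Rightarrow> 'a) set" and B :: "'a set" assume A: "A \<in> sets borel" and B: "B \<in> sets borel"
    have "{\<omega>. \<omega> 0 \<in> B \<and> tail \<omega> \<in> A} = (\<lambda>\<omega>. \<omega> 0) -` B \<inter> tail -` A" by auto
    then have E: "{\<omega>. \<omega> 0 \<in> B \<and> tail \<omega> \<in> A} \<in> sets borel"
      using measurable_sets[OF measurable_product_coordinates[of 0] B] measurable_sets[OF tail_measurable A] by auto
    have "tail (pst 1 x) = pst 0 x" "pst 1 x 0 = \<eta> 1 x" for x :: "int \<Rightarrow> 'a"
      by (auto simp: tail_def pst_def \<eta>_def fun_eq_iff)
    then have "{\<omega>\<in>space M. pst 0 \<omega> \<in> A \<and> \<eta> 1 \<omega> \<in> B} = pst 1 -` {\<omega>. \<omega> 0 \<in> B \<and> tail \<omega> \<in> A} \<inter> space M"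
      by auto
    then have "emeasure M {\<omega>\<in>space M. pst 0 \<omega> \<in> A \<and> \<eta> 1 \<omega> \<in> B} = emeasure \<sigma> {\<omega>. \<omega> 0 \<in> B \<and> tail \<omega> \<in> A}"
      unfolding pst_eq[of 1, symmetric] using emeasure_distr[OF pm E] by simp
    also have "\<dots> = emeasure (\<sigma> \<bind> R) {\<omega>. \<omega> 0 \<in> B \<and> tail \<omega> \<in> A}"
      using \<sigma> by (simp add: invariant_def)
    also have "\<dots> = (\<integral>\<^sup>+x\<in>A. emeasure (Q' x) B \<partial>\<sigma>)" by (rule emeasure_bind_R[OF s A B])
    finally show "emeasure M {\<omega>\<in>space M. pst 0 \<omega> \<in> A \<and> \<eta> 1 \<omega> \<in> B} = (\<integral>\<^sup>+x\<in>A. emeasure (Q' x) B \<partial>distr M borel (pst 0))"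
      unfolding \<sigma>_def .
  qed
  then have tr: "has_transition K Q M \<eta>"
    unfolding has_transition_def pl using sub Q'_eq by blast
  \<comment> \<open>The states at times 1 to m are the block read from the history at time m, whose
    law is again \<open>\<sigma>\<close>.\<close>
  have "block_law M \<eta> m = distr \<sigma> (\<Pi>\<^sub>M i\<in>{1..m}. borel) (block m)" for m
  proof -
    have "block m (pst (int m) x) = (\<lambda>i\<in>{1..m}. \<eta> (int i) x)" for x
      by (auto simp: block_def pst_def \<eta>_def fun_eq_iff of_nat_diff)
    then show ?thesis
      unfolding pst_eq[of "int m", symmetric] block_law_def
      by (subst distr_distr[OF block_meas pm]) (simp add: comp_def)
  qed
  then show thesis
    using dual_lip_dist_le[OF \<sigma>] by (intro that[OF st tr]) simp
qed

end

text \<open>Differences of probabilities are bounded by 1, so the real supremum is a genuine upper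
  bound.\<close>

lemma abs_measure_diff_le_var_dist:
  assumes "prob_space \<mu>" "prob_space \<nu>" "A \<in> sets \<mu>"
  shows "\<bar>measure \<mu> A - measure \<nu> A\<bar> \<le> var_dist \<mu> \<nu>"
  unfolding var_dist_def
proof (rule cSUP_upper[OF assms(3)])
  have "\<bar>measure \<mu> B - measure \<nu> B\<bar> \<le> 1" for B
    using prob_space.prob_le_1[OF assms(1), of B] prob_space.prob_le_1[OF assms(2), of B]
      measure_nonneg[of \<mu> B] measure_nonneg[of \<nu> B] by linarith
  then show "bdd_above ((\<lambda>B. \<bar>measure \<mu> B - measure \<nu> B\<bar>) ` sets \<mu>)"
    by (intro bdd_aboveI2)
qed

theorem theorem4p2:
  fixes K :: "'a::{banach, second_countable_topology} set"
    and \<iota> :: real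
    and Q :: "(nat \<Rightarrow> 'a) \<Rightarrow> 'a measure"
  assumes "compact K" and "K \<noteq> {}" and "\<iota> > 1"
    and "Q \<in> restrict_space borel (past_space K) \<rightarrow>\<^sub>M prob_algebra borel"
    and "\<forall>\<xi>\<in>past_space K. measure_support (Q \<xi>) \<subseteq> K"
    and "hyp_SF \<iota> K Q"
    and "hyp_DLP \<iota> K Q"
    and "hyp_SR K Q"
  shows "(\<exists>(M :: (int \<Rightarrow> 'a) measure) \<eta>.
            stationary_process M \<eta> \<and> has_transition K Q M \<eta> \<and>
            (\<exists>C>0. \<exists>\<gamma>>0. \<forall>m\<ge>1. \<forall>k.
               (SUP \<xi>\<in>past_space K.
                  dual_lip_dist (power_dist m) (last_kernel Q K k m \<xi>) (block_law M \<eta> m))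
               \<le> C * exp (- \<gamma> * real k))) \<and>
         (\<forall>(M\<^sub>1 :: 'u measure) \<eta>\<^sub>1 (M\<^sub>2 :: 'v measure) \<eta>\<^sub>2.
            stationary_process M\<^sub>1 \<eta>\<^sub>1 \<and> (\<forall>k. AE \<omega> in M\<^sub>1. \<eta>\<^sub>1 k \<omega> \<in> K) \<and> has_transition K Q M\<^sub>1 \<eta>\<^sub>1 \<and>
            stationary_process M\<^sub>2 \<eta>\<^sub>2 \<and> (\<forall>k. AE \<omega> in M\<^sub>2. \<eta>\<^sub>2 k \<omega> \<in> K) \<and> has_transition K Q M\<^sub>2 \<eta>\<^sub>2 \<longrightarrow>
            process_law M\<^sub>1 \<eta>\<^sub>1 = process_law M\<^sub>2 \<eta>\<^sub>2)"
proof -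
  obtain x0 where x0: "x0 \<in> K" using assms(2) by auto
  obtain C where C: "C > 0" "\<And>\<xi> \<xi>'. \<xi> \<in> past_space K \<Longrightarrow> \<xi>' \<in> past_space K \<Longrightarrow>
      var_dist (Q \<xi>) (Q \<xi>') \<le> C * past_dist \<iota> \<xi> \<xi>'"
    using assms(6) unfolding hyp_SF_def by blast
  have Q: "prob_space (Q \<xi>)" "sets (Q \<xi>) = sets borel" if "\<xi> \<in> past_space K" for \<xi>
    using measurable_space[OF assms(4), of \<xi>] that by (auto simp: space_restrict_space space_prob_algebra)
  interpret chain K \<iota> C Q x0
  proof
    show "\<bar>measure (Q \<xi>) A - measure (Q \<xi>') A\<bar> \<le> C * past_dist \<iota> \<xi> \<xi>'"
      if "\<xi> \<in> past_space K" "\<xi>' \<in> past_space K" "A \<in> sets borel" for \<xi> \<xi>' A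
      using abs_measure_diff_le_var_dist[of "Q \<xi>" "Q \<xi>'" A] C(2)[of \<xi> \<xi>'] Q that by force
  qed (use assms x0 C in auto)
  obtain D \<gamma> where rate: "D > 0" "\<gamma> > 0"
    "\<And>f c m k. bm f \<Longrightarrow> osc_le f c \<Longrightarrow> dep_on m f \<Longrightarrow> osc_le ((T ^^ (k + m)) f) (c * (D * exp (- \<gamma> * real k)))"
    using exponential_forgetting[OF assms(8)] by metis
  interpret mixing_chain K \<iota> C Q x0 D \<gamma>
    by unfold_locales (fact rate)+
  obtain M :: "(int \<Rightarrow> 'a) measure" and \<eta> where M: "stationary_process M \<eta>" "has_transition K Q M \<eta>"
    "\<And>m k \<xi>. \<xi> \<in> past_space K \<Longrightarrow> dual_lip_dist (power_dist m) (last_kernel Q K k m \<xi>) (block_law M \<eta> m)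
      \<le> 2 * D * exp (- \<gamma> * real k)"
    using stationary_process_exists by metis
  \<comment> \<open>The estimate is uniform in the starting past and in \<open>m\<close>, so it
    passes to the supremum over the nonempty set of pasts with constant 2 D.\<close>
  have "(SUP \<xi>\<in>past_space K. dual_lip_dist (power_dist m) (last_kernel Q K k m \<xi>) (block_law M \<eta> m))
      \<le> 2 * D * exp (- \<gamma> * real k)" for m k
    using M(3) X_ne by (intro cSUP_least)
  then have "2 * D > 0 \<and> \<gamma> > 0 \<and> (\<forall>m\<ge>1. \<forall>k.
      (SUP \<xi>\<in>past_space K. dual_lip_dist (power_dist m) (last_kernel Q K k m \<xi>) (block_law M \<eta> m))
      \<le> 2 * D * exp (- \<gamma> * real k))"
    using rate by simp
  then have "\<exists>C>0. \<exists>\<gamma>>0. \<forall>m\<ge>1. \<forall>k.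
      (SUP \<xi>\<in>past_space K. dual_lip_dist (power_dist m) (last_kernel Q K k m \<xi>) (block_law M \<eta> m))
      \<le> C * exp (- \<gamma> * real k)"
    by blast
  with M(1,2) show ?thesis
    by (intro conjI exI[of _ M] exI[of _ \<eta>] allI impI process_law_unique) auto
qed

end
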